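(* Let $A$ be a separable exact $C^*$-algebra and let $\alpha$ be an automorphism of $A$. If the Voiculescu-Brown entropy satisfies $ht(\alpha)=0$, then $h_{\mathrm{top}}(S_\alpha)=0$, where $S_\alpha$ is the homeomorphism $\sigma\mapsto\sigma\circ\alpha$ of the closed unit ball $B_1(A^* )$ of the dual of $A$ with the weak$^*$ topology. Hence also $h_{\mathrm{top}}(\tilde T_\alpha)=0$, where $\tilde T_\alpha$ is the homeomorphism $\sigma\mapsto\sigma\circ\alpha$ of the quasi-state space $Q(A)$, and, when $A$ is unital, $h_{\mathrm{top}}(T_\alpha)=0$, where $T_\alpha$ is the homeomorphism $\sigma\mapsto\sigma\circ\alpha$ of the state space $S(A)$.
   Context: Automorphisms of $C^*$-algebras are $^*$-automorphisms. $S(A)$ (for $A$ unital) is the set of positive linear functionals $\phi$ on $A$ with $\phi(1)=1$, and $Q(A)$ is the set of positive linear functionals $\phi$ on $A$ with $\|\phi\|\le 1$; both carry the weak$^*$ topology. Topological entropy: for a homeomorphism $T$ of a compact metrizable space $X$ and a finite open cover $\mathcal U$ of $X$, let $N(\mathcal U)$ be the smallest cardinality of a subcover, put $h_{\mathrm{top}}(T,\mathcal U)=\lim_{n\to\infty}\frac1n\log N(\mathcal U\vee T^{-1}\mathcal U\vee\cdots\vee T^{-(n-1)}\mathcal U)$, and $h_{\mathrm{top}}(T)=\sup_{\mathcal U}h_{\mathrm{top}}(T,\mathcal U)$ over all finite open covers. Voiculescu-Brown entropy: let $A$ be an exact $C^*$-algebra and $\pi:A\to\mathcal B(\mathcal H)$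 a faithful representation. For a finite set $\Omega\subset A$ and $\delta>0$, $\mathrm{CPA}(\pi,\Omega,\delta)$ is the collection of triples $(\phi,\psi,B)$ where $B$ is a finite-dimensional $C^*$-algebra and $\phi:A\to B$, $\psi:B\to\mathcal B(\mathcal H)$ are contractive completely positive linear maps with $\|(\psi\circ\phi)(x)-\pi(x)\|<\delta$ for all $x\in\Omega$. Let $\mathrm{rcp}(\Omega,\delta)$ be the infimum of $\mathrm{rank}\,B$ over all such triples, where rank is the dimension of a maximal abelian $C^*$-subalgebra (this is independent of the choice of $\pi$). For an automorphism $\alpha$ of $A$ set $ht(\alpha,\Omega,\delta)=\limsup_{n\to\infty}\frac1n\log\mathrm{rcp}(\Omega\cup\alpha\Omega\cup\cdots\cup\alpha^{n-1}\Omega,\delta)$, $ht(\alpha,\Omega)=\sup_{\delta>0}ht(\alpha,\Omega,\delta)$, and $ht(\alpha)=\sup_\Omega ht(\alpha,\Omega)$ over all finite $\Omega\subset A$. *)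

theory Defs
  imports "HOL-Analysis.Analysis" "HOL-Library.Extended_Nat"
begin

section \<open>Complex vector spaces, Hilbert spaces and C*-algebras with explicit carriers\<close>

text \<open>
  The definition of exactness and of the Voiculescu-Brown entropy quantify over C*-algebras and
  Hilbert spaces, so these structures are records with carrier sets rather than type classes.
  Algebras are not assumed to have a unit.
\<close>

record 'a cvs =
  cv_carrier :: "'a set"
  cv_add :: "'a \<Rightarrow> 'a \<Rightarrow> 'a"
  cv_zero :: "'a"
  cv_scale :: "complex \<Rightarrow> 'a \<Rightarrow> 'a"

record 'a hilb = "'a cvs" +
  hb_inner :: "'a \<Rightarrow> 'a \<Rightarrow> complex"

record 'a cstar = "'a cvs" +
  cs_mult :: "'a \<Rightarrow> 'a \<Rightarrow> 'a"
  cs_star :: "'a \<Rightarrow> 'a"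
  cs_norm :: "'a \<Rightarrow> real"

definition cv_minus :: "('a, 'm) cvs_scheme \<Rightarrow> 'a \<Rightarrow> 'a \<Rightarrow> 'a" where
  "cv_minus V x y = cv_add V x (cv_scale V (- 1) y)"

definition cv_sum :: "('a, 'm) cvs_scheme \<Rightarrow> 'a list \<Rightarrow> 'a" where
  "cv_sum V xs = foldr (cv_add V) xs (cv_zero V)"

locale complex_vs =
  fixes V :: "('a, 'm) cvs_scheme"
  assumes add_closed: "\<lbrakk>x \<in> cv_carrier V; y \<in> cv_carrier V\<rbrakk> \<Longrightarrow> cv_add V x y \<in> cv_carrier V"
    and zero_closed: "cv_zero V \<in> cv_carrier V"
    and scale_closed: "x \<in> cv_carrier V \<Longrightarrow> cv_scale V c x \<in> cv_carrier V"
    and add_assoc: "\<lbrakk>x \<in> cv_carrier V; y \<in> cv_carrier V; z \<in> cv_carrier V\<rbrakk>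
      \<Longrightarrow> cv_add V (cv_add V x y) z = cv_add V x (cv_add V y z)"
    and add_commute: "\<lbrakk>x \<in> cv_carrier V; y \<in> cv_carrier V\<rbrakk> \<Longrightarrow> cv_add V x y = cv_add V y x"
    and add_zero: "x \<in> cv_carrier V \<Longrightarrow> cv_add V x (cv_zero V) = x"
    and add_inverse: "x \<in> cv_carrier V \<Longrightarrow> cv_add V x (cv_scale V (- 1) x) = cv_zero V"
    and scale_one: "x \<in> cv_carrier V \<Longrightarrow> cv_scale V 1 x = x"
    and scale_scale: "x \<in> cv_carrier V \<Longrightarrow> cv_scale V c (cv_scale V d x) = cv_scale V (c * d) x"
    and scale_add_right: "\<lbrakk>x \<in> cv_carrier V; y \<in> cv_carrier V\<rbrakk>
      \<Longrightarrow> cv_scale V c (cv_add V x y) = cv_add V (cv_scale V c x) (cv_scale V c y)"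
    and scale_add_left: "x \<in> cv_carrier V
      \<Longrightarrow> cv_scale V (c + d) x = cv_add V (cv_scale V c x) (cv_scale V d x)"

text \<open>The library locale \<open>Metric_space\<close> asks the distance to be symmetric and nonnegative on the
  whole type, hence the value 0 off the carrier.\<close>

definition norm_dist :: "('a, 'm) cvs_scheme \<Rightarrow> ('a \<Rightarrow> real) \<Rightarrow> 'a \<Rightarrow> 'a \<Rightarrow> real" where
  "norm_dist V N x y =
     (if x \<in> cv_carrier V \<and> y \<in> cv_carrier V then N (cv_minus V x y) else 0)"

definition hb_norm :: "'a hilb \<Rightarrow> 'a \<Rightarrow> real" where
  "hb_norm H x = sqrt (Re (hb_inner H x x))"

text \<open>Inner products are linear in the first argument.\<close>

locale hilbert_space = complex_vs H for H :: "'a hilb" +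
  assumes inner_add: "\<lbrakk>x \<in> cv_carrier H; y \<in> cv_carrier H; z \<in> cv_carrier H\<rbrakk>
      \<Longrightarrow> hb_inner H (cv_add H x y) z = hb_inner H x z + hb_inner H y z"
    and inner_scale: "\<lbrakk>x \<in> cv_carrier H; y \<in> cv_carrier H\<rbrakk>
      \<Longrightarrow> hb_inner H (cv_scale H c x) y = c * hb_inner H x y"
    and inner_commute: "\<lbrakk>x \<in> cv_carrier H; y \<in> cv_carrier H\<rbrakk>
      \<Longrightarrow> hb_inner H y x = cnj (hb_inner H x y)"
    and inner_nonneg: "x \<in> cv_carrier H \<Longrightarrow> 0 \<le> Re (hb_inner H x x)"
    and inner_definite: "\<lbrakk>x \<in> cv_carrier H; hb_inner H x x = 0\<rbrakk> \<Longrightarrow> x = cv_zero H"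
    and complete: "Metric_space.mcomplete (cv_carrier H) (norm_dist H (hb_norm H))"

definition cs_dist :: "'a cstar \<Rightarrow> 'a \<Rightarrow> 'a \<Rightarrow> real" where
  "cs_dist A = norm_dist A (cs_norm A)"

definition cs_topology :: "'a cstar \<Rightarrow> 'a topology" where
  "cs_topology A = Metric_space.mtopology (cv_carrier A) (cs_dist A)"

locale cstar_algebra = complex_vs A for A :: "'a cstar" +
  assumes mult_closed: "\<lbrakk>x \<in> cv_carrier A; y \<in> cv_carrier A\<rbrakk> \<Longrightarrow> cs_mult A x y \<in> cv_carrier A"
    and star_closed: "x \<in> cv_carrier A \<Longrightarrow> cs_star A x \<in> cv_carrier A"
    and mult_assoc: "\<lbrakk>x \<in> cv_carrier A; y \<in> cv_carrier A; z \<in> cv_carrier A\<rbrakk>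
      \<Longrightarrow> cs_mult A (cs_mult A x y) z = cs_mult A x (cs_mult A y z)"
    and distrib_right: "\<lbrakk>x \<in> cv_carrier A; y \<in> cv_carrier A; z \<in> cv_carrier A\<rbrakk>
      \<Longrightarrow> cs_mult A (cv_add A x y) z = cv_add A (cs_mult A x z) (cs_mult A y z)"
    and distrib_left: "\<lbrakk>x \<in> cv_carrier A; y \<in> cv_carrier A; z \<in> cv_carrier A\<rbrakk>
      \<Longrightarrow> cs_mult A x (cv_add A y z) = cv_add A (cs_mult A x y) (cs_mult A x z)"
    and scale_mult_left: "\<lbrakk>x \<in> cv_carrier A; y \<in> cv_carrier A\<rbrakk>
      \<Longrightarrow> cs_mult A (cv_scale A c x) y = cv_scale A c (cs_mult A x y)"
    and scale_mult_right: "\<lbrakk>x \<in> cv_carrier A; y \<in> cv_carrier A\<rbrakk>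
      \<Longrightarrow> cs_mult A x (cv_scale A c y) = cv_scale A c (cs_mult A x y)"
    and star_star: "x \<in> cv_carrier A \<Longrightarrow> cs_star A (cs_star A x) = x"
    and star_add: "\<lbrakk>x \<in> cv_carrier A; y \<in> cv_carrier A\<rbrakk>
      \<Longrightarrow> cs_star A (cv_add A x y) = cv_add A (cs_star A x) (cs_star A y)"
    and star_scale: "x \<in> cv_carrier A
      \<Longrightarrow> cs_star A (cv_scale A c x) = cv_scale A (cnj c) (cs_star A x)"
    and star_mult: "\<lbrakk>x \<in> cv_carrier A; y \<in> cv_carrier A\<rbrakk>
      \<Longrightarrow> cs_star A (cs_mult A x y) = cs_mult A (cs_star A y) (cs_star A x)"
    and norm_nonneg: "x \<in> cv_carrier A \<Longrightarrow> 0 \<le> cs_norm A x"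
    and norm_definite: "x \<in> cv_carrier A \<Longrightarrow> cs_norm A x = 0 \<longleftrightarrow> x = cv_zero A"
    and norm_triangle: "\<lbrakk>x \<in> cv_carrier A; y \<in> cv_carrier A\<rbrakk>
      \<Longrightarrow> cs_norm A (cv_add A x y) \<le> cs_norm A x + cs_norm A y"
    and norm_scale: "x \<in> cv_carrier A \<Longrightarrow> cs_norm A (cv_scale A c x) = cmod c * cs_norm A x"
    and norm_mult: "\<lbrakk>x \<in> cv_carrier A; y \<in> cv_carrier A\<rbrakk>
      \<Longrightarrow> cs_norm A (cs_mult A x y) \<le> cs_norm A x * cs_norm A y"
    and cstar_identity: "x \<in> cv_carrier A
      \<Longrightarrow> cs_norm A (cs_mult A (cs_star A x) x) = (cs_norm A x)\<^sup>2"
    and complete: "Metric_space.mcomplete (cv_carrier A) (cs_dist A)"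

definition cs_separable :: "'a cstar \<Rightarrow> bool" where
  "cs_separable A \<longleftrightarrow> separable_space (cs_topology A)"

definition is_cs_unit :: "'a cstar \<Rightarrow> 'a \<Rightarrow> bool" where
  "is_cs_unit A e \<longleftrightarrow> e \<in> cv_carrier A \<and>
     (\<forall>x\<in>cv_carrier A. cs_mult A e x = x \<and> cs_mult A x e = x)"


section \<open>Maps, bounded operators and representations\<close>

definition lin_map :: "('a, 'm) cvs_scheme \<Rightarrow> ('b, 'n) cvs_scheme \<Rightarrow> ('a \<Rightarrow> 'b) \<Rightarrow> bool" where
  "lin_map V W f \<longleftrightarrow> f \<in> cv_carrier V \<rightarrow> cv_carrier W \<and>
     (\<forall>x\<in>cv_carrier V. \<forall>y\<in>cv_carrier V. f (cv_add V x y) = cv_add W (f x) (f y)) \<and>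
     (\<forall>c. \<forall>x\<in>cv_carrier V. f (cv_scale V c x) = cv_scale W c (f x))"

definition star_hom :: "'a cstar \<Rightarrow> 'b cstar \<Rightarrow> ('a \<Rightarrow> 'b) \<Rightarrow> bool" where
  "star_hom A B f \<longleftrightarrow> lin_map A B f \<and>
     (\<forall>x\<in>cv_carrier A. \<forall>y\<in>cv_carrier A. f (cs_mult A x y) = cs_mult B (f x) (f y)) \<and>
     (\<forall>x\<in>cv_carrier A. f (cs_star A x) = cs_star B (f x))"

definition star_automorphism :: "'a cstar \<Rightarrow> ('a \<Rightarrow> 'a) \<Rightarrow> bool" where
  "star_automorphism A \<alpha> \<longleftrightarrow> star_hom A A \<alpha> \<and> bij_betw \<alpha> (cv_carrier A) (cv_carrier A)"

definition bounded_ops :: "'h hilb \<Rightarrow> ('h \<Rightarrow> 'h) set" where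
  "bounded_ops H = {T \<in> extensional (cv_carrier H). lin_map H H T \<and>
     (\<exists>C. \<forall>x\<in>cv_carrier H. hb_norm H (T x) \<le> C * hb_norm H x)}"

definition hb_adjoint :: "'h hilb \<Rightarrow> ('h \<Rightarrow> 'h) \<Rightarrow> 'h \<Rightarrow> 'h" where
  "hb_adjoint H T = (THE S. S \<in> bounded_ops H \<and>
     (\<forall>x\<in>cv_carrier H. \<forall>y\<in>cv_carrier H. hb_inner H (T x) y = hb_inner H x (S y)))"

definition BH :: "'h hilb \<Rightarrow> ('h \<Rightarrow> 'h) cstar" where
  "BH H = \<lparr>cv_carrier = bounded_ops H,
     cv_add = (\<lambda>S T. \<lambda>x\<in>cv_carrier H. cv_add H (S x) (T x)),
     cv_zero = (\<lambda>x\<in>cv_carrier H. cv_zero H),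
     cv_scale = (\<lambda>c T. \<lambda>x\<in>cv_carrier H. cv_scale H c (T x)),
     cs_mult = (\<lambda>S T. compose (cv_carrier H) S T),
     cs_star = hb_adjoint H,
     cs_norm = (\<lambda>T. Sup {hb_norm H (T x) | x. x \<in> cv_carrier H \<and> hb_norm H x \<le> 1})\<rparr>"

definition representation :: "'a cstar \<Rightarrow> 'h hilb \<Rightarrow> ('a \<Rightarrow> 'h \<Rightarrow> 'h) \<Rightarrow> bool" where
  "representation A H \<pi> \<longleftrightarrow> star_hom A (BH H) \<pi>"

definition faithful_rep :: "'a cstar \<Rightarrow> 'h hilb \<Rightarrow> ('a \<Rightarrow> 'h \<Rightarrow> 'h) \<Rightarrow> bool" where
  "faithful_rep A H \<pi> \<longleftrightarrow> representation A H \<pi> \<and> inj_on \<pi> (cv_carrier A)"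

definition contractive :: "'a cstar \<Rightarrow> 'b cstar \<Rightarrow> ('a \<Rightarrow> 'b) \<Rightarrow> bool" where
  "contractive A B f \<longleftrightarrow> (\<forall>x\<in>cv_carrier A. cs_norm B (f x) \<le> cs_norm A x)"

text \<open>An element of the C*-algebra of \<open>n \<times> n\<close> matrices over \<open>A\<close> is given by its entries with
  indices below \<open>n\<close>; it is positive iff it has the form \<open>Y\<^sup>* Y\<close>.\<close>

definition mat_pos :: "'a cstar \<Rightarrow> nat \<Rightarrow> (nat \<Rightarrow> nat \<Rightarrow> 'a) \<Rightarrow> bool" where
  "mat_pos A n X \<longleftrightarrow> (\<exists>Y. (\<forall>i<n. \<forall>j<n. Y i j \<in> cv_carrier A) \<and>
     (\<forall>i<n. \<forall>j<n. X i j =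
        cv_sum A (map (\<lambda>k. cs_mult A (cs_star A (Y k i)) (Y k j)) [0..<n])))"

definition completely_positive :: "'a cstar \<Rightarrow> 'b cstar \<Rightarrow> ('a \<Rightarrow> 'b) \<Rightarrow> bool" where
  "completely_positive A B f \<longleftrightarrow> lin_map A B f \<and>
     (\<forall>n X. mat_pos A n X \<longrightarrow> mat_pos B n (\<lambda>i j. f (X i j)))"


section \<open>Exactness\<close>

text \<open>
  An element of an algebraic tensor product is given by a list of elementary tensors.
  The algebraic tensor product of two Hilbert spaces is dense in the Hilbert space tensor product,
  so the norm of \<open>\<Sum> S\<^sub>i \<otimes> T\<^sub>i\<close> can be computed on it.
\<close>

definition tensor_hb_norm :: "'h hilb \<Rightarrow> 'k hilb \<Rightarrow> ('h \<times> 'k) list \<Rightarrow> real" where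
  "tensor_hb_norm H K \<xi> = sqrt (Re (\<Sum>(h, k)\<leftarrow>\<xi>. \<Sum>(h', k')\<leftarrow>\<xi>. hb_inner H h h' * hb_inner K k k'))"

definition tensor_apply ::
  "(('h \<Rightarrow> 'h) \<times> ('k \<Rightarrow> 'k)) list \<Rightarrow> ('h \<times> 'k) list \<Rightarrow> ('h \<times> 'k) list" where
  "tensor_apply t \<xi> = concat (map (\<lambda>(S, T). map (map_prod S T) \<xi>) t)"

definition tensor_op_norm ::
  "'h hilb \<Rightarrow> 'k hilb \<Rightarrow> (('h \<Rightarrow> 'h) \<times> ('k \<Rightarrow> 'k)) list \<Rightarrow> real" where
  "tensor_op_norm H K t = Sup {tensor_hb_norm H K (tensor_apply t \<xi>) | \<xi>.
     set \<xi> \<subseteq> cv_carrier H \<times> cv_carrier K \<and> tensor_hb_norm H K \<xi> \<le> 1}"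

text \<open>
  The minimal (spatial) C*-norm, as the supremum over all pairs of representations.  Cyclic
  representations of \<open>A\<close> act, up to unitary equivalence, on closed subspaces of the space of
  square-summable functions on \<open>A\<close>, so the Hilbert spaces below are all that are needed.
\<close>

definition min_norm :: "'a cstar \<Rightarrow> 'b cstar \<Rightarrow> ('a \<times> 'b) list \<Rightarrow> real" where
  "min_norm A B t = Sup {tensor_op_norm H K (map (map_prod \<pi> \<rho>) t) |
     (H :: ('a \<Rightarrow> complex) hilb) (K :: ('b \<Rightarrow> complex) hilb) \<pi> \<rho>.
     hilbert_space H \<and> hilbert_space K \<and> representation A H \<pi> \<and> representation B K \<rho>}"

definition tensor_minus ::
  "'a cstar \<Rightarrow> ('a \<times> 'b) list \<Rightarrow> ('a \<times> 'b) list \<Rightarrow> ('a \<times> 'b) list" where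
  "tensor_minus A s t = s @ map (map_prod (cv_scale A (- 1)) id) t"

text \<open>
  \<open>A\<close> is exact iff for every short exact sequence \<open>0 \<rightarrow> J \<rightarrow> B \<rightarrow> C \<rightarrow> 0\<close> (that is, for every
  surjective *-homomorphism \<open>q : B \<rightarrow> C\<close>, with \<open>J = ker q\<close>) the sequence
  \<open>0 \<rightarrow> A \<otimes> J \<rightarrow> A \<otimes> B \<rightarrow> A \<otimes> C \<rightarrow> 0\<close> of minimal tensor products is exact.  Exactness at the two
  ends is automatic; exactness in the middle says that every element of \<open>A \<otimes> B\<close> (the limit of a
  Cauchy sequence \<open>t\<close> in the algebraic tensor product) killed by \<open>id \<otimes> q\<close> is a limit of a sequence
  \<open>u\<close> in the algebraic tensor product of \<open>A\<close> and \<open>J\<close>.  Replacing \<open>B\<close> by a separable subalgebra that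
  contains the second legs of all \<open>t n\<close>, one sees that separable \<open>B\<close> suffice, and these have, up to
  isomorphism, carriers in \<^typ>\<open>nat \<Rightarrow> complex\<close>.
\<close>

definition exact_cstar :: "'a cstar \<Rightarrow> bool" where
  "exact_cstar A \<longleftrightarrow> (\<forall>(B :: (nat \<Rightarrow> complex) cstar) (C :: (nat \<Rightarrow> complex) cstar) q.
     cstar_algebra B \<and> cstar_algebra C \<and> star_hom B C q \<and> q ` cv_carrier B = cv_carrier C \<longrightarrow>
     (\<forall>t :: nat \<Rightarrow> ('a \<times> (nat \<Rightarrow> complex)) list.
        (\<forall>n. set (t n) \<subseteq> cv_carrier A \<times> cv_carrier B) \<and>
        (\<forall>\<epsilon>>0. \<exists>N. \<forall>m\<ge>N. \<forall>n\<ge>N. min_norm A B (tensor_minus A (t m) (t n)) < \<epsilon>) \<and>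
        (\<lambda>n. min_norm A C (map (map_prod id q) (t n))) \<longlonglongrightarrow> 0 \<longrightarrow>
        (\<exists>u. (\<forall>n. set (u n) \<subseteq> cv_carrier A \<times> {b \<in> cv_carrier B. q b = cv_zero C}) \<and>
             (\<lambda>n. min_norm A B (tensor_minus A (t n) (u n))) \<longlonglongrightarrow> 0)))"


section \<open>Dimension and rank\<close>

definition lin_comb :: "('a, 'm) cvs_scheme \<Rightarrow> complex list \<Rightarrow> 'a list \<Rightarrow> 'a" where
  "lin_comb V cs bs = cv_sum V (map2 (cv_scale V) cs bs)"

text \<open>\<open>bs\<close> is a basis of the linear subspace \<open>D\<close> of \<open>V\<close>.\<close>

definition is_basis :: "('a, 'm) cvs_scheme \<Rightarrow> 'a set \<Rightarrow> 'a list \<Rightarrow> bool" where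
  "is_basis V D bs \<longleftrightarrow> set bs \<subseteq> D \<and>
     (\<forall>x\<in>D. \<exists>!cs. length cs = length bs \<and> x = lin_comb V cs bs)"

definition has_dim :: "('a, 'm) cvs_scheme \<Rightarrow> 'a set \<Rightarrow> nat \<Rightarrow> bool" where
  "has_dim V D r \<longleftrightarrow> (\<exists>bs. length bs = r \<and> is_basis V D bs)"

definition fin_dim_cstar :: "'b cstar \<Rightarrow> bool" where
  "fin_dim_cstar B \<longleftrightarrow> cstar_algebra B \<and> (\<exists>d. has_dim B (cv_carrier B) d)"

definition cstar_subalgebra :: "'b cstar \<Rightarrow> 'b set \<Rightarrow> bool" where
  "cstar_subalgebra B D \<longleftrightarrow> cv_zero B \<in> D \<and>
     (\<forall>x\<in>D. \<forall>y\<in>D. cv_add B x y \<in> D \<and> cs_mult B x y \<in> D) \<and>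
     (\<forall>x\<in>D. cs_star B x \<in> D \<and> (\<forall>c. cv_scale B c x \<in> D)) \<and>
     closedin (cs_topology B) D"

definition abelian_subalgebra :: "'b cstar \<Rightarrow> 'b set \<Rightarrow> bool" where
  "abelian_subalgebra B D \<longleftrightarrow> cstar_subalgebra B D \<and>
     (\<forall>x\<in>D. \<forall>y\<in>D. cs_mult B x y = cs_mult B y x)"

definition maximal_abelian :: "'b cstar \<Rightarrow> 'b set \<Rightarrow> bool" where
  "maximal_abelian B D \<longleftrightarrow> abelian_subalgebra B D \<and>
     (\<forall>E. abelian_subalgebra B E \<and> D \<subseteq> E \<longrightarrow> E = D)"

text \<open>A relation, because the dimension does not depend on the maximal abelian subalgebra.\<close>

definition has_rank :: "'b cstar \<Rightarrow> nat \<Rightarrow> bool" where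
  "has_rank B r \<longleftrightarrow> (\<exists>D. maximal_abelian B D \<and> has_dim B D r)"


section \<open>Voiculescu-Brown entropy\<close>

text \<open>Every finite-dimensional C*-algebra is isomorphic to one with carrier in
  \<^typ>\<open>nat \<Rightarrow> complex\<close>.\<close>

definition CPA :: "'a cstar \<Rightarrow> 'h hilb \<Rightarrow> ('a \<Rightarrow> 'h \<Rightarrow> 'h) \<Rightarrow> 'a set \<Rightarrow> real \<Rightarrow>
    (('a \<Rightarrow> nat \<Rightarrow> complex) \<times> ((nat \<Rightarrow> complex) \<Rightarrow> 'h \<Rightarrow> 'h) \<times> (nat \<Rightarrow> complex) cstar) set" where
  "CPA A H \<pi> \<Omega> \<delta> = {(\<phi>, \<psi>, B). fin_dim_cstar B \<and>
     completely_positive A B \<phi> \<and> contractive A B \<phi> \<and>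
     completely_positive B (BH H) \<psi> \<and> contractive B (BH H) \<psi> \<and>
     (\<forall>x\<in>\<Omega>. cs_norm (BH H) (cv_minus (BH H) (\<psi> (\<phi> x)) (\<pi> x)) < \<delta>)}"

text \<open>The infimum is \<open>\<infinity>\<close> if there are no such triples.\<close>

definition rcp :: "'a cstar \<Rightarrow> 'h hilb \<Rightarrow> ('a \<Rightarrow> 'h \<Rightarrow> 'h) \<Rightarrow> 'a set \<Rightarrow> real \<Rightarrow> enat" where
  "rcp A H \<pi> \<Omega> \<delta> = Inf {enat r | r. \<exists>\<phi> \<psi> B. (\<phi>, \<psi>, B) \<in> CPA A H \<pi> \<Omega> \<delta> \<and> has_rank B r}"

text \<open>The value \<open>ln 0 = 0\<close> at \<open>rcp = 0\<close> (attained when \<open>B = 0\<close>) is a convention that only matters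
  for the algebra \<open>A = 0\<close>, whose entropy becomes 0.\<close>

definition log_enat :: "enat \<Rightarrow> ereal" where
  "log_enat k = (case k of enat r \<Rightarrow> ereal (ln (real r)) | \<infinity> \<Rightarrow> \<infinity>)"

definition ht_local :: "'a cstar \<Rightarrow> 'h hilb \<Rightarrow> ('a \<Rightarrow> 'h \<Rightarrow> 'h) \<Rightarrow> ('a \<Rightarrow> 'a) \<Rightarrow> 'a set \<Rightarrow> real \<Rightarrow> ereal"
  where "ht_local A H \<pi> \<alpha> \<Omega> \<delta> =
    limsup (\<lambda>n. ereal (1 / real n) * log_enat (rcp A H \<pi> (\<Union>i<n. (\<alpha> ^^ i) ` \<Omega>) \<delta>))"

definition ht :: "'a cstar \<Rightarrow> 'h hilb \<Rightarrow> ('a \<Rightarrow> 'h \<Rightarrow> 'h) \<Rightarrow> ('a \<Rightarrow> 'a) \<Rightarrow> ereal" where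
  "ht A H \<pi> \<alpha> = (SUP \<Omega>\<in>{\<Omega>. finite \<Omega> \<and> \<Omega> \<subseteq> cv_carrier A}. SUP \<delta>\<in>{0<..}. ht_local A H \<pi> \<alpha> \<Omega> \<delta>)"


section \<open>Topological entropy\<close>

definition finite_open_cover :: "'x topology \<Rightarrow> 'x set set \<Rightarrow> bool" where
  "finite_open_cover X \<U> \<longleftrightarrow> finite \<U> \<and> (\<forall>U\<in>\<U>. openin X U) \<and> \<Union>\<U> = topspace X"

definition cover_number :: "'x topology \<Rightarrow> 'x set set \<Rightarrow> nat" where
  "cover_number X \<U> = (LEAST k. \<exists>\<V>. \<V> \<subseteq> \<U> \<and> finite \<V> \<and> \<Union>\<V> = topspace X \<and> card \<V> = k)"

definition cover_join :: "'x set set \<Rightarrow> 'x set set \<Rightarrow> 'x set set" where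
  "cover_join \<U> \<V> = {U \<inter> V | U V. U \<in> \<U> \<and> V \<in> \<V>}"

definition cover_preimage :: "'x topology \<Rightarrow> ('x \<Rightarrow> 'x) \<Rightarrow> 'x set set \<Rightarrow> 'x set set" where
  "cover_preimage X T \<U> = (\<lambda>U. {x \<in> topspace X. T x \<in> U}) ` \<U>"

primrec iterated_join :: "'x topology \<Rightarrow> ('x \<Rightarrow> 'x) \<Rightarrow> 'x set set \<Rightarrow> nat \<Rightarrow> 'x set set" where
  "iterated_join X T \<U> 0 = {topspace X}"
| "iterated_join X T \<U> (Suc n) =
     cover_join (iterated_join X T \<U> n) (cover_preimage X (T ^^ n) \<U>)"

definition htop_cover :: "'x topology \<Rightarrow> ('x \<Rightarrow> 'x) \<Rightarrow> 'x set set \<Rightarrow> real" where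
  "htop_cover X T \<U> = lim (\<lambda>n. 1 / real n * ln (real (cover_number X (iterated_join X T \<U> n))))"

definition htop :: "'x topology \<Rightarrow> ('x \<Rightarrow> 'x) \<Rightarrow> ereal" where
  "htop X T = (SUP \<U>\<in>{\<U>. finite_open_cover X \<U>}. ereal (htop_cover X T \<U>))"


section \<open>The dual space, quasi-states and states\<close>

text \<open>Functionals are functions that are \<^const>\<open>undefined\<close> off the carrier.\<close>

definition lin_functional :: "'a cstar \<Rightarrow> ('a \<Rightarrow> complex) \<Rightarrow> bool" where
  "lin_functional A \<sigma> \<longleftrightarrow> \<sigma> \<in> extensional (cv_carrier A) \<and>
     (\<forall>x\<in>cv_carrier A. \<forall>y\<in>cv_carrier A. \<sigma> (cv_add A x y) = \<sigma> x + \<sigma> y) \<and>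
     (\<forall>c. \<forall>x\<in>cv_carrier A. \<sigma> (cv_scale A c x) = c * \<sigma> x)"

definition dual_space :: "'a cstar \<Rightarrow> ('a \<Rightarrow> complex) set" where
  "dual_space A = {\<sigma>. lin_functional A \<sigma> \<and>
     (\<exists>C. \<forall>x\<in>cv_carrier A. cmod (\<sigma> x) \<le> C * cs_norm A x)}"

definition dual_norm :: "'a cstar \<Rightarrow> ('a \<Rightarrow> complex) \<Rightarrow> real" where
  "dual_norm A \<sigma> = Sup {cmod (\<sigma> x) | x. x \<in> cv_carrier A \<and> cs_norm A x \<le> 1}"

definition dual_ball :: "'a cstar \<Rightarrow> ('a \<Rightarrow> complex) set" where
  "dual_ball A = {\<sigma> \<in> dual_space A. dual_norm A \<sigma> \<le> 1}"

definition positive_functional :: "'a cstar \<Rightarrow> ('a \<Rightarrow> complex) \<Rightarrow> bool" where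
  "positive_functional A \<sigma> \<longleftrightarrow> lin_functional A \<sigma> \<and>
     (\<forall>x\<in>cv_carrier A. \<sigma> (cs_mult A (cs_star A x) x) \<in> \<real>\<^sub>\<ge>\<^sub>0)"

definition quasi_states :: "'a cstar \<Rightarrow> ('a \<Rightarrow> complex) set" where
  "quasi_states A = {\<sigma> \<in> dual_space A. positive_functional A \<sigma> \<and> dual_norm A \<sigma> \<le> 1}"

definition states :: "'a cstar \<Rightarrow> 'a \<Rightarrow> ('a \<Rightarrow> complex) set" where
  "states A e = {\<sigma>. positive_functional A \<sigma> \<and> \<sigma> e = 1}"

text \<open>The weak* topology is the topology of pointwise convergence on \<open>A\<close>.\<close>

definition weak_star :: "'a cstar \<Rightarrow> ('a \<Rightarrow> complex) set \<Rightarrow> ('a \<Rightarrow> complex) topology" where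
  "weak_star A S = subtopology (product_topology (\<lambda>_. euclidean) (cv_carrier A)) S"

definition dual_map :: "'a cstar \<Rightarrow> ('a \<Rightarrow> 'a) \<Rightarrow> ('a \<Rightarrow> complex) \<Rightarrow> 'a \<Rightarrow> complex" where
  "dual_map A \<alpha> \<sigma> = compose (cv_carrier A) \<sigma> \<alpha>"

end

theory Submission
  imports Defs "HOL-Computational_Algebra.Fundamental_Theorem_Algebra"
begin

text \<open>
  Fix a finite set \<open>\<Omega>\<close> of contractions and let \<open>y\<close> run through the elements \<open>\<alpha>\<^sup>i x\<close> with \<open>i < n\<close> and
  \<open>x \<in> \<Omega>\<close>.  If the functionals in the dual ball had exponentially many patterns \<open>Re \<sigma>(y)\<close>, separated in a
  fixed proportion of the coordinates, a Sauer-Shelah argument would give a set of coordinates of positive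
  density on which all sign patterns occur with a fixed gap.  Then every signed sum of the
  corresponding \<open>k\<close> elements has norm at least \<open>c k\<close>, with \<open>k\<close> proportional to \<open>n\<close>.  Faithful
  representations are isometric, so the signed sums of the images \<open>\<phi>(y)\<close> in a finite-dimensional algebra
  \<open>B\<close> of rank \<open>r\<close>, through which the representation factors approximately, are equally large.  But the trace
  of an even power of a random signed sum of contractions is at most \<open>r\<close> times the corresponding moment of a
  random walk, so \<open>r\<close> has to grow exponentially in \<open>n\<close>, and the Voiculescu-Brown entropy is positive.
\<close>

section \<open>Complex vector spaces\<close>

text \<open>Distinct patterns alone need not differ at many coordinates. Families are therefore
  separated in a Hamming-like sense, by a fixed gap at a fixed proportion of the coordinates; double
  counting over pairs then finds a coordinate that splits the family into two substantial parts. The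
  price is an error at a small proportion of times, which Hamming balls absorb at a small
  exponential rate. The rank is the dimension of a maximal abelian subalgebra. Orthogonal
  projections in it serve as diagonal matrix units and define the trace, without a decomposition
  into matrix blocks. A sum of \<open>n\<close> random signs reaches \<open>c * n\<close> with
  exponentially small probability; moments of order proportional to \<open>c^2 * n\<close> detect
  this. Algebras need not have a unit, so square roots live in the unitization: \<open>1 - y\<close>
  is represented by \<open>y\<close>, and \<open>(1 - y)^2 = 1 - z\<close> becomes
  \<open>2 y = z + y^2\<close>. This equation replaces functional calculus in the norm bounds, in
  the positivity of the trace and in the isometry of faithful representations.\<close>

context complex_vs
begin

abbreviation carr where "carr \<equiv> cv_carrier V"
abbreviation vadd (infixl "\<oplus>" 65) where "x \<oplus> y \<equiv> cv_add V x y"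
abbreviation vminus (infixl "\<ominus>" 65) where "x \<ominus> y \<equiv> cv_minus V x y"
abbreviation vscale (infixr "\<odot>" 75) where "c \<odot> x \<equiv> cv_scale V c x"

lemmas closed = add_closed zero_closed scale_closed

lemma minus_closed: "\<lbrakk>x \<in> cv_carrier V; y \<in> cv_carrier V\<rbrakk> \<Longrightarrow> cv_minus V x y \<in> cv_carrier V"
  by (simp add: cv_minus_def closed)

lemma add_left_commute: "\<lbrakk>x \<in> cv_carrier V; y \<in> cv_carrier V; z \<in> cv_carrier V\<rbrakk>
    \<Longrightarrow> cv_add V x (cv_add V y z) = cv_add V y (cv_add V x z)"
  by (metis add_assoc add_commute)

lemma zero_add: "x \<in> cv_carrier V \<Longrightarrow> cv_add V (cv_zero V) x = x"
  by (metis add_zero add_commute zero_closed)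

lemma add_left_cancel:
  assumes "x \<in> cv_carrier V" "y \<in> cv_carrier V" "z \<in> cv_carrier V" "cv_add V x y = cv_add V x z"
  shows "y = z"
proof -
  have *: "cv_add V (cv_scale V (-1) x) (cv_add V x w) = w" if "w \<in> cv_carrier V" for w
    using that assms(1) by (metis add_assoc add_commute add_inverse scale_closed zero_add)
  show ?thesis using * assms by metis
qed

lemma scale_zero_left: "x \<in> cv_carrier V \<Longrightarrow> cv_scale V 0 x = cv_zero V"
  using scale_add_left[of x 1 0] add_left_cancel[of x "cv_scale V 0 x" "cv_zero V"]
  by (simp add: scale_one closed add_zero)

lemma scale_zero_right: "cv_scale V c (cv_zero V) = cv_zero V"
  using scale_scale[of "cv_zero V" c 0] by (simp add: scale_zero_left closed)

section \<open>Linear functionals separate the points of a vector space\<close>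

definition linfun :: "('a \<Rightarrow> complex) \<Rightarrow> bool" where
  "linfun f \<longleftrightarrow> (\<forall>x\<in>cv_carrier V. \<forall>y\<in>cv_carrier V. f (cv_add V x y) = f x + f y) \<and>
     (\<forall>c. \<forall>x\<in>cv_carrier V. f (cv_scale V c x) = c * f x)"

lemma linfun_add: "\<lbrakk>linfun f; x \<in> cv_carrier V; y \<in> cv_carrier V\<rbrakk> \<Longrightarrow> f (cv_add V x y) = f x + f y"
  and linfun_scale: "\<lbrakk>linfun f; x \<in> cv_carrier V\<rbrakk> \<Longrightarrow> f (cv_scale V c x) = c * f x"
  by (auto simp: linfun_def)

lemma linfun_minus: "\<lbrakk>linfun f; x \<in> cv_carrier V; y \<in> cv_carrier V\<rbrakk> \<Longrightarrow> f (cv_minus V x y) = f x - f y"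
  by (simp add: cv_minus_def linfun_add linfun_scale closed)

lemma linfun_zero: "linfun f \<Longrightarrow> f (cv_zero V) = 0"
  using linfun_scale[of f "cv_zero V" 0] by (simp add: closed scale_zero_left)

lemmas linfun_simps = linfun_add linfun_scale linfun_minus linfun_zero

definition is_subspace :: "'a set \<Rightarrow> bool" where
  "is_subspace M \<longleftrightarrow> M \<subseteq> cv_carrier V \<and> cv_zero V \<in> M \<and>
     (\<forall>x\<in>M. \<forall>y\<in>M. cv_add V x y \<in> M) \<and> (\<forall>c. \<forall>x\<in>M. cv_scale V c x \<in> M)"

lemma maximal_subspace_avoiding:
  assumes x: "x \<in> cv_carrier V" "x \<noteq> cv_zero V"
  obtains M where "is_subspace M" "x \<notin> M" "\<And>X. is_subspace X \<Longrightarrow> x \<notin> X \<Longrightarrow> M \<subseteq> X \<Longrightarrow> X = M"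
proof -
  let ?S = "{M. is_subspace M \<and> x \<notin> M}"
  have "\<exists>M\<in>?S. \<forall>X\<in>?S. M \<subseteq> X \<longrightarrow> X = M"
  proof (rule subset_Zorn_nonempty)
    have "{cv_zero V} \<in> ?S" using x by (auto simp: is_subspace_def closed add_zero scale_zero_right)
    then show "?S \<noteq> {}" by blast
  next
    fix \<C> assume ne: "\<C> \<noteq> {}" and ch: "subset.chain ?S \<C>"
    then have sub: "\<And>M. M \<in> \<C> \<Longrightarrow> is_subspace M \<and> x \<notin> M"
      by (auto simp: subset.chain_def)
    have tot: "M \<subseteq> M' \<or> M' \<subseteq> M" if "M \<in> \<C>" "M' \<in> \<C>" for M M'
      using ch that by (auto simp: subset.chain_def)
    have add: "cv_add V u v \<in> \<Union>\<C>" if "u \<in> \<Union>\<C>" "v \<in> \<Union>\<C>" for u v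
    proof -
      obtain M M' where M: "M \<in> \<C>" "u \<in> M" "M' \<in> \<C>" "v \<in> M'" using \<open>u \<in> \<Union>\<C>\<close> \<open>v \<in> \<Union>\<C>\<close> by blast
      then consider "u \<in> M'" | "v \<in> M" using tot by blast
      then show ?thesis using M sub[OF M(1)] sub[OF M(3)] unfolding is_subspace_def
        by cases blast+
    qed
    have "is_subspace (\<Union>\<C>)"
      unfolding is_subspace_def using sub ne add unfolding is_subspace_def by blast
    then show "\<Union>\<C> \<in> ?S" using sub by blast
  qed
  then show ?thesis using that by blast
qed

text \<open>A subspace \<open>M\<close> maximal among those omitting \<open>x\<close> has
  codimension one: every vector is \<open>m + c x\<close> for exactly one \<open>c\<close>, and the
  functional reads off \<open>c\<close>. It need not be continuous; its purpose is to reduce vector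
  identities to identities between complex numbers.\<close>

lemma linfun_exists:
  assumes x: "x \<in> cv_carrier V" "x \<noteq> cv_zero V"
  obtains f where "linfun f" "f x = 1"
proof -
  obtain M where M: "is_subspace M" "x \<notin> M"
    and max: "\<And>X. is_subspace X \<Longrightarrow> x \<notin> X \<Longrightarrow> M \<subseteq> X \<Longrightarrow> X = M"
    using maximal_subspace_avoiding[OF x] by blast
  have Mc: "m \<in> cv_carrier V" if "m \<in> M" for m using M that by (auto simp: is_subspace_def)
  have Madd: "cv_add V m n \<in> M" if "m \<in> M" "n \<in> M" for m n using M that by (auto simp: is_subspace_def)
  have Mscale: "cv_scale V c m \<in> M" if "m \<in> M" for m c using M that by (auto simp: is_subspace_def)
  define R where "R y c \<longleftrightarrow> (\<exists>m\<in>M. y = cv_add V m (cv_scale V c x))" for y c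
  have Radd: "R (cv_add V y z) (c + d)"
    if "y \<in> cv_carrier V" "z \<in> cv_carrier V" "R y c" "R z d" for y z c d
  proof -
    obtain m n where mn: "m \<in> M" "n \<in> M" "y = cv_add V m (cv_scale V c x)" "z = cv_add V n (cv_scale V d x)"
      using \<open>R y c\<close> \<open>R z d\<close> by (auto simp: R_def)
    have "cv_add V y z = cv_add V (cv_add V m n) (cv_scale V (c + d) x)"
      unfolding mn using mn(1,2) x Mc by (simp add: scale_add_left closed add_assoc add_left_commute)
    then show ?thesis using mn Madd R_def by blast
  qed
  have Rscale: "R (cv_scale V d y) (d * c)" if "R y c" for y c d
    using that x Mc Mscale unfolding R_def by (metis scale_add_right scale_scale scale_closed)
  have ex: "\<exists>c. R y c" if y: "y \<in> cv_carrier V" for y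
  proof (cases "y \<in> M")
    case True
    then have "R y 0" unfolding R_def using x Mc by (auto simp: scale_zero_left add_zero intro!: bexI[of _ y])
    then show ?thesis by blast
  next
    case False
    \<comment> \<open>Adjoining \<open>y\<close> to \<open>M\<close> gives a strictly larger
      subspace, which by maximality contains \<open>x\<close>.\<close>
    define X where "X = {cv_add V m (cv_scale V c y) | m c. m \<in> M}"
    have zm: "cv_zero V \<in> M" using M by (simp add: is_subspace_def)
    have "is_subspace X" unfolding is_subspace_def
    proof (intro conjI ballI allI)
      show "X \<subseteq> cv_carrier V" using y Mc by (auto simp: X_def closed)
      show "cv_zero V \<in> X" using zm y
        by (auto simp: X_def scale_zero_left add_zero closed intro!: exI[of _ "cv_zero V"] exI[of _ 0])
      fix u v assume "u \<in> X" "v \<in> X"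
      then obtain m n c d where mn: "m \<in> M" "n \<in> M" "u = cv_add V m (cv_scale V c y)" "v = cv_add V n (cv_scale V d y)"
        by (auto simp: X_def)
      have "cv_add V u v = cv_add V (cv_add V m n) (cv_scale V (c + d) y)"
        unfolding mn using mn(1,2) y Mc by (simp add: scale_add_left closed add_assoc add_left_commute)
      then show "cv_add V u v \<in> X" using mn Madd X_def by blast
    next
      fix c u assume "u \<in> X"
      then obtain m d where mn: "m \<in> M" "u = cv_add V m (cv_scale V d y)"
        by (auto simp: X_def)
      have "cv_scale V c u = cv_add V (cv_scale V c m) (cv_scale V (c * d) y)"
        unfolding mn using mn(1) y Mc by (simp add: closed scale_add_right scale_scale)
      then show "cv_scale V c u \<in> X" using mn Mscale X_def by blast
    qed
    moreover have "M \<subseteq> X"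
    proof
      fix m assume "m \<in> M"
      then have "m = cv_add V m (cv_scale V 0 y)" using y Mc by (simp add: scale_zero_left add_zero)
      then show "m \<in> X" using \<open>m \<in> M\<close> X_def by blast
    qed
    moreover have "y \<in> X"
    proof -
      have "y = cv_add V (cv_zero V) (cv_scale V 1 y)" using y by (simp add: scale_one zero_add)
      then show ?thesis using zm X_def by blast
    qed
    ultimately have "x \<in> X" using max False by blast
    then obtain m c where mc: "m \<in> M" "x = cv_add V m (cv_scale V c y)" by (auto simp: X_def)
    \<comment> \<open>Since \<open>x\<close> is not in \<open>M\<close>, the coefficient of
      \<open>y\<close> is nonzero and \<open>x = m + c y\<close> can be solved for
      \<open>y\<close>.\<close>
    have c: "c \<noteq> 0"
    proof
      assume "c = 0"
      then have "x = m" using mc y Mc by (simp add: scale_zero_left add_zero)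
      then show False using mc M by simp
    qed
    have "cv_add V (cv_scale V (-1/c) m) (cv_scale V (1/c) m) = cv_zero V"
      using scale_add_left[of m "-1/c" "1/c"] Mc[OF mc(1)] by (simp add: scale_zero_left)
    then have "cv_add V (cv_scale V (-1/c) m) (cv_scale V (1/c) x) = y"
      unfolding mc(2) using y Mc[OF mc(1)] c
        add_assoc[of "cv_scale V (-1/c) m" "cv_scale V (1/c) m" y]
      by (simp add: scale_add_right scale_scale closed zero_add scale_one)
    then have "R y (1/c)" unfolding R_def using Mscale mc by metis
    then show ?thesis by blast
  qed
  \<comment> \<open>Two coefficients for one vector would make zero the sum of an element of
    \<open>M\<close> and a nonzero multiple of \<open>x\<close>; after rescaling, \<open>x\<close>
    itself would lie in \<open>M\<close>.\<close>
  have unique: "c = d" if "R y c" "R y d" "y \<in> cv_carrier V" for y c d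
  proof (rule ccontr)
    assume "c \<noteq> d"
    have "R (cv_add V y (cv_scale V (-1) y)) (c + (-1) * d)"
      using that by (intro Radd Rscale) (auto simp: closed)
    then have "R (cv_zero V) (c - d)" using that by (simp add: add_inverse)
    then have "R (cv_scale V (1/(c-d)) (cv_zero V)) (1/(c-d) * (c-d))" by (rule Rscale)
    then have "R (cv_zero V) 1" using \<open>c \<noteq> d\<close> by (simp add: scale_zero_right)
    then obtain m where m: "m \<in> M" "cv_zero V = cv_add V m x" using x by (auto simp: R_def scale_one)
    have "x = cv_scale V (-1) m"
      by (metis add_left_cancel add_inverse scale_closed m x(1) Mc)
    then show False using M m Mscale by blast
  qed
  define f where "f y = (THE c. R y c)" for y
  have f: "f y = c" if "R y c" "y \<in> cv_carrier V" for y c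
    unfolding f_def using unique that by blast
  have fR: "R y (f y)" if "y \<in> cv_carrier V" for y using ex[OF that] f that by metis
  have "linfun f" unfolding linfun_def
    using f fR Radd Rscale by (simp add: closed)
  moreover have "R x 1" unfolding R_def using x M
    by (auto simp: scale_one zero_add is_subspace_def intro!: bexI[of _ "cv_zero V"])
  then have "f x = 1" using f x by blast
  ultimately show ?thesis using that by blast
qed

lemma minus_eq_zero_iff:
  assumes "x \<in> cv_carrier V" "y \<in> cv_carrier V"
  shows "cv_minus V x y = cv_zero V \<longleftrightarrow> x = y"
proof
  assume "cv_minus V x y = cv_zero V"
  then have "cv_add V (cv_scale V (-1) y) x = cv_add V (cv_scale V (-1) y) y"
    using assms by (simp add: cv_minus_def add_commute[of "cv_scale V (-1) y"] closed add_inverse)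
  then show "x = y" by (rule add_left_cancel[rotated 3]) (simp_all add: assms closed)
qed (simp add: assms cv_minus_def add_inverse)

text \<open>Vector identities are checked after applying an arbitrary linear functional.\<close>

lemma lin_eqI:
  assumes "x \<in> cv_carrier V" "y \<in> cv_carrier V" and eq: "\<And>f. linfun f \<Longrightarrow> f x = f y"
  shows "x = y"
proof (rule ccontr)
  assume "x \<noteq> y"
  then obtain f where f: "linfun f" "f (cv_minus V x y) = 1"
    using linfun_exists minus_eq_zero_iff minus_closed assms(1,2) by metis
  then show False using eq[OF f(1)] assms by (simp add: linfun_simps)
qed

primrec vsum :: "(nat \<Rightarrow> 'a) \<Rightarrow> nat \<Rightarrow> 'a" where
  "vsum f 0 = cv_zero V"
| "vsum f (Suc n) = cv_add V (vsum f n) (f n)"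

lemma vsum_closed: "(\<And>i. i < n \<Longrightarrow> f i \<in> cv_carrier V) \<Longrightarrow> vsum f n \<in> cv_carrier V"
  by (induction n) (auto simp: closed)

lemma linfun_vsum: "\<lbrakk>linfun g; \<And>i. i < n \<Longrightarrow> f i \<in> cv_carrier V\<rbrakk> \<Longrightarrow> g (vsum f n) = (\<Sum>i<n. g (f i))"
  by (induction n) (auto simp: linfun_simps vsum_closed)

lemma vsum_cong: "(\<And>i. i < n \<Longrightarrow> f i = g i) \<Longrightarrow> vsum f n = vsum g n"
  by (induction n) auto

end

lemma lin_map_vsum:
  assumes "complex_vs V" "complex_vs W" "lin_map V W T" "\<And>i. i < n \<Longrightarrow> f i \<in> cv_carrier V"
  shows "T (complex_vs.vsum V f n) = complex_vs.vsum W (\<lambda>i. T (f i)) n"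
  using assms(4)
proof (induction n)
  case 0
  interpret V: complex_vs V by fact
  interpret W: complex_vs W by fact
  have "T (cv_zero V) = T (cv_scale V 0 (cv_zero V))" by (simp add: V.closed V.scale_zero_left)
  also have "\<dots> = cv_scale W 0 (T (cv_zero V))" using assms(3) V.zero_closed unfolding lin_map_def by blast
  also have "\<dots> = cv_zero W" using assms(3) V.zero_closed unfolding lin_map_def by (intro W.scale_zero_left) auto
  finally show ?case by simp
next
  case (Suc n)
  interpret V: complex_vs V by fact
  interpret W: complex_vs W by fact
  show ?case using Suc assms(3) V.vsum_closed[of n f] by (simp add: lin_map_def)
qed

section \<open>Norms and limits, shared by C*-algebras and Hilbert spaces\<close>

locale normed_vs = complex_vs V for V :: "('a, 'm) cvs_scheme" +
  fixes N :: "'a \<Rightarrow> real"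
  assumes nonneg: "x \<in> cv_carrier V \<Longrightarrow> 0 \<le> N x"
    and definite: "x \<in> cv_carrier V \<Longrightarrow> N x = 0 \<longleftrightarrow> x = cv_zero V"
    and triangle: "\<lbrakk>x \<in> cv_carrier V; y \<in> cv_carrier V\<rbrakk> \<Longrightarrow> N (cv_add V x y) \<le> N x + N y"
    and scale: "x \<in> cv_carrier V \<Longrightarrow> N (cv_scale V c x) = cmod c * N x"
begin

lemma N_minus_commute:
  assumes "x \<in> cv_carrier V" "y \<in> cv_carrier V"
  shows "N (cv_minus V x y) = N (cv_minus V y x)"
proof -
  have "cv_minus V x y = cv_scale V (-1) (cv_minus V y x)"
    by (rule lin_eqI) (use assms in \<open>auto simp: linfun_simps closed minus_closed algebra_simps\<close>)
  then show ?thesis using assms by (simp add: scale minus_closed)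
qed

lemma N_minus_triangle:
  assumes "x \<in> cv_carrier V" "y \<in> cv_carrier V" "z \<in> cv_carrier V"
  shows "N (cv_minus V x z) \<le> N (cv_minus V x y) + N (cv_minus V y z)"
proof -
  have "cv_minus V x z = cv_add V (cv_minus V x y) (cv_minus V y z)"
    by (rule lin_eqI) (use assms in \<open>auto simp: linfun_simps closed minus_closed algebra_simps\<close>)
  then show ?thesis using assms by (simp add: triangle minus_closed)
qed

lemma N_minus_le:
  assumes "x \<in> cv_carrier V" "y \<in> cv_carrier V"
  shows "N (cv_minus V x y) \<le> N x + N y"
  using triangle[of x "cv_scale V (-1) y"] assms by (simp add: cv_minus_def closed scale)

lemma N_zero: "N (cv_zero V) = 0" using definite zero_closed by blast

lemma N_vsum: "(\<And>i. i < n \<Longrightarrow> f i \<in> cv_carrier V) \<Longrightarrow> N (vsum f n) \<le> (\<Sum>i<n. N (f i))"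
proof (induction n)
  case (Suc n)
  then show ?case using triangle[of "vsum f n" "f n"] by (force simp: vsum_closed)
qed (simp add: N_zero)

lemma metric: "Metric_space (cv_carrier V) (norm_dist V N)"
proof
  show "0 \<le> norm_dist V N x y" for x y by (simp add: norm_dist_def nonneg minus_closed)
  show "norm_dist V N x y = norm_dist V N y x" for x y by (simp add: norm_dist_def N_minus_commute)
  show "norm_dist V N x y = 0 \<longleftrightarrow> x = y" if "x \<in> cv_carrier V" "y \<in> cv_carrier V" for x y
    using that by (simp add: norm_dist_def definite minus_closed minus_eq_zero_iff)
  show "norm_dist V N x z \<le> norm_dist V N x y + norm_dist V N y z"
    if "x \<in> cv_carrier V" "y \<in> cv_carrier V" "z \<in> cv_carrier V" for x y z
    using that by (simp add: norm_dist_def N_minus_triangle)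
qed

lemma limit_unique:
  assumes "\<And>n. x n \<in> cv_carrier V" "y \<in> cv_carrier V" "z \<in> cv_carrier V"
    and "(\<lambda>n. N (cv_minus V (x n) y)) \<longlonglongrightarrow> 0" "(\<lambda>n. N (cv_minus V (x n) z)) \<longlonglongrightarrow> 0"
  shows "y = z"
proof -
  have "N (cv_minus V y z) \<le> N (cv_minus V (x n) y) + N (cv_minus V (x n) z)" for n
    using N_minus_triangle[of y "x n" z] N_minus_commute[of y "x n"] assms by simp
  then have "N (cv_minus V y z) \<le> 0"
    using tendsto_lowerbound[OF tendsto_add[OF assms(4,5)]] by (simp add: always_eventually)
  then have "N (cv_minus V y z) = 0" using nonneg[OF minus_closed[OF assms(2,3)]] by simp
  then show ?thesis using assms(2,3) by (metis definite minus_closed minus_eq_zero_iff)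
qed

lemma complete_limit:
  assumes comp: "Metric_space.mcomplete (cv_carrier V) (norm_dist V N)"
    and x: "\<And>n. x n \<in> cv_carrier V"
    and cauchy: "\<And>\<epsilon>. \<epsilon> > 0 \<Longrightarrow> \<exists>K. \<forall>m\<ge>K. \<forall>n\<ge>K. N (cv_minus V (x m) (x n)) < \<epsilon>"
  obtains y where "y \<in> cv_carrier V" "(\<lambda>n. N (cv_minus V (x n) y)) \<longlonglongrightarrow> 0"
proof -
  interpret M: Metric_space "cv_carrier V" "norm_dist V N" by (rule metric)
  have "M.MCauchy x" unfolding M.MCauchy_def norm_dist_def using x cauchy by auto
  then obtain y where y: "limitin M.mtopology x y sequentially" using comp by (auto simp: M.mcomplete_def)
  then have "y \<in> cv_carrier V" by (meson M.limitin_mspace)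
  moreover have "(\<lambda>n. N (cv_minus V (x n) y)) \<longlonglongrightarrow> 0"
    using y calculation unfolding M.limitin_metric_dist_null by (simp add: norm_dist_def x)
  ultimately show ?thesis using that by blast
qed

definition converges :: "(nat \<Rightarrow> 'a) \<Rightarrow> 'a \<Rightarrow> bool" where
  "converges x y \<longleftrightarrow> (\<forall>n. x n \<in> carr) \<and> y \<in> carr \<and> (\<lambda>n. N (x n \<ominus> y)) \<longlonglongrightarrow> 0"

lemma convergesI:
  assumes "\<And>n. x n \<in> carr" "y \<in> carr" "\<And>n. N (x n \<ominus> y) \<le> b n" "b \<longlonglongrightarrow> 0"
  shows "converges x y"
  unfolding converges_def using assms minus_closed nonneg
  by (auto intro!: tendsto_sandwich[OF _ _ tendsto_const assms(4)] always_eventually)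

lemma converges_unique: "\<lbrakk>converges x y; converges x z\<rbrakk> \<Longrightarrow> y = z"
  unfolding converges_def using limit_unique by blast

lemma converges_add:
  assumes "converges x y" "converges u v"
  shows "converges (\<lambda>n. x n \<oplus> u n) (y \<oplus> v)"
proof (rule convergesI)
  note a = assms[unfolded converges_def]
  show "(\<lambda>n. N (x n \<ominus> y) + N (u n \<ominus> v)) \<longlonglongrightarrow> 0" using tendsto_add[of _ 0 _ _ 0] a by force
  fix n
  have "x n \<oplus> u n \<ominus> (y \<oplus> v) = (x n \<ominus> y) \<oplus> (u n \<ominus> v)"
    by (rule lin_eqI) (use a in \<open>auto simp: linfun_simps closed minus_closed\<close>)
  then show "N (x n \<oplus> u n \<ominus> (y \<oplus> v)) \<le> N (x n \<ominus> y) + N (u n \<ominus> v)"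
    using a by (simp add: triangle minus_closed)
qed (use assms in \<open>auto simp: converges_def closed\<close>)

lemma converges_scale:
  assumes "converges x y"
  shows "converges (\<lambda>n. c \<odot> x n) (c \<odot> y)"
proof (rule convergesI)
  note a = assms[unfolded converges_def]
  show "(\<lambda>n. cmod c * N (x n \<ominus> y)) \<longlonglongrightarrow> 0" using tendsto_mult_left[of _ 0] a by force
  fix n
  have "c \<odot> x n \<ominus> c \<odot> y = c \<odot> (x n \<ominus> y)"
    by (rule lin_eqI) (use a in \<open>auto simp: linfun_simps closed minus_closed algebra_simps\<close>)
  then show "N (c \<odot> x n \<ominus> c \<odot> y) \<le> cmod c * N (x n \<ominus> y)"
    using a by (simp add: scale minus_closed)
qed (use assms in \<open>auto simp: converges_def closed\<close>)

lemma converges_norm_le: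
  assumes "converges x y" "\<And>n. N (x n) \<le> b"
  shows "N y \<le> b"
proof -
  note a = assms[unfolded converges_def]
  have "N y \<le> b + N (x n \<ominus> y)" for n
  proof -
    have "x n \<ominus> (x n \<ominus> y) = y"
      by (rule lin_eqI) (use a in \<open>auto simp: linfun_simps minus_closed\<close>)
    then have "N y \<le> N (x n) + N (x n \<ominus> y)" using N_minus_le[of "x n" "x n \<ominus> y"] a minus_closed by metis
    then show ?thesis using assms(2)[of n] by simp
  qed
  moreover have "(\<lambda>n. b + N (x n \<ominus> y)) \<longlonglongrightarrow> b + 0" using a by (intro tendsto_add) auto
  ultimately show ?thesis 
    by (intro tendsto_lowerbound[of _ _ sequentially]) (auto intro: always_eventually)
qed

lemma converges_const: "y \<in> carr \<Longrightarrow> converges (\<lambda>_. y) y"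
  by (rule convergesI[of _ _ "\<lambda>_. 0"]) (auto simp: cv_minus_def add_inverse N_zero)

lemma converges_Suc: "converges x y \<Longrightarrow> converges (\<lambda>n. x (Suc n)) y"
  unfolding converges_def using LIMSEQ_Suc[of "\<lambda>n. N (x n \<ominus> y)"] by auto

end

section \<open>Square roots in C*-algebras\<close>

sublocale cstar_algebra \<subseteq> normed_vs A "cs_norm A"
  by unfold_locales (auto simp: norm_nonneg norm_definite norm_triangle norm_scale)

context cstar_algebra
begin

notation vadd (infixl "\<oplus>" 65) and vminus (infixl "\<ominus>" 65) and vscale (infixr "\<odot>" 75)
abbreviation amult (infixl "\<otimes>" 70) where "x \<otimes> y \<equiv> cs_mult A x y"
abbreviation astar ("_\<^sup>\<star>" [1000] 999) where "x\<^sup>\<star> \<equiv> cs_star A x"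

lemmas cs_closed = closed minus_closed mult_closed star_closed

lemma minus_mult: "\<lbrakk>x \<in> carr; y \<in> carr; z \<in> carr\<rbrakk> \<Longrightarrow> (x \<ominus> y) \<otimes> z = x \<otimes> z \<ominus> y \<otimes> z"
  by (simp add: cv_minus_def distrib_right scale_mult_left closed)

lemma mult_minus: "\<lbrakk>x \<in> carr; y \<in> carr; z \<in> carr\<rbrakk> \<Longrightarrow> x \<otimes> (y \<ominus> z) = x \<otimes> y \<ominus> x \<otimes> z"
  by (simp add: cv_minus_def distrib_left scale_mult_right closed)

lemma star_minus: "\<lbrakk>x \<in> carr; y \<in> carr\<rbrakk> \<Longrightarrow> (x \<ominus> y)\<^sup>\<star> = x\<^sup>\<star> \<ominus> y\<^sup>\<star>"
  by (simp add: cv_minus_def star_add star_scale closed)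

lemma zero_mult: "x \<in> carr \<Longrightarrow> cv_zero A \<otimes> x = cv_zero A"
  using scale_mult_left[of "cv_zero A" x 0] by (simp add: scale_zero_left cs_closed)

lemma mult_zero: "x \<in> carr \<Longrightarrow> x \<otimes> cv_zero A = cv_zero A"
  using scale_mult_right[of x "cv_zero A" 0] by (simp add: scale_zero_left cs_closed)

lemma star_zero: "(cv_zero A)\<^sup>\<star> = cv_zero A"
  using star_scale[of "cv_zero A" 0] by (simp add: scale_zero_left cs_closed)

lemmas expand = distrib_left distrib_right minus_mult mult_minus scale_mult_left scale_mult_right
  star_add star_minus star_scale star_star star_mult zero_mult mult_zero star_zero

lemma norm_star: "x \<in> carr \<Longrightarrow> cs_norm A (x\<^sup>\<star>) = cs_norm A x"
proof -
  have *: "cs_norm A x \<le> cs_norm A (x\<^sup>\<star>)" if x: "x \<in> carr" for x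
  proof (cases "cs_norm A x = 0")
    case False
    have "(cs_norm A x)\<^sup>2 \<le> cs_norm A (x\<^sup>\<star>) * cs_norm A x"
      using norm_mult[of "x\<^sup>\<star>" x] x by (simp add: cstar_identity cs_closed)
    then show ?thesis using False nonneg[OF x] by (simp add: power2_eq_square)
  qed (simp add: nonneg cs_closed x)
  assume "x \<in> carr"
  then show ?thesis using *[of x] *[of "x\<^sup>\<star>"] by (simp add: cs_closed star_star)
qed

lemma eq_zero_of_star_mult: "x \<in> carr \<Longrightarrow> x\<^sup>\<star> \<otimes> x = cv_zero A \<Longrightarrow> x = cv_zero A"
  using cstar_identity[of x] definite[of x] by (simp add: N_zero)

lemma converges_mult:
  assumes "converges x y" "converges u v"
  shows "converges (\<lambda>n. x n \<otimes> u n) (y \<otimes> v)"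
proof (rule convergesI)
  note a = assms[unfolded converges_def]
  let ?b = "\<lambda>n. cs_norm A (x n \<ominus> y) * cs_norm A (u n \<ominus> v)
    + cs_norm A y * cs_norm A (u n \<ominus> v) + cs_norm A (x n \<ominus> y) * cs_norm A v"
  have "?b \<longlonglongrightarrow> 0 * 0 + cs_norm A y * 0 + 0 * cs_norm A v"
    using a by (intro tendsto_intros) auto
  then show "?b \<longlonglongrightarrow> 0" by simp
  fix n
  have c: "x n \<in> carr" "y \<in> carr" "u n \<in> carr" "v \<in> carr" using a by auto
  have "x n \<otimes> u n \<ominus> y \<otimes> v = ((x n \<ominus> y) \<otimes> (u n \<ominus> v) \<oplus> y \<otimes> (u n \<ominus> v)) \<oplus> (x n \<ominus> y) \<otimes> v"
    by (rule lin_eqI) (use c in \<open>auto simp: linfun_simps cs_closed expand\<close>)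
  then show "cs_norm A (x n \<otimes> u n \<ominus> y \<otimes> v) \<le> ?b n"
    using c by (simp only:) (intro order.trans[OF triangle] add_mono norm_mult; auto simp: cs_closed)
qed (use assms in \<open>auto simp: converges_def cs_closed\<close>)

lemma converges_star: "converges x y \<Longrightarrow> converges (\<lambda>n. (x n)\<^sup>\<star>) (y\<^sup>\<star>)"
  by (rule convergesI[of _ _ "\<lambda>n. cs_norm A (x n \<ominus> y)"])
    (auto simp: converges_def cs_closed star_minus[symmetric] norm_star)

text \<open>The square root \<open>1 - y\<close> of \<open>1 - z\<close> in the unitization: the iteration \<open>y \<mapsto> (z + y\<^sup>2) / 2\<close> is
  dominated by the scalar iteration with \<open>z = 1\<close>, which converges monotonically.\<close>

lemma sqrt_one_minus:
  assumes z: "z \<in> carr" "cs_norm A z \<le> 1"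
  obtains y where "y \<in> carr" "2 \<odot> y = z \<oplus> y \<otimes> y" "cs_norm A y \<le> 1" "z\<^sup>\<star> = z \<Longrightarrow> y\<^sup>\<star> = y"
    "\<And>w. w \<in> carr \<Longrightarrow> w \<otimes> z = z \<otimes> w \<Longrightarrow> w \<otimes> y = y \<otimes> w"
proof -
  define Y where "Y = rec_nat (cv_zero A) (\<lambda>_ y. (1/2) \<odot> (z \<oplus> y \<otimes> y))"
  define q where "q = rec_nat (0::real) (\<lambda>_ r. (1 + r\<^sup>2) / 2)"
  have Y0: "Y 0 = cv_zero A" and YS: "\<And>n. Y (Suc n) = (1/2) \<odot> (z \<oplus> Y n \<otimes> Y n)" by (simp_all add: Y_def)
  have q0: "q 0 = 0" and qS: "\<And>n. q (Suc n) = (1 + (q n)\<^sup>2) / 2" by (simp_all add: q_def)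
  have q: "0 \<le> q n \<and> q n \<le> 1" for n
    by (induction n) (auto simp: q0 qS power_le_one)
  have qmono: "q n \<le> q (Suc n)" for n
    using zero_le_power2[of "q n - 1"] by (simp add: qS power2_eq_square algebra_simps)
  have Yc: "Y n \<in> carr" for n by (induction n) (auto simp: Y0 YS cs_closed z)
  have YN: "cs_norm A (Y n) \<le> q n" for n
  proof (induction n)
    case (Suc n)
    have "cs_norm A (z \<oplus> Y n \<otimes> Y n) \<le> 1 + q n * q n"
      using z Yc Suc q[of n]
      by (intro order.trans[OF triangle] add_mono order.trans[OF norm_mult] mult_mono) (auto simp: cs_closed nonneg)
    then show ?case using z Yc by (simp add: YS qS scale cs_closed power2_eq_square)
  qed (simp add: Y0 q0 N_zero)
  \<comment> \<open>Increments are compared rather than values: those of \<open>q\<close> telescope,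
    so the convergence of the bounded monotone sequence \<open>q\<close> makes \<open>Y\<close>
    Cauchy.\<close>
  have step: "cs_norm A (Y (Suc n) \<ominus> Y n) \<le> q (Suc n) - q n" for n
  proof (induction n)
    case 0
    show ?case using z by (simp add: Y0 YS q0 qS zero_mult add_zero cs_closed cv_minus_def scale_zero_right scale)
  next
    case (Suc n)
    let ?d = "Y (Suc n) \<ominus> Y n"
    \<comment> \<open>The identity \<open>u^2 - v^2 = u (u - v) + (u - v) v\<close> holds without
      commutativity. The recursion for \<open>Y (Suc n)\<close> is unfolded only where it is
      subtracted, so that it survives as a factor.\<close>
    have "Y (Suc (Suc n)) \<ominus> Y (Suc n) = (1/2) \<odot> (Y (Suc n) \<otimes> ?d \<oplus> ?d \<otimes> Y n)"
      unfolding YS[of "Suc n"] YS[of n, THEN arg_cong[where f = "\<lambda>u. _ \<ominus> u"]]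
      by (rule lin_eqI) (use z Yc in \<open>auto simp: linfun_simps cs_closed expand algebra_simps\<close>)
    also have "cs_norm A \<dots> \<le> (1/2) * (q (Suc n) * (q (Suc n) - q n) + (q (Suc n) - q n) * q n)"
      using Yc YN Suc q qmono
      by (simp add: scale cs_closed)
        (intro order.trans[OF triangle] add_mono order.trans[OF norm_mult] mult_mono; simp add: cs_closed nonneg)
    also have "\<dots> = q (Suc (Suc n)) - q (Suc n)"
      by (simp only: qS[of "Suc n"] qS[of n, THEN arg_cong[where f = "\<lambda>u. _ - u"]])
        (simp add: power2_eq_square field_simps)
    finally show ?case .
  qed
  have diff: "cs_norm A (Y m \<ominus> Y n) \<le> q m - q n" if "n \<le> m" for m n
    using that
  proof (induction m rule: dec_induct)
    case base
    show ?case using Yc by (simp add: cv_minus_def add_inverse N_zero)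
  next
    case (step m)
    show ?case using N_minus_triangle[of "Y (Suc m)" "Y m" "Y n", OF Yc Yc Yc] step \<open>\<And>n. cs_norm A (Y (Suc n) \<ominus> Y n) \<le> _\<close>[of m]
      by linarith
  qed
  have "convergent q"
    by (rule Bseq_monoseq_convergent) (use q in \<open>auto intro!: BseqI'[of _ 1] mono_SucI1 simp: qmono incseq_SucI monoseq_Suc\<close>)
  then have "Cauchy q" by (rule convergent_Cauchy)
  have "\<exists>K. \<forall>m\<ge>K. \<forall>n\<ge>K. cs_norm A (Y m \<ominus> Y n) < \<epsilon>" if "\<epsilon> > 0" for \<epsilon>
  proof -
    obtain K where K: "\<And>m n. m \<ge> K \<Longrightarrow> n \<ge> K \<Longrightarrow> \<bar>q m - q n\<bar> < \<epsilon>"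
      using \<open>Cauchy q\<close> \<open>\<epsilon> > 0\<close> unfolding Cauchy_def dist_real_def by blast
    have "cs_norm A (Y m \<ominus> Y n) < \<epsilon>" if "m \<ge> K" "n \<ge> K" for m n
    proof (cases "n \<le> m")
      case True
      then show ?thesis using diff[of n m] K[OF that] by linarith
    next
      case False
      then show ?thesis using diff[of m n] K[OF that] N_minus_commute[OF Yc Yc, of m n] by simp
    qed
    then show ?thesis by blast
  qed
  then obtain y where "y \<in> carr" "(\<lambda>n. cs_norm A (Y n \<ominus> y)) \<longlonglongrightarrow> 0"
    using complete_limit[OF complete[unfolded cs_dist_def], of Y] Yc by blast
  then have lim: "converges Y y" unfolding converges_def using Yc by blast
  have "converges (\<lambda>n. 2 \<odot> Y (Suc n)) (2 \<odot> y)" by (intro converges_scale converges_Suc lim)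
  moreover have "(\<lambda>n. 2 \<odot> Y (Suc n)) = (\<lambda>n. z \<oplus> Y n \<otimes> Y n)"
    using z Yc by (auto simp: YS scale_scale scale_one cs_closed)
  moreover have "converges (\<lambda>n. z \<oplus> Y n \<otimes> Y n) (z \<oplus> y \<otimes> y)"
    by (intro converges_add converges_const converges_mult lim z)
  ultimately have 1: "2 \<odot> y = z \<oplus> y \<otimes> y" using converges_unique by metis
  have 2: "cs_norm A y \<le> 1"
    by (rule converges_norm_le[OF lim]) (use YN q order.trans in blast)
  have 3: "y\<^sup>\<star> = y" if "z\<^sup>\<star> = z"
  proof -
    have "(Y n)\<^sup>\<star> = Y n" for n by (induction n) (use z Yc that in \<open>auto simp: Y0 YS expand cs_closed\<close>)
    then show ?thesis using converges_star[OF lim] lim converges_unique by auto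
  qed
  have 4: "w \<otimes> y = y \<otimes> w" if w: "w \<in> carr" "w \<otimes> z = z \<otimes> w" for w
  proof -
    have eq: "w \<otimes> Y n = Y n \<otimes> w" for n
    proof (induction n)
      case (Suc n)
      have "w \<otimes> (Y n \<otimes> Y n) = (Y n \<otimes> Y n) \<otimes> w"
        using w Yc Suc mult_assoc by metis
      then show ?case using w z Yc by (simp add: YS expand cs_closed)
    qed (use w in \<open>simp add: Y0 expand\<close>)
    have "converges (\<lambda>n. w \<otimes> Y n) (w \<otimes> y)" "converges (\<lambda>n. Y n \<otimes> w) (y \<otimes> w)"
      by (intro converges_mult converges_const lim w)+
    then show ?thesis unfolding eq using converges_unique by blast
  qed
  show ?thesis using that[of y] 1 2 3 4 \<open>y \<in> carr\<close> by blast
qed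

lemma norm_selfadjoint_square: "\<lbrakk>x \<in> carr; x\<^sup>\<star> = x\<rbrakk> \<Longrightarrow> cs_norm A (x \<otimes> x) = (cs_norm A x)\<^sup>2"
  using cstar_identity[of x] by simp

text \<open>Testing on \<open>v = x\<close> gives that the square of the norm is at most the norm.
  Left multiplications also make sense for elements of the unitization, which is how the bounds on
  \<open>x \<otimes> v\<close> are obtained below.\<close>

lemma norm_le_one_of_left_mult:
  assumes "x \<in> carr" "x\<^sup>\<star> = x" "\<And>v. v \<in> carr \<Longrightarrow> cs_norm A (x \<otimes> v) \<le> cs_norm A v"
  shows "cs_norm A x \<le> 1"
proof (rule ccontr)
  assume "\<not> ?thesis"
  then show False using assms(3)[of x] norm_selfadjoint_square assms(1,2)
    by (simp add: power2_eq_square)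
qed

text \<open>For commuting self-adjoint \<open>g\<close>, \<open>y\<close> with \<open>g\<^sup>2 + (1 - y)\<^sup>2 = 1\<close>, the element \<open>g \<plusminus> i (1 - y)\<close> of the
  unitization is unitary.\<close>

lemma norm_unitary_mult:
  assumes gy: "g \<in> carr" "y \<in> carr" "g\<^sup>\<star> = g" "y\<^sup>\<star> = y" "g \<otimes> y = y \<otimes> g" "2 \<odot> y = g \<otimes> g \<oplus> y \<otimes> y"
    and k: "k = \<i> \<or> k = - \<i>" and v: "v \<in> carr"
  shows "cs_norm A (g \<otimes> v \<oplus> k \<odot> (v \<ominus> y \<otimes> v)) = cs_norm A v"
proof -
  let ?z = "g \<otimes> v \<oplus> k \<odot> (v \<ominus> y \<otimes> v)"
  have gg: "g \<otimes> g = 2 \<odot> y \<ominus> y \<otimes> y"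
    unfolding gy(6) by (rule lin_eqI) (use gy(1,2) in \<open>auto simp: linfun_simps cs_closed\<close>)
  have ggv: "g \<otimes> (g \<otimes> v) = 2 \<odot> (y \<otimes> v) \<ominus> y \<otimes> (y \<otimes> v)"
    using gy(1,2) v by (simp add: mult_assoc[symmetric] gg expand cs_closed)
  have gyv: "g \<otimes> (y \<otimes> v) = y \<otimes> (g \<otimes> v)"
    using gy(1,2,5) v by (simp add: mult_assoc[symmetric])
  have "?z\<^sup>\<star> \<otimes> ?z = v\<^sup>\<star> \<otimes> v"
    by (rule lin_eqI) (use gy(1-4) v k in \<open>auto simp: linfun_simps cs_closed expand mult_assoc ggv gyv algebra_simps\<close>)
  then have "(cs_norm A ?z)\<^sup>2 = (cs_norm A v)\<^sup>2"
    using gy v by (metis cs_closed cstar_identity)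
  then show ?thesis using gy v by (simp add: nonneg cs_closed)
qed

text \<open>\<open>g\<close> is the mean of \<open>g + i (1 - y)\<close> and
  \<open>g - i (1 - y)\<close>, whose left multiplications are isometric. The algebraic relations
  alone exhibit \<open>g\<close> as the cosine of a unitary.\<close>

lemma norm_cos_le_one:
  assumes gy: "g \<in> carr" "y \<in> carr" "g\<^sup>\<star> = g" "y\<^sup>\<star> = y" "g \<otimes> y = y \<otimes> g" "2 \<odot> y = g \<otimes> g \<oplus> y \<otimes> y"
  shows "cs_norm A g \<le> 1"
proof (rule norm_le_one_of_left_mult)
  fix v assume v: "v \<in> carr"
  let ?W = "\<lambda>k. g \<otimes> v \<oplus> k \<odot> (v \<ominus> y \<otimes> v)"
  have W: "cs_norm A (?W \<i>) = cs_norm A v" "cs_norm A (?W (-\<i>)) = cs_norm A v"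
    by (rule norm_unitary_mult; (fact gy v)?; simp)+
  have "2 \<odot> (g \<otimes> v) = ?W \<i> \<oplus> ?W (-\<i>)"
    by (rule lin_eqI) (use gy(1,2) v in \<open>auto simp: linfun_simps cs_closed\<close>)
  then have "2 * cs_norm A (g \<otimes> v) \<le> cs_norm A (?W \<i>) + cs_norm A (?W (-\<i>))"
    using scale[of "g \<otimes> v" 2] triangle[of "?W \<i>" "?W (-\<i>)"] gy(1,2) v by (simp add: cs_closed)
  then show "cs_norm A (g \<otimes> v) \<le> cs_norm A v" using W by simp
qed (fact gy)+

text \<open>If \<open>g\<close> is the cosine and \<open>1 - y\<close> the sine of an angle, then
  \<open>2 g (1 - y)\<close> is the sine of the double angle: the difference of the squares of the
  two unitaries, divided by \<open>2 i\<close>.\<close>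

lemma norm_sin_double_le_one:
  assumes gy: "g \<in> carr" "y \<in> carr" "g\<^sup>\<star> = g" "y\<^sup>\<star> = y" "g \<otimes> y = y \<otimes> g" "2 \<odot> y = g \<otimes> g \<oplus> y \<otimes> y"
  shows "cs_norm A (2 \<odot> (g \<ominus> g \<otimes> y)) \<le> 1"
proof (rule norm_le_one_of_left_mult)
  let ?e = "2 \<odot> (g \<ominus> g \<otimes> y)"
  show "?e \<in> carr" using gy by (simp add: cs_closed)
  show "?e\<^sup>\<star> = ?e" using gy by (simp add: cs_closed expand)
  fix v assume v: "v \<in> carr"
  let ?W = "\<lambda>k v. g \<otimes> v \<oplus> k \<odot> (v \<ominus> y \<otimes> v)"
  have Wc: "?W k v \<in> carr" if "v \<in> carr" for k v using gy that by (simp add: cs_closed)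
  have W: "cs_norm A (?W k v) = cs_norm A v" if "k = \<i> \<or> k = -\<i>" "v \<in> carr" for k v
    by (rule norm_unitary_mult) (use gy that in auto)
  have gyv: "g \<otimes> (y \<otimes> v) = y \<otimes> (g \<otimes> v)"
    using gy(1,2,5) v by (simp add: mult_assoc[symmetric])
  have eq: "(2 * \<i>) \<odot> (?e \<otimes> v) = ?W \<i> (?W \<i> v) \<ominus> ?W (-\<i>) (?W (-\<i>) v)"
    by (rule lin_eqI) (use gy(1,2) v in \<open>auto simp: linfun_simps cs_closed expand mult_assoc gyv algebra_simps\<close>)
  have "2 * cs_norm A (?e \<otimes> v) = cs_norm A ((2 * \<i>) \<odot> (?e \<otimes> v))"
    using scale[of "?e \<otimes> v" "2 * \<i>"] gy(1,2) v by (simp add: cs_closed norm_mult)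
  also have "\<dots> \<le> cs_norm A (?W \<i> (?W \<i> v)) + cs_norm A (?W (-\<i>) (?W (-\<i>) v))"
    unfolding eq by (intro N_minus_le Wc v)
  also have "\<dots> = 2 * cs_norm A v" using W Wc v by simp
  finally show "cs_norm A (?e \<otimes> v) \<le> cs_norm A v" by simp
qed

end

section \<open>Finite-dimensional C*-algebras\<close>

text \<open>Gaussian elimination: the last equation eliminates an unknown with nonzero coefficient,
  if it has one.\<close>

lemma homogeneous_system:
  fixes f :: "'i \<Rightarrow> nat \<Rightarrow> complex"
  assumes "finite I" "n < card I"
  shows "\<exists>c. (\<exists>i\<in>I. c i \<noteq> 0) \<and> (\<forall>j<n. (\<Sum>i\<in>I. c i * f i j) = 0)"
  using assms
proof (induction n arbitrary: I f)
  case 0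
  then have "I \<noteq> {}" by auto
  then show ?case by (auto intro!: exI[of _ "\<lambda>_. 1"])
next
  case (Suc n)
  show ?case
  proof (cases "\<forall>i\<in>I. f i n = 0")
    case True
    obtain c where "\<exists>i\<in>I. c i \<noteq> 0" "\<forall>j<n. (\<Sum>i\<in>I. c i * f i j) = 0"
      using Suc.IH[OF Suc.prems(1), of f] Suc.prems(2) by auto
    then show ?thesis using True by (intro exI[of _ c]) (auto simp: less_Suc_eq)
  next
    case False
    then obtain k where k: "k \<in> I" "f k n \<noteq> 0" by blast
    let ?I = "I - {k}"
    let ?f = "\<lambda>i j. f i j - f i n / f k n * f k j"
    obtain c where c: "\<exists>i\<in>?I. c i \<noteq> 0" "\<forall>j<n. (\<Sum>i\<in>?I. c i * ?f i j) = 0"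
    proof -
      have "n < card ?I" using Suc.prems k by simp
      then show ?thesis using Suc.IH[of ?I ?f] Suc.prems(1) that by blast
    qed
    \<comment> \<open>This value solves equation \<open>n\<close>; substituted into the other
      equations it produces the coefficients \<open>?f\<close>.\<close>
    define ck where "ck = - (\<Sum>i\<in>?I. c i * f i n / f k n)"
    define c' where "c' = c(k := ck)"
    have sum: "(\<Sum>i\<in>I. c' i * f i j) = (\<Sum>i\<in>?I. c i * ?f i j)" for j
    proof -
      have "(\<Sum>i\<in>I. c' i * f i j) = c' k * f k j + (\<Sum>i\<in>?I. c' i * f i j)"
        using Suc.prems(1) k by (simp add: sum.remove)
      also have "(\<Sum>i\<in>?I. c' i * f i j) = (\<Sum>i\<in>?I. c i * f i j)"
        by (rule sum.cong) (auto simp: c'_def)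
      also have "c' k * f k j = - (\<Sum>i\<in>?I. c i * (f i n / f k n * f k j))"
        by (simp add: c'_def ck_def sum_distrib_right mult.assoc)
      finally show ?thesis by (simp add: right_diff_distrib sum_subtractf)
    qed
    have "(\<Sum>i\<in>I. c' i * f i j) = 0" if "j < Suc n" for j
      using c(2) that k(2) unfolding sum by (cases "j = n") auto
    moreover have "\<exists>i\<in>I. c' i \<noteq> 0" using c(1) by (auto simp: c'_def)
    ultimately show ?thesis by blast
  qed
qed

context complex_vs
begin

lemma linfun_cv_sum: "\<lbrakk>linfun g; set xs \<subseteq> carr\<rbrakk> \<Longrightarrow> cv_sum V xs \<in> carr \<and> g (cv_sum V xs) = sum_list (map g xs)"
  by (induction xs) (auto simp: cv_sum_def linfun_simps closed)

lemma linfun_lin_comb: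
  assumes "linfun g" "length cs = length bs" "set bs \<subseteq> carr"
  shows "g (lin_comb V cs bs) = (\<Sum>j<length bs. cs ! j * g (bs ! j))"
proof -
  have "set (map2 (cv_scale V) cs bs) \<subseteq> carr"
    using assms(3) by (auto simp: closed dest!: set_zip_rightD)
  then have "g (lin_comb V cs bs) = sum_list (map g (map2 (cv_scale V) cs bs))"
    using linfun_cv_sum[OF assms(1)] by (simp add: lin_comb_def)
  also have "\<dots> = (\<Sum>j<length bs. g (cv_scale V (cs ! j) (bs ! j)))"
    using assms(2) by (simp add: sum_list_sum_nth atLeast0LessThan)
  also have "\<dots> = (\<Sum>j<length bs. cs ! j * g (bs ! j))"
  proof (rule sum.cong)
    fix j assume "j \<in> {..<length bs}"
    then have "bs ! j \<in> carr" using assms(3) by auto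
    then show "g (cv_scale V (cs ! j) (bs ! j)) = cs ! j * g (bs ! j)" using assms(1) by (simp add: linfun_simps)
  qed simp
  finally show ?thesis .
qed

text \<open>The coordinates of the \<open>d + 1\<close> vectors give \<open>d\<close> homogeneous
  equations for the \<open>d + 1\<close> coefficients of a relation.\<close>

lemma linearly_dependent:
  assumes dim: "has_dim V D d" and D: "D \<subseteq> carr" and X: "\<And>i. i \<le> d \<Longrightarrow> X i \<in> D"
  obtains c where "\<exists>i\<le>d. c i \<noteq> 0" "vsum (\<lambda>i. c i \<odot> X i) (Suc d) = cv_zero V"
proof -
  obtain bs where bs: "length bs = d" "set bs \<subseteq> D"
    and ex: "\<And>x. x \<in> D \<Longrightarrow> \<exists>cs. length cs = d \<and> x = lin_comb V cs bs"
  proof -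
    obtain bs where bs: "length bs = d" "set bs \<subseteq> D"
      and "\<forall>x\<in>D. \<exists>!cs. length cs = length bs \<and> x = lin_comb V cs bs"
      using dim unfolding has_dim_def is_basis_def by blast
    then have "\<exists>cs. length cs = d \<and> x = lin_comb V cs bs" if "x \<in> D" for x
      using that by (metis (lifting))
    then show ?thesis using that bs by blast
  qed
  obtain cs where cs: "\<And>i. i \<le> d \<Longrightarrow> length (cs i) = d \<and> X i = lin_comb V (cs i) bs"
  proof -
    have "\<exists>cs. \<forall>i\<in>{..d}. length (cs i) = d \<and> X i = lin_comb V (cs i) bs"
      by (rule bchoice) (use ex X in blast)
    then show ?thesis using that by auto
  qed
  obtain c where c: "\<exists>i\<in>{..<Suc d}. c i \<noteq> 0" "\<And>j. j < d \<Longrightarrow> (\<Sum>i<Suc d. c i * cs i ! j) = 0"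
    using homogeneous_system[of "{..<Suc d}" d "\<lambda>i j. cs i ! j"] by auto
  have Xc: "X i \<in> carr" if "i < Suc d" for i using X[of i] D that by auto
  have "vsum (\<lambda>i. c i \<odot> X i) (Suc d) = cv_zero V"
  proof (rule lin_eqI)
    fix g assume g: "linfun g"
    have "g (vsum (\<lambda>i. c i \<odot> X i) (Suc d)) = (\<Sum>i<Suc d. g (c i \<odot> X i))"
      by (rule linfun_vsum) (use g Xc in \<open>auto simp: closed\<close>)
    also have "\<dots> = (\<Sum>i<Suc d. \<Sum>j<d. c i * cs i ! j * g (bs ! j))"
    proof (rule sum.cong)
      fix i assume i: "i \<in> {..<Suc d}"
      have "g (X i) = (\<Sum>j<d. cs i ! j * g (bs ! j))"
        using linfun_lin_comb[OF g, of "cs i" bs] cs[of i] bs D i by auto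
      then show "g (c i \<odot> X i) = (\<Sum>j<d. c i * cs i ! j * g (bs ! j))"
        using linfun_scale[OF g Xc[of i]] i by (simp add: sum_distrib_left mult.assoc)
    qed simp
    also have "\<dots> = (\<Sum>j<d. (\<Sum>i<Suc d. c i * cs i ! j) * g (bs ! j))"
      unfolding sum_distrib_right by (rule sum.swap)
    also have "\<dots> = 0" using c(2) by simp
    finally show "g (vsum (\<lambda>i. c i \<odot> X i) (Suc d)) = g (cv_zero V)" using g by (simp add: linfun_simps)
  qed (use Xc in \<open>auto intro!: vsum_closed simp: closed simp del: vsum.simps\<close>)
  moreover have "\<exists>i\<le>d. c i \<noteq> 0" using c(1) by (auto simp: less_Suc_eq_le)
  ultimately show ?thesis using that by blast
qed

end

section \<open>Eigenprojections and maximal abelian subalgebras\<close>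

context cstar_algebra
begin

lemma linfun_mult_left: "\<lbrakk>linfun g; w \<in> carr\<rbrakk> \<Longrightarrow> linfun (\<lambda>x. g (w \<otimes> x))"
  unfolding linfun_def by (simp add: expand mult_closed closed)

lemma linfun_mult_right: "\<lbrakk>linfun g; w \<in> carr\<rbrakk> \<Longrightarrow> linfun (\<lambda>x. g (x \<otimes> w))"
  unfolding linfun_def by (simp add: expand mult_closed closed)

lemma real_imaginary_parts:
  assumes "x \<in> carr"
  obtains h k where "h \<in> carr" "k \<in> carr" "h\<^sup>\<star> = h" "k\<^sup>\<star> = k" "x = h \<oplus> \<i> \<odot> k"
    "\<And>S. cstar_subalgebra A S \<Longrightarrow> x \<in> S \<Longrightarrow> h \<in> S \<and> k \<in> S"
proof
  let ?h = "(1/2) \<odot> (x \<oplus> x\<^sup>\<star>)" and ?k = "(-\<i>/2) \<odot> (x \<oplus> (-1) \<odot> x\<^sup>\<star>)"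
  show "?h \<in> carr" "?k \<in> carr" using assms by (simp_all add: cs_closed)
  show "?h\<^sup>\<star> = ?h" using assms by (simp add: cs_closed expand add_commute)
  show "?k\<^sup>\<star> = ?k"
    by (rule lin_eqI) (use assms in \<open>auto simp: cs_closed expand linfun_simps algebra_simps\<close>)
  show "x = ?h \<oplus> \<i> \<odot> ?k"
    by (rule lin_eqI) (use assms in \<open>auto simp: cs_closed linfun_simps algebra_simps\<close>)
  show "?h \<in> S \<and> ?k \<in> S" if "cstar_subalgebra A S" "x \<in> S" for S
    using that unfolding cstar_subalgebra_def by blast
qed

text \<open>An eigenvector of multiplication by \<open>a\<close> is found by splitting off a linear factor of a polynomial
  of minimal degree annihilating \<open>a\<close>; it generates the projection.\<close>

lemma eigenprojection_exists:
  assumes D: "abelian_subalgebra A D" and dim: "has_dim A D d"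
    and a: "a \<in> D" "a\<^sup>\<star> = a" "a \<noteq> cv_zero A"
  obtains e \<mu> where "e \<in> D" "e\<^sup>\<star> = e" "e \<otimes> e = e" "e \<noteq> cv_zero A" "\<mu> \<noteq> 0" "a \<otimes> e = \<mu> \<odot> e"
proof -
  have sub: "D \<subseteq> carr"
  proof -
    interpret M: Metric_space carr "cs_dist A" unfolding cs_dist_def by (rule metric)
    show ?thesis using D closedin_subset[of "cs_topology A" D]
      by (simp add: abelian_subalgebra_def cstar_subalgebra_def cs_topology_def)
  qed
  have Dops: "\<And>x y. x \<in> D \<Longrightarrow> y \<in> D \<Longrightarrow> x \<oplus> y \<in> D \<and> x \<otimes> y \<in> D \<and> x \<otimes> y = y \<otimes> x"
    "\<And>x c. x \<in> D \<Longrightarrow> x\<^sup>\<star> \<in> D \<and> c \<odot> x \<in> D" "cv_zero A \<in> D"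
    using D by (auto simp: abelian_subalgebra_def cstar_subalgebra_def)
  have ac: "a \<in> carr" using a sub by blast
  \<comment> \<open>For want of a unit the powers start with \<open>a\<close>: \<open>pw i\<close>
    is the power \<open>i + 1\<close>, and \<open>act p\<close> is the value at \<open>a\<close> of
    \<open>p\<close> multiplied by the variable.\<close>
  define pw where "pw = rec_nat a (\<lambda>_ y. a \<otimes> y)"
  have pw0: "pw 0 = a" and pwS: "\<And>i. pw (Suc i) = a \<otimes> pw i" by (simp_all add: pw_def)
  have pwD: "pw i \<in> D" for i by (induction i) (use a Dops in \<open>auto simp: pw0 pwS\<close>)
  then have pwc: "pw i \<in> carr" for i using sub by blast
  define act where "act p = vsum (\<lambda>i. coeff p i \<odot> pw i) (Suc (degree p))" for p
  have actD: "act p \<in> D" for p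
  proof -
    have "vsum (\<lambda>i. coeff p i \<odot> pw i) n \<in> D" for n by (induction n) (use pwD Dops in auto)
    then show ?thesis by (simp only: act_def)
  qed
  then have actc: "act p \<in> carr" for p using sub by blast
  have act: "g (act p) = (\<Sum>i<n. coeff p i * g (pw i))" if g: "linfun g" and n: "degree p < n" for g p n
  proof -
    have "g (act p) = (\<Sum>i<Suc (degree p). g (coeff p i \<odot> pw i))"
      unfolding act_def by (rule linfun_vsum) (use g pwc in \<open>auto simp: closed\<close>)
    also have "\<dots> = (\<Sum>i<Suc (degree p). coeff p i * g (pw i))"
      using g pwc by (intro sum.cong) (auto simp: linfun_simps)
    also have "\<dots> = (\<Sum>i<n. coeff p i * g (pw i))"
      using n by (intro sum.mono_neutral_left) (auto simp: coeff_eq_0)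
    finally show ?thesis .
  qed
  have "\<exists>p. p \<noteq> 0 \<and> act p = cv_zero A"
  proof -
    obtain c where c: "\<exists>i\<le>d. c i \<noteq> 0" "vsum (\<lambda>i. c i \<odot> pw i) (Suc d) = cv_zero A"
      using linearly_dependent[OF dim sub, of pw] pwD by blast
    define p where "p = (\<Sum>i\<le>d. monom (c i) i)"
    have coeff: "coeff p i = (if i \<le> d then c i else 0)" for i
      by (simp add: p_def coeff_sum)
    have deg: "degree p < Suc d" by (simp add: coeff degree_le le_imp_less_Suc)
    have "act p = vsum (\<lambda>i. c i \<odot> pw i) (Suc d)"
    proof (rule lin_eqI)
      fix g assume g: "linfun g"
      have "g (act p) = (\<Sum>i<Suc d. c i * g (pw i))" using act[OF g deg] by (simp add: coeff)
      also have "\<dots> = (\<Sum>i<Suc d. g (c i \<odot> pw i))" using g pwc by (intro sum.cong) (auto simp: linfun_simps)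
      also have "\<dots> = g (vsum (\<lambda>i. c i \<odot> pw i) (Suc d))"
        by (rule linfun_vsum[symmetric]) (use g pwc in \<open>auto simp: closed\<close>)
      finally show "g (act p) = g (vsum (\<lambda>i. c i \<odot> pw i) (Suc d))" .
    qed (use actc pwc in \<open>auto intro!: vsum_closed simp: closed simp del: vsum.simps\<close>)
    moreover have "p \<noteq> 0" using c(1) coeff by (metis coeff_0)
    ultimately show ?thesis using c(2) by auto
  qed
  then obtain p where p: "p \<noteq> 0" "act p = cv_zero A"
    and min: "\<And>q. q \<noteq> 0 \<Longrightarrow> act q = cv_zero A \<Longrightarrow> degree p \<le> degree q"
    using ex_has_least_nat[of "\<lambda>p. p \<noteq> 0 \<and> act p = cv_zero A" _ degree] by blast
  have "degree p \<noteq> 0"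
  proof
    assume 0: "degree p = 0"
    then obtain k where k: "p = [:k:]" by (rule degree_eq_zeroE)
    then have "k \<odot> a = cv_zero A" using p(2) ac by (simp add: act_def pw0 zero_add closed)
    then have "(1/k) \<odot> (k \<odot> a) = cv_zero A" by (simp add: scale_zero_right)
    then show False using k p(1) a(3) ac by (simp add: scale_scale scale_one)
  qed
  then obtain \<mu> where "poly p \<mu> = 0"
    using fundamental_theorem_of_algebra[of p] constant_degree by metis
  then obtain q where q: "p = [:-\<mu>, 1:] * q" using poly_eq_0_iff_dvd dvdE by metis
  have q0: "q \<noteq> 0" using p q by auto
  have dp: "degree p = Suc (degree q)" using degree_mult_eq[of "[:-\<mu>, 1:]" q] q0 by (simp add: q del: mult_pCons_left)
  \<comment> \<open>Minimality of \<open>p\<close> keeps \<open>act q\<close> from vanishing, while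
    its product with \<open>a - \<mu>\<close> is \<open>act p\<close>, that is, zero.\<close>
  define b where "b = act q"
  have b: "b \<in> D" "b \<in> carr" "b \<noteq> cv_zero A"
    using actD actc min[OF q0] dp by (auto simp: b_def)
  have ab: "a \<otimes> b = \<mu> \<odot> b"
  proof (rule lin_eqI)
    fix g assume g: "linfun g"
    let ?n = "Suc (degree q)"
    have c: "coeff p i = (case i of 0 \<Rightarrow> 0 | Suc j \<Rightarrow> coeff q j) - \<mu> * coeff q i" for i
      unfolding q by (cases i) (auto simp: coeff_pCons)
    have "0 = g (act p)" using p g by (simp add: linfun_simps)
    also have "\<dots> = (\<Sum>i<Suc ?n. coeff p i * g (pw i))" by (rule act) (use g dp in auto)
    also have "\<dots> = (\<Sum>i<Suc ?n. (case i of 0 \<Rightarrow> 0 | Suc j \<Rightarrow> coeff q j) * g (pw i))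
        - \<mu> * (\<Sum>i<Suc ?n. coeff q i * g (pw i))"
      by (simp add: c left_diff_distrib sum_subtractf sum_distrib_left mult.assoc del: sum.lessThan_Suc)
    also have "(\<Sum>i<Suc ?n. coeff q i * g (pw i)) = g b" unfolding b_def by (rule act[symmetric]) (use g in auto)
    also have "(\<Sum>i<Suc ?n. (case i of 0 \<Rightarrow> 0 | Suc j \<Rightarrow> coeff q j) * g (pw i)) = (\<Sum>i<?n. coeff q i * g (a \<otimes> pw i))"
      by (simp add: sum.lessThan_Suc_shift pwS del: sum.lessThan_Suc)
    also have "\<dots> = g (a \<otimes> b)" unfolding b_def by (rule act[symmetric, OF linfun_mult_left]) (use g ac in auto)
    finally show "g (a \<otimes> b) = g (\<mu> \<odot> b)" using g b by (simp add: linfun_simps)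
  qed (use ac b in \<open>auto simp: cs_closed\<close>)
  \<comment> \<open>In the commutative \<open>D\<close> the self-adjoint product of \<open>b\<close>
    with its adjoint is an eigenvector too, and nonzero by the C*-identity.\<close>
  define f where "f = b\<^sup>\<star> \<otimes> b"
  have f: "f \<in> D" "f \<in> carr" "f\<^sup>\<star> = f" using b Dops sub by (auto simp: f_def star_mult star_star cs_closed)
  have fn: "f \<noteq> cv_zero A" using b eq_zero_of_star_mult by (auto simp: f_def)
  have af: "a \<otimes> f = \<mu> \<odot> f"
  proof -
    have "a \<otimes> f = (a \<otimes> b) \<otimes> b\<^sup>\<star>" unfolding f_def using ac b Dops by (metis mult_assoc star_closed)
    then show ?thesis unfolding ab using b Dops by (simp add: f_def expand cs_closed)
  qed
  have pwf: "pw i \<otimes> f = \<mu> ^ Suc i \<odot> f" for i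
  proof (induction i)
    case (Suc i)
    have "pw (Suc i) \<otimes> f = a \<otimes> (pw i \<otimes> f)" using ac pwc f by (simp add: pwS mult_assoc)
    then show ?case using Suc ac f af by (simp add: expand scale_scale mult.commute)
  qed (simp add: pw0 af)
  \<comment> \<open>The scalar by which \<open>b\<close> acts on \<open>f\<close>: the polynomial
    defining \<open>b\<close>, evaluated at the eigenvalue. As \<open>f f\<close> is
    \<open>|\<xi>|^2 f\<close>, division by \<open>|\<xi>|^2\<close> turns \<open>f\<close> into a
    projection.\<close>
  define \<xi> where "\<xi> = (\<Sum>i<Suc (degree q). coeff q i * \<mu> ^ Suc i)"
  have bf: "b \<otimes> f = \<xi> \<odot> f"
  proof (rule lin_eqI)
    fix g assume g: "linfun g"
    have "g (b \<otimes> f) = (\<Sum>i<Suc (degree q). coeff q i * g (pw i \<otimes> f))"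
      unfolding b_def by (rule act[OF linfun_mult_right]) (use g f in auto)
    also have "\<dots> = \<xi> * g f" using g f unfolding \<xi>_def sum_distrib_right
      by (intro sum.cong) (auto simp: pwf linfun_simps)
    finally show "g (b \<otimes> f) = g (\<xi> \<odot> f)" using g f by (simp add: linfun_simps)
  qed (use b f in \<open>auto simp: cs_closed\<close>)
  have bsf: "b\<^sup>\<star> \<otimes> f = cnj \<xi> \<odot> f"
  proof -
    have "b\<^sup>\<star> \<otimes> f = (f \<otimes> b)\<^sup>\<star>" using b f by (simp add: star_mult)
    also have "\<dots> = (b \<otimes> f)\<^sup>\<star>" using b f Dops by metis
    finally show ?thesis using f by (simp add: bf star_scale)
  qed
  have ff: "f \<otimes> f = (\<xi> * cnj \<xi>) \<odot> f"
  proof -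
    have "f \<otimes> f = b\<^sup>\<star> \<otimes> (b \<otimes> f)" unfolding f_def using b f by (simp add: mult_assoc f_def cs_closed)
    then show ?thesis using b f by (simp add: bf bsf expand scale_scale star_closed)
  qed
  have \<xi>0: "\<xi> \<noteq> 0"
  proof
    assume "\<xi> = 0"
    then have "f\<^sup>\<star> \<otimes> f = cv_zero A" using ff f by (simp add: scale_zero_left)
    then show False using eq_zero_of_star_mult f fn by blast
  qed
  define \<kappa> where "\<kappa> = (cmod \<xi>)\<^sup>2"
  have \<kappa>: "\<xi> * cnj \<xi> = complex_of_real \<kappa>" "\<kappa> \<noteq> 0"
    unfolding \<kappa>_def by (rule complex_norm_square[symmetric]) (use \<xi>0 in simp)
  show ?thesis
  proof (rule that[of "complex_of_real (1 / \<kappa>) \<odot> f" \<mu>])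
    show "complex_of_real (1 / \<kappa>) \<odot> f \<in> D" using f Dops by blast
    show "(complex_of_real (1 / \<kappa>) \<odot> f)\<^sup>\<star> = complex_of_real (1 / \<kappa>) \<odot> f" using f by (simp add: star_scale)
    show "complex_of_real (1 / \<kappa>) \<odot> f \<otimes> complex_of_real (1 / \<kappa>) \<odot> f = complex_of_real (1 / \<kappa>) \<odot> f"
      using f ff \<kappa> by (simp add: expand cs_closed scale_scale)
    show "complex_of_real (1 / \<kappa>) \<odot> f \<noteq> cv_zero A"
    proof
      assume "complex_of_real (1 / \<kappa>) \<odot> f = cv_zero A"
      then have "complex_of_real \<kappa> \<odot> (complex_of_real (1 / \<kappa>) \<odot> f) = cv_zero A" by (simp add: scale_zero_right)
      then show False using f fn \<kappa> by (simp add: scale_scale scale_one flip: of_real_mult)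
    qed
    \<comment> \<open>Every term of \<open>\<xi>\<close> has a factor \<open>\<mu>\<close>, because
      the powers start at one.\<close>
    show "\<mu> \<noteq> 0"
    proof
      assume "\<mu> = 0"
      then have "\<xi> = 0" by (simp add: \<xi>_def)
      then show False using \<xi>0 by simp
    qed
    show "a \<otimes> complex_of_real (1 / \<kappa>) \<odot> f = \<mu> \<odot> complex_of_real (1 / \<kappa>) \<odot> f"
      using f ac af by (simp add: expand scale_scale mult.commute)
  qed
qed

text \<open>The bicommutant of \<open>D\<close> together with \<open>y\<close> is automatically a
  closed *-subalgebra, with no closure to be formed, and it is commutative. By maximality it is
  \<open>D\<close>.\<close>

lemma maximal_abelian_contains_commutant:
  assumes D: "maximal_abelian A D" and y: "y \<in> carr" "y\<^sup>\<star> = y"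
    and comm: "\<And>x. x \<in> D \<Longrightarrow> x \<otimes> y = y \<otimes> x"
  shows "y \<in> D"
proof -
  interpret M: Metric_space carr "cs_dist A" unfolding cs_dist_def by (rule metric)
  have Dab: "abelian_subalgebra A D" using D by (simp add: maximal_abelian_def)
  then have sub: "D \<subseteq> carr" using closedin_subset[of "cs_topology A" D]
    by (simp add: abelian_subalgebra_def cstar_subalgebra_def cs_topology_def)
  define W where "W = insert y D"
  define C where "C X = {z \<in> carr. \<forall>x\<in>X. z \<otimes> x = x \<otimes> z}" for X
  have Wc: "W \<subseteq> carr" using sub y by (auto simp: W_def)
  have Wcomm: "u \<otimes> v = v \<otimes> u" if "u \<in> W" "v \<in> W" for u v
    using that Dab comm unfolding W_def abelian_subalgebra_def by auto
  have Wstar: "u\<^sup>\<star> \<in> W" if "u \<in> W" for u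
    using that Dab y unfolding W_def abelian_subalgebra_def cstar_subalgebra_def by auto
  have Cstar: "z\<^sup>\<star> \<in> C X" if "z \<in> C X" "X \<subseteq> carr" and Xstar: "\<And>u. u \<in> X \<Longrightarrow> u\<^sup>\<star> \<in> X" for z X
  proof -
    have "z\<^sup>\<star> \<otimes> u = u \<otimes> z\<^sup>\<star>" if u: "u \<in> X" for u
    proof -
      have "z\<^sup>\<star> \<otimes> u = (u\<^sup>\<star> \<otimes> z)\<^sup>\<star>" using \<open>z \<in> C X\<close> \<open>X \<subseteq> carr\<close> u by (auto simp: C_def star_mult star_star star_closed)
      also have "\<dots> = (z \<otimes> u\<^sup>\<star>)\<^sup>\<star>" using \<open>z \<in> C X\<close> u Xstar by (auto simp: C_def)
      also have "\<dots> = u \<otimes> z\<^sup>\<star>" using \<open>z \<in> C X\<close> \<open>X \<subseteq> carr\<close> u by (auto simp: C_def star_mult star_star star_closed)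
      finally show ?thesis .
    qed
    then show ?thesis using that(1) by (auto simp: C_def star_closed)
  qed
  \<comment> \<open>Commutants reverse inclusions: \<open>W \<subseteq> C W\<close> gives
    \<open>C (C W) \<subseteq> C W\<close>, and this makes \<open>E\<close> commutative.\<close>
  define E where "E = C (C W)"
  have CWc: "C W \<subseteq> carr" by (auto simp: C_def)
  have WE: "W \<subseteq> E" using Wc by (auto simp: E_def C_def)
  have WCW: "W \<subseteq> C W" using Wc Wcomm by (auto simp: C_def)
  have ECW: "E \<subseteq> C W" using WCW by (auto simp: E_def C_def)
  have Eab: "u \<otimes> v = v \<otimes> u" if "u \<in> E" "v \<in> E" for u v
    using that ECW unfolding E_def C_def by blast
  have "cstar_subalgebra A E"
    unfolding cstar_subalgebra_def
  proof (intro conjI ballI allI)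
    show "cv_zero A \<in> E" using CWc by (auto simp: E_def C_def[of "C W"] closed expand)
    show "x \<oplus> z \<in> E" if "x \<in> E" "z \<in> E" for x z
      using that CWc by (auto simp: E_def C_def[of "C W"] closed expand)
    show "x \<otimes> z \<in> E" if "x \<in> E" "z \<in> E" for x z
    proof -
      have "(x \<otimes> z) \<otimes> u = u \<otimes> (x \<otimes> z)" if u: "u \<in> C W" for u
        using \<open>x \<in> E\<close> \<open>z \<in> E\<close> u CWc unfolding E_def C_def[of "C W"] by (simp add: subset_iff) (metis mult_assoc)
      then show ?thesis using that by (auto simp: E_def C_def[of "C W"] mult_closed)
    qed
    show "x\<^sup>\<star> \<in> E" if "x \<in> E" for x
      unfolding E_def by (rule Cstar) (use that CWc Cstar[OF _ Wc Wstar] in \<open>auto simp: E_def\<close>)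
    show "c \<odot> x \<in> E" if "x \<in> E" for x c
      using that CWc by (auto simp: E_def C_def[of "C W"] closed expand)
    show "closedin (cs_topology A) E"
      unfolding cs_topology_def M.metric_closedin_iff_sequentially_closed
    proof (intro conjI allI impI)
      show "E \<subseteq> carr" by (auto simp: E_def C_def)
      fix s l assume s: "range s \<subseteq> E \<and> limitin M.mtopology s l sequentially"
      then have l: "l \<in> carr" by (meson M.limitin_mspace)
      have sc: "s n \<in> carr" for n using s by (auto simp: E_def C_def)
      have "(\<lambda>n. cs_dist A (s n) l) \<longlonglongrightarrow> 0" using s by (simp add: M.limitin_metric_dist_null)
      then have lim: "converges s l" using sc l by (simp add: converges_def cs_dist_def norm_dist_def)
      have "l \<otimes> u = u \<otimes> l" if u: "u \<in> C W" for u
      proof -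
        have uc: "u \<in> carr" using u CWc by blast
        have "converges (\<lambda>n. s n \<otimes> u) (l \<otimes> u)" "converges (\<lambda>n. u \<otimes> s n) (u \<otimes> l)"
          by (intro converges_mult converges_const lim uc)+
        moreover have "(\<lambda>n. s n \<otimes> u) = (\<lambda>n. u \<otimes> s n)"
        proof
          fix n have "s n \<in> E" using s by blast
          then show "s n \<otimes> u = u \<otimes> s n" using u by (simp add: E_def C_def[of "C W"])
        qed
        ultimately show ?thesis using converges_unique by metis
      qed
      then show "l \<in> E" using l by (simp add: E_def C_def[of "C W"])
    qed
  qed
  then have "abelian_subalgebra A E" using Eab by (simp add: abelian_subalgebra_def)
  moreover have "D \<subseteq> E" using WE by (auto simp: W_def)
  ultimately have "E = D" using D by (simp add: maximal_abelian_def)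
  then show ?thesis using WE by (auto simp: W_def)
qed

lemma projection_norm:
  assumes "p \<in> carr" "p\<^sup>\<star> = p" "p \<otimes> p = p" "p \<noteq> cv_zero A"
  shows "cs_norm A p = 1"
proof -
  have "cs_norm A p = (cs_norm A p)\<^sup>2" using cstar_identity[of p] assms by simp
  moreover have "cs_norm A p \<noteq> 0" using assms definite by blast
  ultimately show ?thesis by (simp add: power2_eq_square)
qed

lemma scale_cancel: "\<lbrakk>c \<odot> x = cv_zero A; x \<in> carr; x \<noteq> cv_zero A\<rbrakk> \<Longrightarrow> c = 0"
  using norm_scale[of x c] definite[of x] by (simp add: N_zero)

text \<open>A largest orthogonal family of projections in \<open>D\<close> plays the role of the
  diagonal matrix units. Being largest makes each member minimal in \<open>D\<close>, so
  \<open>D\<close> acts on it by scalars; a self-adjoint compression \<open>P i x P i\<close> then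
  commutes with \<open>D\<close>, hence lies in \<open>D\<close> and is a multiple of
  \<open>P i\<close>.\<close>

lemma diagonal_projections:
  assumes max: "maximal_abelian A D" and dim: "has_dim A D d"
  obtains P r where "r \<le> d"
    "\<And>i. i < r \<Longrightarrow> P i \<in> carr \<and> (P i)\<^sup>\<star> = P i \<and> P i \<otimes> P i = P i \<and> P i \<noteq> cv_zero A"
    "\<And>x. x \<in> carr \<Longrightarrow> vsum P r \<otimes> x = x \<and> x \<otimes> vsum P r = x"
    "\<And>i x. i < r \<Longrightarrow> x \<in> carr \<Longrightarrow> \<exists>c. P i \<otimes> x \<otimes> P i = c \<odot> P i"
proof -
  have Dab: "abelian_subalgebra A D" and Dsa: "cstar_subalgebra A D"
    using max by (auto simp: maximal_abelian_def abelian_subalgebra_def)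
  have sub: "D \<subseteq> carr"
  proof -
    interpret M: Metric_space carr "cs_dist A" unfolding cs_dist_def by (rule metric)
    show ?thesis using Dsa closedin_subset[of "cs_topology A" D]
      by (simp add: cstar_subalgebra_def cs_topology_def)
  qed
  have Dops: "\<And>x y. x \<in> D \<Longrightarrow> y \<in> D \<Longrightarrow> x \<oplus> y \<in> D" "\<And>x y. x \<in> D \<Longrightarrow> y \<in> D \<Longrightarrow> x \<otimes> y \<in> D"
    "\<And>x c. x \<in> D \<Longrightarrow> c \<odot> x \<in> D" "cv_zero A \<in> D" "\<And>x. x \<in> D \<Longrightarrow> x\<^sup>\<star> \<in> D"
    and Dcomm: "\<And>x y. x \<in> D \<Longrightarrow> y \<in> D \<Longrightarrow> x \<otimes> y = y \<otimes> x"
    using Dab by (auto simp: abelian_subalgebra_def cstar_subalgebra_def)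
  have Dminus: "x \<ominus> y \<in> D" if "x \<in> D" "y \<in> D" for x y using that Dops by (simp add: cv_minus_def)
  have Dc: "x \<in> carr" if "x \<in> D" for x using sub that by blast
  define fam where "fam P r \<longleftrightarrow> (\<forall>i<r. P i \<in> D \<and> (P i)\<^sup>\<star> = P i \<and> P i \<otimes> P i = P i \<and> P i \<noteq> cv_zero A \<and>
    (\<forall>j<r. j \<noteq> i \<longrightarrow> P i \<otimes> P j = cv_zero A))" for P and r :: nat
  \<comment> \<open>Multiplication by \<open>P k\<close> singles out the coefficient at
    \<open>k\<close>. So the members are linearly independent and \<open>d\<close> bounds their
    number.\<close>
  have famg: "g (vsum (\<lambda>i. c i \<odot> P i) n \<otimes> P k) = c k * g (P k)"
    if "fam P r" "k < n" "n \<le> r" "linfun g" for P r k n g and c :: "nat \<Rightarrow> complex"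
  proof -
    have Pc: "P i \<in> carr" if "i < n" for i using \<open>fam P r\<close> \<open>n \<le> r\<close> that Dc unfolding fam_def by auto
    have "g (vsum (\<lambda>i. c i \<odot> P i) n \<otimes> P k) = (\<Sum>i<n. g ((c i \<odot> P i) \<otimes> P k))"
      by (rule linfun_vsum[OF linfun_mult_right]) (use that Pc in \<open>auto simp: closed\<close>)
    also have "\<dots> = (\<Sum>i<n. if i = k then c k * g (P k) else 0)"
    proof (rule sum.cong)
      fix i assume i: "i \<in> {..<n}"
      have "P i \<otimes> P k = (if i = k then P k else cv_zero A)"
        using \<open>fam P r\<close> i that unfolding fam_def by auto
      then show "g ((c i \<odot> P i) \<otimes> P k) = (if i = k then c k * g (P k) else 0)"
        using Pc i that by (simp add: expand linfun_simps mult_closed scale_zero_right)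
    qed simp
    also have "\<dots> = c k * g (P k)" using that by simp
    finally show ?thesis .
  qed
  have bound: "r \<le> d" if fam: "fam P r" for P r
  proof (rule ccontr)
    assume "\<not> r \<le> d"
    then have r: "Suc d \<le> r" by simp
    have PD: "P i \<in> D" if "i \<le> d" for i using fam r that unfolding fam_def by auto
    obtain c where c: "\<exists>i\<le>d. c i \<noteq> 0" "vsum (\<lambda>i. c i \<odot> P i) (Suc d) = cv_zero A"
      using linearly_dependent[OF dim sub, of P] PD by blast
    then obtain k where k: "k \<le> d" "c k \<noteq> 0" by blast
    have Pk: "P k \<in> carr" "P k \<noteq> cv_zero A" using PD Dc k fam r unfolding fam_def by auto
    have "c k \<odot> P k = cv_zero A"
    proof (rule lin_eqI)
      fix g assume g: "linfun g"
      have "c k * g (P k) = g (vsum (\<lambda>i. c i \<odot> P i) (Suc d) \<otimes> P k)"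
        by (rule famg[symmetric]) (use fam r k g in auto)
      also have "\<dots> = g (cv_zero A)" unfolding c(2) using Pk by (simp add: expand)
      finally show "g (c k \<odot> P k) = g (cv_zero A)" using g Pk by (simp add: linfun_simps)
    qed (use Pk in \<open>auto simp: closed\<close>)
    then show False using scale_cancel Pk k by blast
  qed
  have "\<exists>r. (\<exists>P. fam P r) \<and> (\<forall>r'. (\<exists>P. fam P r') \<longrightarrow> r' \<le> r)"
  proof -
    let ?R = "{r. \<exists>P. fam P r}"
    have "finite ?R" using bound by (intro finite_subset[of ?R "{..d}"]) auto
    moreover have "0 \<in> ?R" by (simp add: fam_def)
    ultimately have "Max ?R \<in> ?R" "\<forall>r'\<in>?R. r' \<le> Max ?R"
      using Max_in[of ?R] Max_ge[of ?R] by blast+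
    then show ?thesis by blast
  qed
  then obtain r P where fam: "fam P r" and maxr: "\<And>r' P'. fam P' r' \<Longrightarrow> r' \<le> r" by blast
  have P: "P i \<in> D" "P i \<in> carr" "(P i)\<^sup>\<star> = P i" "P i \<otimes> P i = P i" "P i \<noteq> cv_zero A" if "i < r" for i
    using fam that Dc unfolding fam_def by auto
  have orth: "P i \<otimes> P j = cv_zero A" if "i < r" "j < r" "i \<noteq> j" for i j
    using fam that unfolding fam_def by auto
  define q where "q = vsum P r"
  have qD: "q \<in> D"
  proof -
    have "vsum P n \<in> D" if "n \<le> r" for n using that by (induction n) (use P Dops in auto)
    then show ?thesis by (simp add: q_def)
  qed
  have qc: "q \<in> carr" using qD Dc by blast
  have qs: "q\<^sup>\<star> = q"
  proof -
    have "(vsum P n)\<^sup>\<star> = vsum P n" if "n \<le> r" for n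
      using that by (induction n) (use P in \<open>auto simp: expand vsum_closed\<close>)
    then show ?thesis by (simp add: q_def)
  qed
  have qP: "q \<otimes> P i = P i" "P i \<otimes> q = P i" if i: "i < r" for i
  proof -
    have "vsum P r = vsum (\<lambda>i. 1 \<odot> P i) r" by (rule vsum_cong) (use P in \<open>simp add: scale_one\<close>)
    then show "q \<otimes> P i = P i"
      by (intro lin_eqI) (use famg[OF fam i order_refl, where c = "\<lambda>_. 1"] P i qc in \<open>auto simp: q_def cs_closed\<close>)
    then show "P i \<otimes> q = P i" using Dcomm P i qD by metis
  qed
  have no_orth: "\<exists>i<r. e \<otimes> P i \<noteq> cv_zero A"
    if e: "e \<in> D" "e\<^sup>\<star> = e" "e \<otimes> e = e" "e \<noteq> cv_zero A" for e
  proof (rule ccontr)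
    assume "\<not> ?thesis"
    then have o: "\<And>i. i < r \<Longrightarrow> e \<otimes> P i = cv_zero A \<and> P i \<otimes> e = cv_zero A" using Dcomm P e by metis
    have "fam (P(r := e)) (Suc r)"
      unfolding fam_def using e o P orth by (auto simp: less_Suc_eq)
    then show False using maxr by fastforce
  qed
  \<comment> \<open>Otherwise \<open>P i\<close> could be replaced by the two orthogonal projections
    \<open>e\<close> and \<open>P i - e\<close>, which gives a longer family.\<close>
  have minimal: "e = P i"
    if i: "i < r" and e: "e \<in> D" "e\<^sup>\<star> = e" "e \<otimes> e = e" "e \<noteq> cv_zero A" "e \<otimes> P i = e" for i e
  proof (rule ccontr)
    assume "e \<noteq> P i"
    let ?f = "P i \<ominus> e"
    have ec: "e \<in> carr" using e Dc by blast
    have Pe: "P i \<otimes> e = e" using Dcomm P i e by metis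
    have f: "?f \<in> D" "?f\<^sup>\<star> = ?f" "?f \<otimes> ?f = ?f" "?f \<noteq> cv_zero A" "e \<otimes> ?f = cv_zero A" "?f \<otimes> e = cv_zero A"
    proof -
      show "?f \<in> D" using Dminus P i e by blast
      show "?f\<^sup>\<star> = ?f" using P i e ec by (simp add: expand)
      have ee: "e \<ominus> e = cv_zero A" using ec by (simp add: minus_eq_zero_iff)
      show "?f \<otimes> ?f = ?f"
        by (rule lin_eqI) (use P i e ec Pe in \<open>auto simp: expand cs_closed linfun_simps\<close>)
      show "?f \<noteq> cv_zero A" using \<open>e \<noteq> P i\<close> P i ec by (simp add: minus_eq_zero_iff)
      show "e \<otimes> ?f = cv_zero A" "?f \<otimes> e = cv_zero A" using P i e ec Pe ee by (simp_all add: expand cs_closed)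
    qed
    have eP: "e \<otimes> P j = cv_zero A" "P j \<otimes> e = cv_zero A" if "j < r" "j \<noteq> i" for j
    proof -
      have "e \<otimes> P j = e \<otimes> (P i \<otimes> P j)" using e(5) ec P that i by (metis mult_assoc)
      then show "e \<otimes> P j = cv_zero A" using orth that i ec by (simp add: expand)
      then show "P j \<otimes> e = cv_zero A" using Dcomm P that e by metis
    qed
    have fP: "?f \<otimes> P j = cv_zero A" "P j \<otimes> ?f = cv_zero A" if "j < r" "j \<noteq> i" for j
      using that i P ec eP orth by (simp_all add: expand cs_closed minus_eq_zero_iff)
    have "fam (P(i := e, r := ?f)) (Suc r)"
      unfolding fam_def using e f P orth eP fP i by (auto simp: less_Suc_eq)
    then show False using maxr by fastforce
  qed
  \<comment> \<open>An eigenprojection of \<open>a P i\<close> lies below \<open>P i\<close>, so it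
    is \<open>P i\<close> itself.\<close>
  have scalar_sa: "\<exists>c. a \<otimes> P i = c \<odot> P i" if a: "a \<in> D" "a\<^sup>\<star> = a" and i: "i < r" for a i
  proof (cases "a \<otimes> P i = cv_zero A")
    case True
    then show ?thesis using P i by (auto simp: scale_zero_left intro!: exI[of _ 0])
  next
    case False
    let ?a = "a \<otimes> P i"
    have ac: "a \<in> carr" using a Dc by blast
    have "?a \<in> D" "?a\<^sup>\<star> = ?a" using a P i ac Dops Dcomm by (auto simp: star_mult)
    then obtain e \<mu> where e: "e \<in> D" "e\<^sup>\<star> = e" "e \<otimes> e = e" "e \<noteq> cv_zero A" "\<mu> \<noteq> 0" "?a \<otimes> e = \<mu> \<odot> e"
      using eigenprojection_exists[OF Dab dim _ _ False] by metis
    have ec: "e \<in> carr" using e Dc by blast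
    have "?a \<otimes> P i = ?a" using P i ac by (simp add: mult_assoc)
    have "P i \<otimes> (?a \<otimes> e) = ?a \<otimes> e" using P i ac ec a Dcomm by (metis mult_assoc mult_closed)
    then have "\<mu> \<odot> (P i \<otimes> e) = \<mu> \<odot> e" using e P i ec by (simp add: expand)
    then have "(1/\<mu>) \<odot> (\<mu> \<odot> (P i \<otimes> e)) = (1/\<mu>) \<odot> (\<mu> \<odot> e)" by simp
    then have "P i \<otimes> e = e" using e(5) P i ec by (simp add: scale_scale scale_one cs_closed)
    then have "e = P i" using minimal[OF i e(1-4)] Dcomm P i e by metis
    then show ?thesis using e(6) \<open>?a \<otimes> P i = ?a\<close> by metis
  qed
  have scalar: "\<exists>c. a \<otimes> P i = c \<odot> P i" if a: "a \<in> D" and i: "i < r" for a i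
  proof -
    obtain h k where hk: "h \<in> D" "k \<in> D" "h\<^sup>\<star> = h" "k\<^sup>\<star> = k" "a = h \<oplus> \<i> \<odot> k"
      using real_imaginary_parts[OF Dc[OF a]] Dsa a by metis
    obtain c c' where c: "h \<otimes> P i = c \<odot> P i" "k \<otimes> P i = c' \<odot> P i" using scalar_sa hk i by metis
    have "a \<otimes> P i = (c + \<i> * c') \<odot> P i"
      unfolding hk(5) using hk(1,2) Dc P i by (simp add: expand cs_closed c scale_add_left scale_scale)
    then show ?thesis by blast
  qed
  \<comment> \<open>An eigenprojection of \<open>a - a q\<close> has a nonzero product with some
    \<open>P i\<close>, but \<open>a - a q\<close> annihilates every \<open>P i\<close>.\<close>
  have unit_sa: "a \<otimes> q = a" if a: "a \<in> D" "a\<^sup>\<star> = a" for a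
  proof (rule ccontr)
    assume "a \<otimes> q \<noteq> a"
    have ac: "a \<in> carr" using a Dc by blast
    let ?a = "a \<ominus> a \<otimes> q"
    have "?a \<in> D" using Dminus[OF a(1) Dops(2)[OF a(1) qD]] .
    moreover have "?a\<^sup>\<star> = ?a" using a ac qs qc qD Dcomm[OF a(1) qD] by (simp add: expand cs_closed)
    moreover have "?a \<noteq> cv_zero A" using \<open>a \<otimes> q \<noteq> a\<close> ac qc by (metis minus_eq_zero_iff mult_closed)
    ultimately obtain e \<mu> where e: "e \<in> D" "e\<^sup>\<star> = e" "e \<otimes> e = e" "e \<noteq> cv_zero A" "\<mu> \<noteq> 0" "?a \<otimes> e = \<mu> \<odot> e"
      using eigenprojection_exists[OF Dab dim] by metis
    have ec: "e \<in> carr" using e Dc by blast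
    obtain i where i: "i < r" "e \<otimes> P i \<noteq> cv_zero A" using no_orth e by blast
    have "?a \<otimes> P i = cv_zero A" using P i ac qc by (simp add: expand cs_closed mult_assoc qP minus_eq_zero_iff)
    then have "e \<otimes> (?a \<otimes> P i) = cv_zero A" using ec by (simp add: expand)
    then have "(?a \<otimes> e) \<otimes> P i = cv_zero A"
      using Dcomm[OF \<open>?a \<in> D\<close> e(1)] ec \<open>?a \<in> D\<close>[THEN Dc] P i by (simp add: mult_assoc)
    then have "\<mu> \<odot> (e \<otimes> P i) = cv_zero A" using e(6) ec P i by (simp add: expand)
    then show False using scale_cancel e(5) i ec P mult_closed by metis
  qed
  have unitD: "a \<otimes> q = a" "q \<otimes> a = a" if a: "a \<in> D" for a
  proof -
    obtain h k where hk: "h \<in> D" "k \<in> D" "h\<^sup>\<star> = h" "k\<^sup>\<star> = k" "a = h \<oplus> \<i> \<odot> k"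
      using real_imaginary_parts[OF Dc[OF a]] Dsa a by metis
    then show "a \<otimes> q = a" using unit_sa[of h] unit_sa[of k] Dc qc by (simp add: expand cs_closed)
    then show "q \<otimes> a = a" using Dcomm a qD by metis
  qed
  \<comment> \<open>The corner \<open>(1 - q) x (1 - q)\<close> is annihilated by \<open>D\<close>
    on both sides, so it commutes with \<open>D\<close> and belongs to \<open>D\<close>. But
    \<open>q\<close> is a unit for \<open>D\<close> and annihilates the corner.\<close>
  have corner: "x \<ominus> q \<otimes> x \<ominus> x \<otimes> q \<oplus> q \<otimes> x \<otimes> q = cv_zero A" if x: "x \<in> carr" "x\<^sup>\<star> = x" for x
  proof -
    let ?y = "x \<ominus> q \<otimes> x \<ominus> x \<otimes> q \<oplus> q \<otimes> x \<otimes> q"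
    have qq: "q \<otimes> q = q" using unitD qD by blast
    have qqx: "q \<otimes> (q \<otimes> z) = q \<otimes> z" if "z \<in> carr" for z using that qc qq by (simp add: mult_assoc[symmetric])
    have y: "?y \<in> carr" using x qc by (simp add: cs_closed)
    have ys: "?y\<^sup>\<star> = ?y"
      by (rule lin_eqI) (use x qc qs in \<open>auto simp: expand cs_closed linfun_simps mult_assoc\<close>)
    have yq: "?y \<otimes> q = cv_zero A" "q \<otimes> ?y = cv_zero A"
      by (rule lin_eqI; use x qc qq qqx in \<open>auto simp: expand cs_closed linfun_simps mult_assoc\<close>)+
    have "a \<otimes> ?y = ?y \<otimes> a" if a: "a \<in> D" for a
    proof -
      have "a \<otimes> ?y = a \<otimes> (q \<otimes> ?y)" using unitD(1)[OF a] Dc[OF a] qc y by (metis mult_assoc)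
      also have "\<dots> = cv_zero A" using yq Dc[OF a] by (simp add: expand)
      also have "\<dots> = (?y \<otimes> q) \<otimes> a" using yq Dc[OF a] by (simp add: expand)
      also have "\<dots> = ?y \<otimes> a" using unitD(2)[OF a] Dc[OF a] qc y by (metis mult_assoc)
      finally show ?thesis .
    qed
    then have "?y \<in> D" using maximal_abelian_contains_commutant[OF max y ys] by blast
    then show ?thesis using unitD yq by metis
  qed
  \<comment> \<open>For \<open>z = x (1 - q)\<close> the product of the adjoint of \<open>z\<close>
    with \<open>z\<close> is such a corner, so \<open>z = 0\<close>: the unit of \<open>D\<close> is
    a unit of the whole algebra.\<close>
  have unit: "x \<otimes> q = x" if x: "x \<in> carr" for x
  proof -
    let ?z = "x \<ominus> x \<otimes> q"
    have "?z\<^sup>\<star> \<otimes> ?z = x\<^sup>\<star> \<otimes> x \<ominus> q \<otimes> (x\<^sup>\<star> \<otimes> x) \<ominus> (x\<^sup>\<star> \<otimes> x) \<otimes> q \<oplus> q \<otimes> (x\<^sup>\<star> \<otimes> x) \<otimes> q"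
      by (rule lin_eqI) (use x qc qs in \<open>auto simp: expand cs_closed linfun_simps mult_assoc\<close>)
    also have "\<dots> = cv_zero A" using x by (intro corner) (simp_all add: cs_closed star_mult star_star)
    finally have "?z = cv_zero A" using x qc eq_zero_of_star_mult[of ?z] by (simp add: cs_closed)
    then show ?thesis using x qc by (metis minus_eq_zero_iff mult_closed)
  qed
  have unit': "q \<otimes> x = x" if x: "x \<in> carr" for x
  proof -
    have "(x\<^sup>\<star> \<otimes> q)\<^sup>\<star> = (x\<^sup>\<star>)\<^sup>\<star>" using unit[of "x\<^sup>\<star>"] x by (simp add: star_closed)
    then show ?thesis using x qc qs by (simp add: star_mult star_star star_closed)
  qed
  have cut_sa: "\<exists>c. P i \<otimes> x \<otimes> P i = c \<odot> P i" if i: "i < r" and x: "x \<in> carr" "x\<^sup>\<star> = x" for i x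
  proof -
    let ?y = "P i \<otimes> x \<otimes> P i"
    have y: "?y \<in> carr" "?y\<^sup>\<star> = ?y" using P i x by (simp_all add: cs_closed star_mult mult_assoc)
    have "a \<otimes> ?y = ?y \<otimes> a" if a: "a \<in> D" for a
    proof -
      obtain c where c: "a \<otimes> P i = c \<odot> P i" using scalar a i by blast
      then have c': "P i \<otimes> a = c \<odot> P i" using Dcomm a P i by metis
      have "a \<otimes> ?y = c \<odot> ?y" using c Dc[OF a] P i x by (simp add: mult_assoc[symmetric] expand cs_closed)
      moreover have "?y \<otimes> a = c \<odot> ?y" using c' Dc[OF a] P i x by (simp add: mult_assoc expand cs_closed)
      ultimately show ?thesis by simp
    qed
    then have "?y \<in> D" using maximal_abelian_contains_commutant[OF max y] by blast
    then obtain c where "?y \<otimes> P i = c \<odot> P i" using scalar i by blast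
    moreover have "?y \<otimes> P i = ?y" using P i x by (simp add: mult_assoc cs_closed)
    ultimately show ?thesis by auto
  qed
  have cut: "\<exists>c. P i \<otimes> x \<otimes> P i = c \<odot> P i" if i: "i < r" and x: "x \<in> carr" for i x
  proof -
    obtain h k where hk: "h \<in> carr" "k \<in> carr" "h\<^sup>\<star> = h" "k\<^sup>\<star> = k" "x = h \<oplus> \<i> \<odot> k"
      using real_imaginary_parts[OF x] by metis
    obtain c c' where c: "P i \<otimes> h \<otimes> P i = c \<odot> P i" "P i \<otimes> k \<otimes> P i = c' \<odot> P i" using cut_sa hk i by metis
    have "P i \<otimes> x \<otimes> P i = (c + \<i> * c') \<odot> P i"
      unfolding hk(5) using hk(1,2) P i by (simp add: expand cs_closed c scale_add_left scale_scale)
    then show ?thesis by blast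
  qed
  show ?thesis
    by (rule that[of r P]) (use bound[OF fam] P unit unit' cut in \<open>auto simp: q_def\<close>)
qed

end

section \<open>Traces and signed sums\<close>

context cstar_algebra
begin

text \<open>The functional sends \<open>x\<close> to the sum of its diagonal entries.\<close>

lemma trace_functional:
  assumes rank: "has_rank A d"
  obtains \<tau> q where "linfun \<tau>" "\<And>x. x \<in> carr \<Longrightarrow> cmod (\<tau> x) \<le> real d * cs_norm A x"
    "\<And>h. h \<in> carr \<Longrightarrow> h\<^sup>\<star> = h \<Longrightarrow> (cs_norm A h)\<^sup>2 \<le> Re (\<tau> (h \<otimes> h))"
    "q \<in> carr" "q\<^sup>\<star> = q" "cs_norm A q \<le> 1" "\<And>x. x \<in> carr \<Longrightarrow> q \<otimes> x = x \<and> x \<otimes> q = x"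
proof -
  obtain D where D: "maximal_abelian A D" "has_dim A D d" using rank by (auto simp: has_rank_def)
  obtain P r where r: "r \<le> d"
    and P: "\<And>i. i < r \<Longrightarrow> P i \<in> carr \<and> (P i)\<^sup>\<star> = P i \<and> P i \<otimes> P i = P i \<and> P i \<noteq> cv_zero A"
    and unit: "\<And>x. x \<in> carr \<Longrightarrow> vsum P r \<otimes> x = x \<and> x \<otimes> vsum P r = x"
    and cut: "\<And>i x. i < r \<Longrightarrow> x \<in> carr \<Longrightarrow> \<exists>c. P i \<otimes> x \<otimes> P i = c \<odot> P i"
    using diagonal_projections[OF D] by metis
  define q where "q = vsum P r"
  have qc: "q \<in> carr" unfolding q_def by (rule vsum_closed) (use P in auto)
  have q1: "q \<otimes> x = x" "x \<otimes> q = x" if "x \<in> carr" for x using unit that by (auto simp: q_def)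
  have qs: "q\<^sup>\<star> = q"
  proof -
    have "q\<^sup>\<star> = q\<^sup>\<star> \<otimes> q" using q1 qc by (simp add: star_closed)
    then have "(q\<^sup>\<star>)\<^sup>\<star> = (q\<^sup>\<star> \<otimes> q)\<^sup>\<star>" by simp
    also have "\<dots> = q\<^sup>\<star> \<otimes> q" using qc by (simp add: star_mult star_star star_closed)
    finally show ?thesis using q1 qc by (simp add: star_star star_closed)
  qed
  have qn: "cs_norm A q \<le> 1"
    using projection_norm[OF qc qs] q1 qc N_zero by (metis order_refl zero_le_one)
  \<comment> \<open>\<open>f i x\<close> is the diagonal entry of \<open>x\<close> at
    \<open>P i\<close>.\<close>
  define f where "f i x = (SOME c. P i \<otimes> x \<otimes> P i = c \<odot> P i)" for i x
  have f: "P i \<otimes> x \<otimes> P i = f i x \<odot> P i" if "i < r" "x \<in> carr" for i x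
    unfolding f_def using cut[OF that] by (rule someI_ex)
  have uniq: "c = c'" if "c \<odot> P i = c' \<odot> P i" "i < r" for i c c'
  proof -
    have "(c - c') \<odot> P i = c \<odot> P i \<ominus> c' \<odot> P i"
      by (rule lin_eqI) (use P that(2) in \<open>auto simp: linfun_simps closed minus_closed algebra_simps\<close>)
    also have "\<dots> = cv_zero A" using that P by (metis minus_eq_zero_iff scale_closed)
    finally show ?thesis using scale_cancel[of "c - c'" "P i"] P that by simp
  qed
  have f_lin: "linfun (f i)" if i: "i < r" for i
    unfolding linfun_def
  proof (intro conjI ballI allI)
    fix x y assume xy: "x \<in> carr" "y \<in> carr"
    have "f i (x \<oplus> y) \<odot> P i = (f i x + f i y) \<odot> P i"
      using f[OF i, of "x \<oplus> y", symmetric] xy P i by (simp add: closed expand mult_closed f scale_add_left)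
    then show "f i (x \<oplus> y) = f i x + f i y" using uniq i by blast
  next
    fix c x assume x: "x \<in> carr"
    have "f i (c \<odot> x) \<odot> P i = (c * f i x) \<odot> P i"
      using f[OF i, of "c \<odot> x", symmetric] x P i by (simp add: closed expand mult_closed f scale_scale)
    then show "f i (c \<odot> x) = c * f i x" using uniq i by blast
  qed
  have f_cut: "cmod (f i x) = cs_norm A (P i \<otimes> x \<otimes> P i)" if "i < r" "x \<in> carr" for i x
    using f[OF that] P that projection_norm[of "P i"] by (simp add: norm_scale)
  have f_norm: "cmod (f i x) \<le> cs_norm A x" if "i < r" "x \<in> carr" for i x
  proof -
    have "cs_norm A (P i \<otimes> x \<otimes> P i) \<le> cs_norm A (P i) * cs_norm A x * cs_norm A (P i)"
      using P that by (intro order.trans[OF norm_mult] mult_right_mono norm_mult nonneg) (auto simp: mult_closed)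
    then show ?thesis using f_cut that P projection_norm[of "P i"] by simp
  qed
  have f_real: "Im (f i x) = 0" if "i < r" "x \<in> carr" "x\<^sup>\<star> = x" for i x
  proof -
    have "(f i x \<odot> P i)\<^sup>\<star> = f i x \<odot> P i"
      unfolding f[OF that(1,2), symmetric] using P that by (simp add: star_mult mult_assoc mult_closed)
    then have "cnj (f i x) = f i x" using P that uniq by (simp add: star_scale)
    then show ?thesis by (simp add: complex_eq_iff)
  qed
  \<comment> \<open>For a contraction \<open>h\<close> one has \<open>q - h^2 = (q - y)^2\<close>,
    and \<open>q - y\<close> is a contraction: up to the factor \<open>i\<close> it is half the
    difference of the two unitaries applied to \<open>q\<close>. Hence \<open>1 - f i (h^2)\<close>
    has modulus at most one.\<close>
  have f_pos1: "0 \<le> Re (f i (h \<otimes> h))" if i: "i < r" and h: "h \<in> carr" "h\<^sup>\<star> = h" "cs_norm A h \<le> 1" for i h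
  proof -
    have "cs_norm A (h \<otimes> h) \<le> 1" using norm_selfadjoint_square[OF h(1,2)] h nonneg by (simp add: power_le_one)
    moreover have "(h \<otimes> h)\<^sup>\<star> = h \<otimes> h" using h by (simp add: star_mult)
    ultimately obtain y where y: "y \<in> carr" "2 \<odot> y = h \<otimes> h \<oplus> y \<otimes> y" "y\<^sup>\<star> = y"
      and comm: "\<And>w. w \<in> carr \<Longrightarrow> w \<otimes> (h \<otimes> h) = (h \<otimes> h) \<otimes> w \<Longrightarrow> w \<otimes> y = y \<otimes> w"
      using sqrt_one_minus[of "h \<otimes> h"] h mult_closed by metis
    have hy: "h \<otimes> y = y \<otimes> h" using comm[OF h(1)] h mult_assoc by simp
    let ?W = "\<lambda>k. h \<otimes> q \<oplus> k \<odot> (q \<ominus> y \<otimes> q)"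
    have W: "cs_norm A (?W k) \<le> 1" if "k = \<i> \<or> k = - \<i>" for k
      using norm_unitary_mult[OF h(1) y(1) h(2) y(3) hy y(2) that qc] qn by simp
    have "(2 * \<i>) \<odot> (q \<ominus> y) = ?W \<i> \<ominus> ?W (-\<i>)"
      by (rule lin_eqI) (use h y qc q1 in \<open>auto simp: linfun_simps cs_closed algebra_simps\<close>)
    then have "cs_norm A ((2 * \<i>) \<odot> (q \<ominus> y)) \<le> 1 + 1"
      using N_minus_le[of "?W \<i>" "?W (-\<i>)"] W[of \<i>] W[of "-\<i>"] h y qc by (simp add: cs_closed)
    then have qy: "cs_norm A (q \<ominus> y) \<le> 1" using y qc by (simp add: scale cs_closed Real_Vector_Spaces.norm_mult)
    have hh: "h \<otimes> h = 2 \<odot> y \<ominus> y \<otimes> y"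
      unfolding y(2) by (rule lin_eqI) (use y(1) h in \<open>auto simp: linfun_simps cs_closed\<close>)
    have "q \<ominus> h \<otimes> h = (q \<ominus> y) \<otimes> (q \<ominus> y)"
      unfolding hh by (rule lin_eqI) (use y(1) qc q1 in \<open>auto simp: linfun_simps cs_closed expand\<close>)
    then have "cs_norm A (q \<ominus> h \<otimes> h) \<le> cs_norm A (q \<ominus> y) * cs_norm A (q \<ominus> y)"
      using norm_mult[of "q \<ominus> y" "q \<ominus> y"] y qc by (simp add: minus_closed)
    also have "\<dots> \<le> 1" using qy y qc by (simp add: mult_le_one nonneg minus_closed)
    finally have 1: "cmod (f i (q \<ominus> h \<otimes> h)) \<le> 1"
      using f_norm[OF i, of "q \<ominus> h \<otimes> h"] qc h by (simp add: cs_closed)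
    have "f i q \<odot> P i = 1 \<odot> P i" using f[OF i qc] P i q1 by (simp add: scale_one)
    then have "f i q = 1" using uniq i by blast
    then have "f i (q \<ominus> h \<otimes> h) = 1 - f i (h \<otimes> h)"
      using linfun_minus[OF f_lin[OF i]] qc h by (simp add: cs_closed)
    then have "cmod (1 - f i (h \<otimes> h)) \<le> 1" using 1 by simp
    then have "Re (1 - f i (h \<otimes> h)) \<le> 1" using complex_Re_le_cmod order.trans by blast
    then show ?thesis by simp
  qed
  have f_pos: "f i (h \<otimes> h) = complex_of_real (cmod (f i (h \<otimes> h)))"
    if i: "i < r" and h: "h \<in> carr" "h\<^sup>\<star> = h" for i h
  proof -
    \<comment> \<open>Scaling by \<open>t\<close> makes \<open>h\<close> a contraction; the summand
      1 covers \<open>h = 0\<close>.\<close>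
    define t where "t = 1 / (1 + cs_norm A h)"
    have t: "t > 0" "t * cs_norm A h \<le> 1" using nonneg[OF h(1)] by (simp_all add: t_def add_pos_nonneg)
    let ?h = "complex_of_real t \<odot> h"
    have "0 \<le> Re (f i (?h \<otimes> ?h))"
      by (rule f_pos1[OF i]) (use h t in \<open>auto simp: closed star_scale norm_scale\<close>)
    also have "f i (?h \<otimes> ?h) = complex_of_real (t * t) * f i (h \<otimes> h)"
      using h linfun_scale[OF f_lin[OF i]] by (simp add: expand closed mult_closed)
    finally have "0 \<le> (t * t) * Re (f i (h \<otimes> h))" by simp
    then have "0 \<le> Re (f i (h \<otimes> h))" using mult_le_cancel_left_pos[of "t * t" 0] t by simp
    moreover have "Im (f i (h \<otimes> h)) = 0" using h by (intro f_real[OF i]) (auto simp: mult_closed star_mult)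
    ultimately show ?thesis by (simp add: complex_eq_iff cmod_def)
  qed
  define \<tau> where "\<tau> x = (\<Sum>i<r. f i x)" for x
  have "linfun \<tau>" unfolding linfun_def \<tau>_def
    using f_lin by (auto simp: linfun_add linfun_scale sum.distrib sum_distrib_left)
  moreover have "cmod (\<tau> x) \<le> real d * cs_norm A x" if x: "x \<in> carr" for x
  proof -
    have "cmod (\<tau> x) \<le> (\<Sum>i<r. cs_norm A x)"
      unfolding \<tau>_def using f_norm x by (intro order.trans[OF norm_sum] sum_mono) auto
    also have "\<dots> \<le> real d * cs_norm A x" using r nonneg[OF x] by (simp add: mult_right_mono)
    finally show ?thesis .
  qed
  moreover have "(cs_norm A h)\<^sup>2 \<le> Re (\<tau> (h \<otimes> h))" if h: "h \<in> carr" "h\<^sup>\<star> = h" for h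
  proof -
    \<comment> \<open>The \<open>P i\<close> sum to the unit, so \<open>h^2\<close> is the sum of
      the \<open>h P i h\<close>, and the C*-identity turns the norm of \<open>h P i h\<close> into
      that of \<open>P i h^2 P i\<close>, which is a diagonal entry.\<close>
    have "h \<otimes> h = vsum (\<lambda>i. h \<otimes> P i \<otimes> h) r"
    proof (rule lin_eqI)
      fix g assume g: "linfun g"
      have "g (h \<otimes> h) = g (h \<otimes> q \<otimes> h)" using h q1 by simp
      also have "\<dots> = (\<Sum>i<r. g (h \<otimes> P i \<otimes> h))" unfolding q_def
        by (rule linfun_vsum[OF linfun_mult_left[OF linfun_mult_right]]) (use g h P in auto)
      also have "\<dots> = g (vsum (\<lambda>i. h \<otimes> P i \<otimes> h) r)"
        by (rule linfun_vsum[symmetric]) (use g h P in \<open>auto simp: mult_closed\<close>)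
      finally show "g (h \<otimes> h) = g (vsum (\<lambda>i. h \<otimes> P i \<otimes> h) r)" .
    qed (use h P in \<open>auto intro!: vsum_closed simp: mult_closed\<close>)
    then have "(cs_norm A h)\<^sup>2 = cs_norm A (vsum (\<lambda>i. h \<otimes> P i \<otimes> h) r)"
      using norm_selfadjoint_square[OF h] by simp
    also have "\<dots> \<le> (\<Sum>i<r. cs_norm A (h \<otimes> P i \<otimes> h))"
      by (rule N_vsum) (use h P in \<open>auto simp: mult_closed\<close>)
    also have "\<dots> = (\<Sum>i<r. Re (f i (h \<otimes> h)))"
    proof (rule sum.cong)
      fix i assume "i \<in> {..<r}"
      then have i: "i < r" by simp
      note Pi = P[OF i]
      have "h \<otimes> P i \<otimes> h = (P i \<otimes> h)\<^sup>\<star> \<otimes> (P i \<otimes> h)"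
        using h Pi by (simp add: star_mult mult_assoc mult_closed) (metis mult_assoc)
      then have "cs_norm A (h \<otimes> P i \<otimes> h) = (cs_norm A ((P i \<otimes> h)\<^sup>\<star>))\<^sup>2"
        using h Pi by (simp add: cstar_identity norm_star mult_closed)
      also have "\<dots> = (cs_norm A (h \<otimes> P i))\<^sup>2" using h Pi by (simp add: star_mult)
      also have "\<dots> = cs_norm A ((h \<otimes> P i)\<^sup>\<star> \<otimes> (h \<otimes> P i))" using h Pi by (simp add: cstar_identity mult_closed)
      also have "(h \<otimes> P i)\<^sup>\<star> \<otimes> (h \<otimes> P i) = P i \<otimes> (h \<otimes> h) \<otimes> P i"
        using h Pi by (simp add: star_mult mult_assoc mult_closed)
      also have "cs_norm A \<dots> = cmod (f i (h \<otimes> h))" using f_cut[OF i] h by (simp add: mult_closed)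
      also have "\<dots> = Re (f i (h \<otimes> h))" by (subst f_pos[OF i h]) simp
      finally show "cs_norm A (h \<otimes> P i \<otimes> h) = Re (f i (h \<otimes> h))" .
    qed simp
    finally show ?thesis by (simp add: \<tau>_def)
  qed
  ultimately show ?thesis using that[of \<tau> q] qc qs qn q1 by blast
qed

end

section \<open>Moments of sums of random signs\<close>

abbreviation signs :: "nat \<Rightarrow> (nat \<Rightarrow> real) set" where
  "signs n \<equiv> {..<n} \<rightarrow>\<^sub>E {1, -1}"

lemma card_signs: "card (signs n) = 2 ^ n"
  by (simp add: card_PiE numeral_2_eq_2)

lemma sum_signs_prod: "(\<Sum>\<epsilon>\<in>signs n. \<Prod>s<n. f s (\<epsilon> s)) = (\<Prod>s<n. f s 1 + f s (-1) :: real)"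
  using prod_sum_PiE[of "{..<n}" "\<lambda>_. {1, -1::real}" f] by simp

text \<open>A word in the signs averages to one if every letter occurs an even number of times, and
  to zero otherwise.\<close>

lemma sum_signs_character_nonneg:
  assumes "set T \<subseteq> {..<n}"
  shows "0 \<le> (\<Sum>\<epsilon>\<in>signs n. prod_list (map \<epsilon> T))"
proof -
  have "prod_list (map \<epsilon> T) = (\<Prod>s<n. \<epsilon> s ^ count_list T s)" for \<epsilon> :: "nat \<Rightarrow> real"
    using assms
  proof (induction T)
    case (Cons t T)
    have "(\<Prod>s<n. \<epsilon> s ^ count_list (t # T) s) = (\<Prod>s<n. (if s = t then \<epsilon> s else 1) * \<epsilon> s ^ count_list T s)"
      by (rule prod.cong) auto
    also have "\<dots> = \<epsilon> t * (\<Prod>s<n. \<epsilon> s ^ count_list T s)" using Cons.prems by (simp add: prod.distrib)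
    finally show ?case using Cons by simp
  qed simp
  then have "(\<Sum>\<epsilon>\<in>signs n. prod_list (map \<epsilon> T)) = (\<Prod>s<n. 1 ^ count_list T s + (-1) ^ count_list T s)"
    using sum_signs_prod[of "\<lambda>s e. e ^ count_list T s" n] by simp
  also have "\<dots> \<ge> 0"
  proof (rule prod_nonneg)
    fix s show "(0::real) \<le> 1 ^ count_list T s + (-1) ^ count_list T s"
      by (cases "even (count_list T s)") auto
  qed
  finally show ?thesis .
qed

text \<open>Each factor of the power adds a letter to the word. These sums are the weights in the
  trace estimate, where norms may be replaced by upper bounds only because the weights are
  nonnegative.\<close>

lemma sum_signs_moment_nonneg:
  "set T \<subseteq> {..<n} \<Longrightarrow> 0 \<le> (\<Sum>\<epsilon>\<in>signs n. prod_list (map \<epsilon> T) * (\<Sum>s<n. \<epsilon> s) ^ m)"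
proof (induction m arbitrary: T)
  case 0
  then show ?case using sum_signs_character_nonneg by simp
next
  case (Suc m)
  have "(\<Sum>\<epsilon>\<in>signs n. prod_list (map \<epsilon> T) * (\<Sum>s<n. \<epsilon> s) ^ Suc m)
      = (\<Sum>\<epsilon>\<in>signs n. \<Sum>s<n. prod_list (map \<epsilon> (s # T)) * (\<Sum>s<n. \<epsilon> s) ^ m)"
    by (simp add: sum_distrib_left sum_distrib_right mult_ac)
  also have "\<dots> = (\<Sum>s<n. \<Sum>\<epsilon>\<in>signs n. prod_list (map \<epsilon> (s # T)) * (\<Sum>s<n. \<epsilon> s) ^ m)"
    by (rule sum.swap)
  also have "\<dots> \<ge> 0" using Suc by (intro sum_nonneg Suc.IH) auto
  finally show ?case .
qed

text \<open>The sub-Gaussian bound \<open>cosh x \<le> exp (x^2)\<close>, from second order bounds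
  for both exponentials; the one at \<open>- x\<close> rests on
  \<open>(1 - x + x^2) (1 + x) = 1 + x^3\<close>.\<close>

lemma exp_add_exp_minus_le:
  fixes x :: real
  assumes "0 \<le> x" "x \<le> 1"
  shows "exp x + exp (- x) \<le> 2 * exp (x\<^sup>2)"
proof -
  have 1: "exp x \<le> 1 + x + x\<^sup>2" using exp_bound assms by simp
  have "1 \<le> (1 - x + x\<^sup>2) * (1 + x)" using assms by (simp add: power2_eq_square algebra_simps)
  also have "\<dots> \<le> (1 - x + x\<^sup>2) * exp x"
  proof (rule mult_left_mono)
    show "0 \<le> 1 - x + x\<^sup>2" using assms zero_le_power2[of x] by linarith
  qed (use exp_ge_add_one_self in auto)
  finally have 2: "exp (- x) \<le> 1 - x + x\<^sup>2" by (simp add: exp_minus field_simps)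
  have "1 + x\<^sup>2 \<le> exp (x\<^sup>2)" by (rule exp_ge_add_one_self)
  then show ?thesis using 1 2 by linarith
qed

text \<open>Chernoff's method: \<open>u \<le> exp (u - 1)\<close> at \<open>u = l |x| / M\<close>,
  raised to the power \<open>M\<close>, bounds \<open>x^M\<close> by exponentials, whose sums over
  the signs factorize. The parameter \<open>l\<close> stays free to be matched to
  \<open>M\<close>.\<close>

lemma sum_signs_even_moment_le:
  fixes l :: real
  assumes M: "M > 0" "even M" and l: "0 < l" "l \<le> 1"
  shows "(\<Sum>\<epsilon>\<in>signs n. (\<Sum>s<n. \<epsilon> s) ^ M) \<le> 2 ^ n * (2 * (real M / (exp 1 * l)) ^ M * exp (real n * l\<^sup>2))"
proof -
  have pt: "x ^ M \<le> (real M / (exp 1 * l)) ^ M * (exp (l * x) + exp (- (l * x)))" for x :: real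
  proof -
    have "l * \<bar>x\<bar> / real M \<le> exp (l * \<bar>x\<bar> / real M - 1)"
      using exp_ge_add_one_self[of "l * \<bar>x\<bar> / real M - 1"] by simp
    then have "(l * \<bar>x\<bar> / real M) ^ M \<le> exp (l * \<bar>x\<bar> / real M - 1) ^ M" using l by (intro power_mono) auto
    also have "\<dots> = exp (l * \<bar>x\<bar> - real M)" using M by (simp add: exp_of_nat_mult[symmetric] algebra_simps)
    also have "\<dots> = exp (l * \<bar>x\<bar>) / exp 1 ^ M" by (simp add: exp_diff exp_of_nat_mult[symmetric])
    finally have "\<bar>x\<bar> ^ M \<le> (real M / (exp 1 * l)) ^ M * exp (l * \<bar>x\<bar>)"
      using M l by (simp add: power_divide power_mult_distrib field_simps)
    also have "\<dots> \<le> (real M / (exp 1 * l)) ^ M * (exp (l * x) + exp (- (l * x)))"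
      using l by (intro mult_left_mono) (auto simp: abs_if)
    finally show ?thesis using M by (simp add: power_even_abs)
  qed
  have E: "(\<Sum>\<epsilon>\<in>signs n. exp (c * (\<Sum>s<n. \<epsilon> s))) \<le> 2 ^ n * exp (real n * l\<^sup>2)" if "c = l \<or> c = - l" for c
  proof -
    have "(\<Sum>\<epsilon>\<in>signs n. exp (c * (\<Sum>s<n. \<epsilon> s))) = (\<Prod>s<n. exp (c * 1) + exp (c * (-1)))"
      using sum_signs_prod[of "\<lambda>s e. exp (c * e)" n] by (simp add: sum_distrib_left exp_sum)
    also have "\<dots> = (exp l + exp (- l)) ^ n" using that by (auto simp: add.commute)
    also have "\<dots> \<le> (2 * exp (l\<^sup>2)) ^ n"
      using exp_add_exp_minus_le[of l] l by (intro power_mono) auto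
    also have "\<dots> = 2 ^ n * exp (real n * l\<^sup>2)" by (simp add: power_mult_distrib exp_of_nat_mult)
    finally show ?thesis .
  qed
  have "(\<Sum>\<epsilon>\<in>signs n. (\<Sum>s<n. \<epsilon> s) ^ M) \<le> (\<Sum>\<epsilon>\<in>signs n. (real M / (exp 1 * l)) ^ M *
      (exp (l * (\<Sum>s<n. \<epsilon> s)) + exp (- (l * (\<Sum>s<n. \<epsilon> s)))))"
    by (intro sum_mono pt)
  also have "\<dots> = (real M / (exp 1 * l)) ^ M * ((\<Sum>\<epsilon>\<in>signs n. exp (l * (\<Sum>s<n. \<epsilon> s))) + (\<Sum>\<epsilon>\<in>signs n. exp (- l * (\<Sum>s<n. \<epsilon> s))))"
    by (simp only: sum_distrib_left[symmetric] sum.distrib mult_minus_left)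
  also have "\<dots> \<le> (real M / (exp 1 * l)) ^ M * (2 ^ n * exp (real n * l\<^sup>2) + 2 ^ n * exp (real n * l\<^sup>2))"
    using E[of l] E[of "- l"] l by (intro mult_left_mono add_mono) auto
  finally show ?thesis by (simp add: algebra_simps)
qed

section \<open>Moments of signed sums under the trace\<close>

context cstar_algebra
begin

abbreviation signed_sum :: "(nat \<Rightarrow> 'a) \<Rightarrow> nat \<Rightarrow> (nat \<Rightarrow> real) \<Rightarrow> 'a" where
  "signed_sum z n \<epsilon> \<equiv> vsum (\<lambda>s. complex_of_real (\<epsilon> s) \<odot> z s) n"

text \<open>Powers need a value at exponent 0, and the algebra carries no constant for a unit;
  \<open>q\<close> stands for the unit that comes with the trace.\<close>

primrec upow :: "'a \<Rightarrow> 'a \<Rightarrow> nat \<Rightarrow> 'a" where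
  "upow q x 0 = q"
| "upow q x (Suc n) = x \<otimes> upow q x n"

lemma upow_closed: "\<lbrakk>q \<in> carr; x \<in> carr\<rbrakk> \<Longrightarrow> upow q x n \<in> carr"
  by (induction n) (auto simp: mult_closed)

text \<open>Expanding \<open>(S\<^sup>* S)\<^sup>m\<close> into words, every word has norm at most 1 and the average of its sign is
  nonnegative, so the moments are at most those of a scalar random walk.\<close>

lemma sum_signs_trace_le:
  assumes z: "\<And>s. s < n \<Longrightarrow> z s \<in> carr" "\<And>s. s < n \<Longrightarrow> cs_norm A (z s) \<le> 1"
    and \<tau>: "linfun \<tau>" "\<And>x. x \<in> carr \<Longrightarrow> cmod (\<tau> x) \<le> real d * cs_norm A x"
    and q: "q \<in> carr" "\<And>x. x \<in> carr \<Longrightarrow> x \<otimes> q = x"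
  shows "\<lbrakk>u \<in> carr; set T \<subseteq> {..<n}\<rbrakk> \<Longrightarrow>
    (\<Sum>\<epsilon>\<in>signs n. prod_list (map \<epsilon> T) * Re (\<tau> (u \<otimes> upow q ((signed_sum z n \<epsilon>)\<^sup>\<star> \<otimes> signed_sum z n \<epsilon>) m)))
    \<le> real d * cs_norm A u * (\<Sum>\<epsilon>\<in>signs n. prod_list (map \<epsilon> T) * (\<Sum>s<n. \<epsilon> s) ^ (2 * m))"
\<comment> \<open>The letters already read are collected in \<open>u\<close> and their signs in
  \<open>T\<close>; each further factor of the power adds two letters, so both must be
  general.\<close>
proof (induction m arbitrary: u T)
  case 0
  have "Re (\<tau> u) \<le> real d * cs_norm A u" using \<tau>(2)[OF 0(1)] complex_Re_le_cmod order.trans by blast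
  then have "(\<Sum>\<epsilon>\<in>signs n. prod_list (map \<epsilon> T)) * Re (\<tau> u)
      \<le> (\<Sum>\<epsilon>\<in>signs n. prod_list (map \<epsilon> T)) * (real d * cs_norm A u)"
    using sum_signs_character_nonneg[OF 0(2)] by (rule mult_left_mono)
  moreover have "(\<Sum>\<epsilon>\<in>signs n. prod_list (map \<epsilon> T) * Re (\<tau> (u \<otimes> q))) = (\<Sum>\<epsilon>\<in>signs n. prod_list (map \<epsilon> T)) * Re (\<tau> u)"
    using q(2)[OF 0(1)] by (simp add: sum_distrib_right)
  ultimately show ?case by (simp add: mult.commute)
next
  case (Suc m)
  let ?S = "signed_sum z n"
  let ?U = "\<lambda>\<epsilon> m. upow q ((?S \<epsilon>)\<^sup>\<star> \<otimes> ?S \<epsilon>) m"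
  let ?u = "\<lambda>s t. u \<otimes> (z s)\<^sup>\<star> \<otimes> z t"
  have Sc: "?S \<epsilon> \<in> carr" for \<epsilon> using z by (intro vsum_closed) (simp add: closed)
  then have Uc: "?U \<epsilon> m \<in> carr" for \<epsilon> m using q by (intro upow_closed) (auto simp: cs_closed)
  have Sstar: "(?S \<epsilon>)\<^sup>\<star> = vsum (\<lambda>s. complex_of_real (\<epsilon> s) \<odot> (z s)\<^sup>\<star>) n" for \<epsilon>
  proof -
    have "(vsum (\<lambda>s. complex_of_real (\<epsilon> s) \<odot> z s) k)\<^sup>\<star> = vsum (\<lambda>s. complex_of_real (\<epsilon> s) \<odot> (z s)\<^sup>\<star>) k"
      if "k \<le> n" for k
      using that by (induction k) (use z in \<open>auto simp: expand closed vsum_closed\<close>)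
    then show ?thesis by simp
  qed
  have exp: "\<tau> (u \<otimes> ?U \<epsilon> (Suc m)) = (\<Sum>s<n. \<Sum>t<n. complex_of_real (\<epsilon> s * \<epsilon> t) * \<tau> (?u s t \<otimes> ?U \<epsilon> m))" for \<epsilon>
  proof -
    have "u \<otimes> ?U \<epsilon> (Suc m) = u \<otimes> ((?S \<epsilon>)\<^sup>\<star> \<otimes> (?S \<epsilon> \<otimes> ?U \<epsilon> m))"
      using Suc.prems Sc Uc by (simp add: mult_assoc cs_closed)
    then have "\<tau> (u \<otimes> ?U \<epsilon> (Suc m)) = \<tau> (u \<otimes> ((?S \<epsilon>)\<^sup>\<star> \<otimes> (?S \<epsilon> \<otimes> ?U \<epsilon> m)))"
      by (rule arg_cong)
    also have "\<dots> = (\<Sum>s<n. \<tau> (u \<otimes> ((complex_of_real (\<epsilon> s) \<odot> (z s)\<^sup>\<star>) \<otimes> (?S \<epsilon> \<otimes> ?U \<epsilon> m))))"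
    proof -
      have "\<tau> (u \<otimes> ((?S \<epsilon>)\<^sup>\<star> \<otimes> w)) = (\<Sum>s<n. \<tau> (u \<otimes> ((complex_of_real (\<epsilon> s) \<odot> (z s)\<^sup>\<star>) \<otimes> w)))"
        if "w \<in> carr" for w
        unfolding Sstar
        by (rule linfun_vsum[OF linfun_mult_right[OF linfun_mult_left]])
          (use \<tau> Suc.prems that z in \<open>auto simp: cs_closed\<close>)
      then show ?thesis using Sc Uc by (simp add: mult_closed)
    qed
    also have "\<dots> = (\<Sum>s<n. \<Sum>t<n. complex_of_real (\<epsilon> s * \<epsilon> t) * \<tau> (?u s t \<otimes> ?U \<epsilon> m))"
    proof (rule sum.cong)
      fix s assume s: "s \<in> {..<n}"
      let ?c = "complex_of_real (\<epsilon> s)"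
      have "\<tau> (u \<otimes> ((?c \<odot> (z s)\<^sup>\<star>) \<otimes> (?S \<epsilon> \<otimes> ?U \<epsilon> m)))
          = (\<Sum>t<n. \<tau> (u \<otimes> ((?c \<odot> (z s)\<^sup>\<star>) \<otimes> ((complex_of_real (\<epsilon> t) \<odot> z t) \<otimes> ?U \<epsilon> m))))"
        by (rule linfun_vsum[OF linfun_mult_right[OF linfun_mult_left[OF linfun_mult_left]]])
          (use \<tau> Suc.prems s Uc z in \<open>auto simp: cs_closed\<close>)
      also have "\<dots> = (\<Sum>t<n. complex_of_real (\<epsilon> s * \<epsilon> t) * \<tau> (?u s t \<otimes> ?U \<epsilon> m))"
        using \<tau> Suc.prems s Uc z
        by (intro sum.cong) (auto simp: expand cs_closed linfun_simps mult_assoc)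
      finally show "\<tau> (u \<otimes> ((?c \<odot> (z s)\<^sup>\<star>) \<otimes> (?S \<epsilon> \<otimes> ?U \<epsilon> m)))
          = (\<Sum>t<n. complex_of_real (\<epsilon> s * \<epsilon> t) * \<tau> (?u s t \<otimes> ?U \<epsilon> m))" .
    qed simp
    finally show ?thesis .
  qed
  have "(\<Sum>\<epsilon>\<in>signs n. prod_list (map \<epsilon> T) * Re (\<tau> (u \<otimes> ?U \<epsilon> (Suc m))))
      = (\<Sum>\<epsilon>\<in>signs n. \<Sum>s<n. \<Sum>t<n. prod_list (map \<epsilon> (s # t # T)) * Re (\<tau> (?u s t \<otimes> ?U \<epsilon> m)))"
    unfolding exp by (simp add: sum_distrib_left mult_ac del: of_real_mult)
  also have "\<dots> = (\<Sum>s<n. \<Sum>\<epsilon>\<in>signs n. \<Sum>t<n. prod_list (map \<epsilon> (s # t # T)) * Re (\<tau> (?u s t \<otimes> ?U \<epsilon> m)))"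
    by (rule sum.swap)
  also have "\<dots> = (\<Sum>s<n. \<Sum>t<n. \<Sum>\<epsilon>\<in>signs n. prod_list (map \<epsilon> (s # t # T)) * Re (\<tau> (?u s t \<otimes> ?U \<epsilon> m)))"
    by (intro sum.cong refl sum.swap)
  also have "\<dots> \<le> (\<Sum>s<n. \<Sum>t<n. real d * cs_norm A u *
      (\<Sum>\<epsilon>\<in>signs n. prod_list (map \<epsilon> (s # t # T)) * (\<Sum>s<n. \<epsilon> s) ^ (2 * m)))"
  proof (intro sum_mono)
    fix s t assume st: "s \<in> {..<n}" "t \<in> {..<n}"
    have uc: "?u s t \<in> carr" using Suc.prems z st by (simp add: cs_closed)
    have T: "set (s # t # T) \<subseteq> {..<n}" using Suc.prems st by simp
    have "cs_norm A (?u s t) \<le> cs_norm A u * cs_norm A ((z s)\<^sup>\<star>) * cs_norm A (z t)"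
      using Suc.prems z st by (intro order.trans[OF norm_mult] mult_right_mono norm_mult nonneg) (auto simp: cs_closed)
    also have "\<dots> \<le> cs_norm A u * 1 * 1"
      using Suc.prems z st by (intro mult_mono) (auto simp: norm_star nonneg)
    finally have un: "real d * cs_norm A (?u s t) \<le> real d * cs_norm A u" by (simp add: mult_left_mono)
    have "(\<Sum>\<epsilon>\<in>signs n. prod_list (map \<epsilon> (s # t # T)) * Re (\<tau> (?u s t \<otimes> ?U \<epsilon> m)))
        \<le> real d * cs_norm A (?u s t) * (\<Sum>\<epsilon>\<in>signs n. prod_list (map \<epsilon> (s # t # T)) * (\<Sum>s<n. \<epsilon> s) ^ (2 * m))"
      by (rule Suc.IH[OF uc T])
    also have "\<dots> \<le> real d * cs_norm A u * (\<Sum>\<epsilon>\<in>signs n. prod_list (map \<epsilon> (s # t # T)) * (\<Sum>s<n. \<epsilon> s) ^ (2 * m))"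
      by (rule mult_right_mono[OF un sum_signs_moment_nonneg[OF T]])
    finally show "(\<Sum>\<epsilon>\<in>signs n. prod_list (map \<epsilon> (s # t # T)) * Re (\<tau> (?u s t \<otimes> ?U \<epsilon> m)))
        \<le> real d * cs_norm A u * (\<Sum>\<epsilon>\<in>signs n. prod_list (map \<epsilon> (s # t # T)) * (\<Sum>s<n. \<epsilon> s) ^ (2 * m))" .
  qed
  also have "\<dots> = real d * cs_norm A u *
      (\<Sum>s<n. \<Sum>t<n. \<Sum>\<epsilon>\<in>signs n. prod_list (map \<epsilon> (s # t # T)) * (\<Sum>s<n. \<epsilon> s) ^ (2 * m))"
    by (simp only: sum_distrib_left)
  also have "(\<Sum>s<n. \<Sum>t<n. \<Sum>\<epsilon>\<in>signs n. prod_list (map \<epsilon> (s # t # T)) * (\<Sum>s<n. \<epsilon> s) ^ (2 * m))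
      = (\<Sum>s<n. \<Sum>\<epsilon>\<in>signs n. \<Sum>t<n. prod_list (map \<epsilon> (s # t # T)) * (\<Sum>s<n. \<epsilon> s) ^ (2 * m))"
    by (intro sum.cong refl sum.swap)
  also have "\<dots> = (\<Sum>\<epsilon>\<in>signs n. \<Sum>s<n. \<Sum>t<n. prod_list (map \<epsilon> (s # t # T)) * (\<Sum>s<n. \<epsilon> s) ^ (2 * m))"
    by (rule sum.swap)
  also have "\<dots> = (\<Sum>\<epsilon>\<in>signs n. prod_list (map \<epsilon> T) * (\<Sum>s<n. \<epsilon> s) ^ (2 * Suc m))"
  proof (rule sum.cong)
    fix \<epsilon> :: "nat \<Rightarrow> real"
    have "(\<Sum>s<n. \<Sum>t<n. prod_list (map \<epsilon> (s # t # T)) * (\<Sum>s<n. \<epsilon> s) ^ (2 * m))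
        = ((\<Sum>s<n. \<epsilon> s) * (\<Sum>t<n. \<epsilon> t)) * (prod_list (map \<epsilon> T) * (\<Sum>s<n. \<epsilon> s) ^ (2 * m))"
      unfolding sum_product by (simp add: sum_distrib_right mult.assoc)
    then show "(\<Sum>s<n. \<Sum>t<n. prod_list (map \<epsilon> (s # t # T)) * (\<Sum>s<n. \<epsilon> s) ^ (2 * m))
        = prod_list (map \<epsilon> T) * (\<Sum>s<n. \<epsilon> s) ^ (2 * Suc m)" by (simp add: mult_ac)
  qed simp
  finally show ?case .
qed

text \<open>For exponents that are powers of two, repeated squaring of the self-adjoint base and the
  C*-identity compute the norm exactly. One more doubling makes the power a square, whose trace
  dominates a squared norm.\<close>

lemma norm_upow_le_trace:
  assumes x: "x \<in> carr" and q: "q \<in> carr" "q\<^sup>\<star> = q" "\<And>x. x \<in> carr \<Longrightarrow> q \<otimes> x = x \<and> x \<otimes> q = x"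
    and \<tau>: "\<And>h. h \<in> carr \<Longrightarrow> h\<^sup>\<star> = h \<Longrightarrow> (cs_norm A h)\<^sup>2 \<le> Re (\<tau> (h \<otimes> h))"
  shows "(cs_norm A x) ^ (2 * 2 ^ Suc k) \<le> Re (\<tau> (upow q (x\<^sup>\<star> \<otimes> x) (2 ^ Suc k)))"
proof -
  let ?y = "x\<^sup>\<star> \<otimes> x"
  let ?U = "upow q ?y"
  have y: "?y \<in> carr" "?y\<^sup>\<star> = ?y" using x by (simp_all add: cs_closed star_mult star_star)
  have U: "?U n \<in> carr" for n using y q by (intro upow_closed)
  have Uadd: "?U (m + n) = ?U m \<otimes> ?U n" for m n
    by (induction m) (use q U y in \<open>auto simp: mult_assoc\<close>)
  have U1: "?U (Suc 0) = ?y" using q y by simp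
  have Ucomm: "?y \<otimes> ?U n = ?U n \<otimes> ?y" for n
    using Uadd[of "Suc 0" n] Uadd[of n "Suc 0"] by (simp only: add.commute[of n] U1)
  have Us: "(?U n)\<^sup>\<star> = ?U n" for n
    by (induction n) (use q U y Ucomm in \<open>auto simp: star_mult\<close>)
  have double: "?U (2 ^ Suc k) = ?U (2 ^ k) \<otimes> ?U (2 ^ k)" for k
    using Uadd[of "2 ^ k" "2 ^ k"] by (simp add: mult_2)
  have norm: "cs_norm A (?U (2 ^ k)) = (cs_norm A x) ^ (2 * 2 ^ k)" for k
  proof (induction k)
    case 0
    then show ?case using x U1 by (simp add: cstar_identity del: upow.simps)
  next
    case (Suc k)
    show ?case using norm_selfadjoint_square[OF U Us, of "2 ^ k"] Suc unfolding double
      by (simp add: power_mult[symmetric] mult_ac del: upow.simps)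
  qed
  have "(cs_norm A x) ^ (2 * 2 ^ Suc k) = (cs_norm A (?U (2 ^ k)))\<^sup>2"
    by (simp add: norm power_mult[symmetric] mult_ac)
  also have "\<dots> \<le> Re (\<tau> (?U (2 ^ Suc k)))" unfolding double by (rule \<tau>[OF U Us])
  finally show ?thesis .
qed

text \<open>The exponent of the moments is the largest power of two below \<open>c\<^sup>2 n / 4\<close>.\<close>

lemma exp_le_rank_if_signed_sums_large:
  assumes rank: "has_rank A d"
    and z: "\<And>s. s < n \<Longrightarrow> z s \<in> carr" "\<And>s. s < n \<Longrightarrow> cs_norm A (z s) \<le> 1"
    and c: "0 < c" "c \<le> 1"
    and large: "\<And>\<epsilon>. \<epsilon> \<in> signs n \<Longrightarrow> c * real n \<le> cs_norm A (signed_sum z n \<epsilon>)"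
  shows "exp (c\<^sup>2 * real n / 16) \<le> 3 * real (max d 1)"
\<comment> \<open>For small \<open>n\<close> the left side is at most \<open>exp 1\<close>; this is
  the source of the constant 3.\<close>
proof (cases "c\<^sup>2 * real n / 4 < 4")
  case True
  then have "exp (c\<^sup>2 * real n / 16) \<le> exp 1" by simp
  also have "\<dots> \<le> 3" by (rule exp_le)
  finally show ?thesis by simp
next
  case False
  let ?x = "c\<^sup>2 * real n / 4"
  have x: "?x \<ge> 4" using False by simp
  then have n: "n > 0" using c by (cases n) auto
  \<comment> \<open>\<open>?x / 4 \<ge> 1\<close> makes the floor positive. With
    \<open>M = 4 * 2^k\<close> the two bounds say \<open>M \<le> ?x < 2 * M\<close>.\<close>
  obtain k where k: "2 ^ k \<le> nat \<lfloor>?x / 4\<rfloor>" "nat \<lfloor>?x / 4\<rfloor> < 2 ^ (k + 1)"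
    using ex_power_ivl1[of 2 "nat \<lfloor>?x / 4\<rfloor>"] x by (auto simp: le_nat_iff le_floor_iff)
  have k1: "real (2 ^ k) \<le> ?x / 4"
    using k(1) x by (simp add: le_nat_iff le_floor_iff)
  have k2: "?x / 4 < real (2 ^ (k + 1))"
    using k(2) x by (simp add: nat_less_iff floor_less_iff)
  define m :: nat where "m = 2 ^ Suc k"
  define M where "M = 2 * m"
  have M: "real M \<le> ?x" "?x < 2 * real M" "M > 0" "even M"
    using k1 k2 by (simp_all add: M_def m_def)
  obtain \<tau> q where \<tau>: "linfun \<tau>" "\<And>x. x \<in> carr \<Longrightarrow> cmod (\<tau> x) \<le> real d * cs_norm A x"
    "\<And>h. h \<in> carr \<Longrightarrow> h\<^sup>\<star> = h \<Longrightarrow> (cs_norm A h)\<^sup>2 \<le> Re (\<tau> (h \<otimes> h))"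
    and q: "q \<in> carr" "q\<^sup>\<star> = q" "cs_norm A q \<le> 1" "\<And>x. x \<in> carr \<Longrightarrow> q \<otimes> x = x \<and> x \<otimes> q = x"
    by (rule trace_functional[OF rank], rule that)
  let ?S = "signed_sum z n"
  let ?U = "\<lambda>\<epsilon>. upow q ((?S \<epsilon>)\<^sup>\<star> \<otimes> ?S \<epsilon>) m"
  have Sc: "?S \<epsilon> \<in> carr" for \<epsilon> using z by (intro vsum_closed) (simp add: closed)
  have Uc: "?U \<epsilon> \<in> carr" for \<epsilon> using q Sc by (intro upow_closed) (auto simp: cs_closed)
  have "2 ^ n * (c * real n) ^ M = (\<Sum>\<epsilon>\<in>signs n. (c * real n) ^ M)" by (simp add: card_signs)
  also have "\<dots> \<le> (\<Sum>\<epsilon>\<in>signs n. Re (\<tau> (q \<otimes> ?U \<epsilon>)))"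
  proof (rule sum_mono)
    fix \<epsilon> assume "\<epsilon> \<in> signs n"
    then have "(c * real n) ^ M \<le> (cs_norm A (?S \<epsilon>)) ^ M" using large c by (intro power_mono) auto
    also have "\<dots> \<le> Re (\<tau> (?U \<epsilon>))"
      unfolding M_def m_def by (rule norm_upow_le_trace) (use Sc q \<tau> in auto)
    finally show "(c * real n) ^ M \<le> Re (\<tau> (q \<otimes> ?U \<epsilon>))" using q Uc by simp
  qed
  also have "\<dots> \<le> real d * cs_norm A q * (\<Sum>\<epsilon>\<in>signs n. (\<Sum>s<n. \<epsilon> s) ^ M)"
    using sum_signs_trace_le[of n z \<tau> d q q "[]" m] z \<tau> q by (simp add: M_def)
  also have "\<dots> \<le> real (max d 1) * (\<Sum>\<epsilon>\<in>signs n. (\<Sum>s<n. \<epsilon> s) ^ M)"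
  proof (rule mult_right_mono)
    have "real d * cs_norm A q \<le> real d * 1" using q by (intro mult_left_mono) auto
    then show "real d * cs_norm A q \<le> real (max d 1)" by simp
    show "0 \<le> (\<Sum>\<epsilon>\<in>signs n. (\<Sum>s<n. \<epsilon> s) ^ M)" using sum_signs_moment_nonneg[of "[]" n M] by simp
  qed
  \<comment> \<open>With \<open>l = c / 4\<close> the bound \<open>M \<le> c^2 * n / 4\<close> gives
    \<open>M / (e l) \<le> c n / e\<close>: the powers of \<open>c n\<close> cancel and leave
    \<open>exp (- M)\<close>. The loss \<open>exp (n l^2)\<close> has exponent
    \<open>c^2 * n / 16\<close>, half of the guaranteed \<open>M > c^2 * n / 8\<close>.\<close>
  also have "\<dots> \<le> real (max d 1) * (2 ^ n * (2 * (real M / (exp 1 * (c/4))) ^ M * exp (real n * (c/4)\<^sup>2)))"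
    using M c by (intro mult_left_mono sum_signs_even_moment_le) auto
  also have "\<dots> \<le> real (max d 1) * (2 ^ n * (2 * (c * real n / exp 1) ^ M * exp (real n * (c/4)\<^sup>2)))"
  proof (intro mult_left_mono mult_right_mono power_mono)
    have "real M / (exp 1 * (c/4)) = (4 * real M / c) / exp 1" using c by (simp add: field_simps)
    also have "4 * real M / c \<le> c * real n" using M(1) c by (simp add: field_simps power2_eq_square)
    finally show "real M / (exp 1 * (c/4)) \<le> c * real n / exp 1" by (simp add: divide_right_mono)
  qed (use c in auto)
  finally have "(c * real n) ^ M \<le> real (max d 1) * (2 * (c * real n / exp 1) ^ M * exp (real n * (c/4)\<^sup>2))"
    by simp
  also have "\<dots> = (c * real n) ^ M * (2 * real (max d 1) * exp (c\<^sup>2 * real n / 16)) / exp (real M)"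
  proof -
    have "(c * real n / exp 1) ^ M = (c * real n) ^ M / exp (real M)"
      by (simp add: power_divide exp_of_nat_mult[symmetric])
    moreover have "real n * (c/4)\<^sup>2 = c\<^sup>2 * real n / 16" by (simp add: power2_eq_square)
    ultimately show ?thesis by simp
  qed
  finally have "(c * real n) ^ M * exp (real M) \<le> (c * real n) ^ M * (2 * real (max d 1) * exp (c\<^sup>2 * real n / 16))"
    by (simp only: pos_le_divide_eq[OF exp_gt_zero])
  then have "exp (real M) \<le> 2 * real (max d 1) * exp (c\<^sup>2 * real n / 16)"
    using c n by simp
  moreover have "exp (c\<^sup>2 * real n / 16) * exp (c\<^sup>2 * real n / 16) \<le> exp (real M)"
  proof -
    have "c\<^sup>2 * real n / 16 + c\<^sup>2 * real n / 16 \<le> real M" using M(2) by linarith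
    then show ?thesis unfolding exp_add[symmetric] by simp
  qed
  ultimately have "exp (c\<^sup>2 * real n / 16) * exp (c\<^sup>2 * real n / 16) \<le> 2 * real (max d 1) * exp (c\<^sup>2 * real n / 16)"
    by linarith
  then have "exp (c\<^sup>2 * real n / 16) \<le> 2 * real (max d 1)" by simp
  then show ?thesis by simp
qed

end

section \<open>Separated families and shattering\<close>

text \<open>Weight a function by \<open>t\<close> raised to the number of its differences from
  \<open>f\<close>. Within the ball the weights are at least \<open>t powr v\<close>, and the sum of
  all weights is a product over the coordinates.\<close>

lemma card_hamming_ball_le:
  fixes t v :: real
  assumes I: "finite I" and G: "finite G" and t: "0 < t" "t \<le> 1"
  shows "real (card {g \<in> I \<rightarrow>\<^sub>E G. real (card {i\<in>I. g i \<noteq> f i}) \<le> v})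
    \<le> t powr (- v) * (1 + t * card G) ^ card I"
proof -
  let ?B = "{g \<in> I \<rightarrow>\<^sub>E G. real (card {i\<in>I. g i \<noteq> f i}) \<le> v}"
  let ?w = "\<lambda>g. \<Prod>i\<in>I. if g i = f i then 1 else t"
  have fin: "finite (I \<rightarrow>\<^sub>E G)" using I G by (simp add: finite_PiE)
  have w: "?w g = t ^ card {i\<in>I. g i \<noteq> f i}" for g
  proof -
    have "?w g = (\<Prod>i\<in>{i\<in>I. g i \<noteq> f i}. t)"
      unfolding prod.inter_filter[OF I] by (intro prod.cong) auto
    then show ?thesis by simp
  qed
  have "t powr v \<le> ?w g" if "g \<in> ?B" for g
    using that t by (simp add: w powr_realpow[symmetric] powr_mono')
  then have "real (card ?B) * t powr v \<le> (\<Sum>g\<in>?B. ?w g)"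
    by (intro sum_bounded_below) auto
  also have "\<dots> \<le> (\<Sum>g\<in>I \<rightarrow>\<^sub>E G. ?w g)"
    using fin t by (intro sum_mono2) (auto intro!: prod_nonneg)
  also have "\<dots> = (\<Prod>i\<in>I. \<Sum>a\<in>G. if a = f i then 1 else t)"
    using I G by (simp add: prod_sum_PiE)
  also have "\<dots> \<le> (\<Prod>i\<in>I. 1 + t * card G)"
  proof (intro prod_mono conjI)
    fix i
    have "(\<Sum>a\<in>G. if a = f i then 1 else t) \<le> (\<Sum>a\<in>G. (if a = f i then 1 else 0) + t)"
      using t by (intro sum_mono) auto
    also have "\<dots> \<le> 1 + t * card G" using G by (simp add: sum.distrib)
    finally show "(\<Sum>a\<in>G. if a = f i then 1 else t) \<le> 1 + t * card G" .
  qed (use t in \<open>auto intro!: sum_nonneg\<close>)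
  finally have "real (card ?B) * t powr v \<le> (1 + t * card G) ^ card I" by simp
  then show ?thesis using t by (simp add: powr_minus field_simps)
qed

text \<open>Shattering with margin \<open>\<gamma>\<close>, as in the fat-shattering dimension. The
  partial map records both the coordinate set, as its domain, and the witnessing thresholds, so that
  the same coordinates with different thresholds are counted separately.\<close>

definition shattered :: "real \<Rightarrow> ('i \<Rightarrow> real) set \<Rightarrow> ('i \<rightharpoonup> real) \<Rightarrow> bool" where
  "shattered \<gamma> F g \<longleftrightarrow> (\<forall>P\<subseteq>dom g. \<exists>f\<in>F. \<forall>i\<in>dom g.
     (i \<in> P \<longrightarrow> the (g i) + \<gamma> \<le> f i) \<and> (i \<notin> P \<longrightarrow> f i \<le> the (g i)))"

definition shattered_maps :: "real \<Rightarrow> 'i set \<Rightarrow> real set \<Rightarrow> ('i \<Rightarrow> real) set \<Rightarrow> ('i \<rightharpoonup> real) set" where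
  "shattered_maps \<gamma> I G F = {g. dom g \<subseteq> I \<and> ran g \<subseteq> G \<and> shattered \<gamma> F g}"

lemma finite_shattered_maps:
  assumes "finite I" "finite G"
  shows "finite (shattered_maps \<gamma> I G F)"
proof -
  have "shattered_maps \<gamma> I G F \<subseteq> (\<Union>J\<in>Pow I. {g. dom g = J \<and> ran g \<subseteq> G})"
    by (auto simp: shattered_maps_def)
  moreover have "finite (\<Union>J\<in>Pow I. {g. dom g = J \<and> ran g \<subseteq> G})"
    using assms by (auto intro!: finite_set_of_finite_maps dest: finite_subset)
  ultimately show ?thesis by (rule finite_subset)
qed

text \<open>A map shattered by both halves extends by the splitting coordinate, which is the count
  behind Pajor's form of the Sauer-Shelah lemma.\<close>

lemma card_shattered_maps_split:
  fixes F :: "('i \<Rightarrow> real) set"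
  assumes I: "finite I" and G: "finite G" and i: "i \<in> I" and a: "a \<in> G" and \<gamma>: "\<gamma> > 0"
  defines "F1 \<equiv> {f\<in>F. f i \<le> a}" and "F2 \<equiv> {f\<in>F. a + \<gamma> \<le> f i}"
  shows "card (shattered_maps \<gamma> I G F1) + card (shattered_maps \<gamma> I G F2) \<le> card (shattered_maps \<gamma> I G F)"
proof -
  let ?A = "shattered_maps \<gamma> I G F1" and ?B = "shattered_maps \<gamma> I G F2"
  let ?u = "\<lambda>g. g(i \<mapsto> a)"
  \<comment> \<open>Realizing the pattern \<open>{i}\<close> within \<open>F1\<close> pushes the
    threshold at \<open>i\<close> below \<open>a\<close>, and realizing the empty pattern within
    \<open>F2\<close> pushes it to at least \<open>a + \<gamma>\<close>. So no map shattered by both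
    is defined at \<open>i\<close>.\<close>
  have le: "the (g i) + \<gamma> \<le> a" if "g \<in> ?A" "i \<in> dom g" for g
  proof -
    have "\<exists>f\<in>F1. \<forall>j\<in>dom g. (j \<in> {i} \<longrightarrow> the (g j) + \<gamma> \<le> f j) \<and> (j \<notin> {i} \<longrightarrow> f j \<le> the (g j))"
      using that unfolding shattered_maps_def shattered_def by blast
    then show ?thesis using that by (force simp: F1_def)
  qed
  have ge: "a + \<gamma> \<le> the (g i)" if "g \<in> ?B" "i \<in> dom g" for g
  proof -
    have "\<exists>f\<in>F2. \<forall>j\<in>dom g. (j \<in> {} \<longrightarrow> the (g j) + \<gamma> \<le> f j) \<and> (j \<notin> {} \<longrightarrow> f j \<le> the (g j))"
      using that unfolding shattered_maps_def shattered_def by blast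
    then show ?thesis using that by (force simp: F2_def)
  qed
  have notin: "i \<notin> dom g" if "g \<in> ?A \<inter> ?B" for g using le[of g] ge[of g] that \<gamma> by force
  have sub: "?A \<union> ?B \<subseteq> shattered_maps \<gamma> I G F"
  proof -
    have "shattered \<gamma> F g" if "shattered \<gamma> F' g" "F' \<subseteq> F" for F' g
      using that unfolding shattered_def by (meson subsetD)
    moreover have "F1 \<subseteq> F" "F2 \<subseteq> F" by (auto simp: F1_def F2_def)
    ultimately show ?thesis unfolding shattered_maps_def by auto
  qed
  have u: "?u g \<in> shattered_maps \<gamma> I G F" if g: "g \<in> ?A \<inter> ?B" for g
  proof -
    have "\<exists>f\<in>F. \<forall>j\<in>dom (?u g). (j \<in> P \<longrightarrow> the (?u g j) + \<gamma> \<le> f j) \<and> (j \<notin> P \<longrightarrow> f j \<le> the (?u g j))"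
      if P: "P \<subseteq> dom (?u g)" for P
    proof -
      have P': "P - {i} \<subseteq> dom g" using P by auto
      have sh1: "shattered \<gamma> F1 g" and sh2: "shattered \<gamma> F2 g" using g by (auto simp: shattered_maps_def)
      obtain f1 where f1: "f1 \<in> F1"
        "\<forall>j\<in>dom g. (j \<in> P - {i} \<longrightarrow> the (g j) + \<gamma> \<le> f1 j) \<and> (j \<notin> P - {i} \<longrightarrow> f1 j \<le> the (g j))"
        using sh1 P' unfolding shattered_def by meson
      obtain f2 where f2: "f2 \<in> F2"
        "\<forall>j\<in>dom g. (j \<in> P - {i} \<longrightarrow> the (g j) + \<gamma> \<le> f2 j) \<and> (j \<notin> P - {i} \<longrightarrow> f2 j \<le> the (g j))"
        using sh2 P' unfolding shattered_def by meson
      show ?thesis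
      proof (cases "i \<in> P")
        case True
        then show ?thesis using f2 notin[OF g] by (intro bexI[of _ f2]) (auto simp: F2_def)
      next
        case False
        then show ?thesis using f1 notin[OF g] by (intro bexI[of _ f1]) (auto simp: F1_def)
      qed
    qed
    then have "shattered \<gamma> F (?u g)" unfolding shattered_def by blast
    moreover have "ran (?u g) \<subseteq> G"
      using g a by (force simp: shattered_maps_def ran_def split: if_splits)
    ultimately show ?thesis using g i by (auto simp: shattered_maps_def)
  qed
  \<comment> \<open>A threshold \<open>a\<close> at \<open>i\<close> violates both \<open>le\<close>
    and \<open>ge\<close>, so the extended maps are new.\<close>
  have disj: "(?A \<union> ?B) \<inter> ?u ` (?A \<inter> ?B) = {}"
  proof -
    have "?u g \<notin> ?A" "?u g \<notin> ?B" for g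
      using le[of "?u g"] ge[of "?u g"] \<gamma> by auto
    then show ?thesis by blast
  qed
  have inj: "inj_on ?u (?A \<inter> ?B)"
  proof (rule inj_onI)
    fix g g' assume *: "g \<in> ?A \<inter> ?B" "g' \<in> ?A \<inter> ?B" "?u g = ?u g'"
    have "g i = None" "g' i = None" using notin *(1,2) by (auto simp: domIff)
    then show "g = g'" using *(3) by (metis fun_upd_triv fun_upd_upd)
  qed
  have finA: "finite ?A" and finB: "finite ?B" by (auto simp: finite_shattered_maps I G)
  have "card ?A + card ?B = card (?A \<union> ?B) + card (?A \<inter> ?B)"
    using finA finB by (rule card_Un_Int)
  also have "\<dots> = card (?A \<union> ?B) + card (?u ` (?A \<inter> ?B))" by (simp add: card_image[OF inj])
  also have "\<dots> = card ((?A \<union> ?B) \<union> ?u ` (?A \<inter> ?B))"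
    by (rule card_Un_disjoint[symmetric]) (use finA finB disj in auto)
  also have "\<dots> \<le> card (shattered_maps \<gamma> I G F)"
    using sub u by (intro card_mono finite_shattered_maps I G) blast
  finally show ?thesis .
qed

text \<open>Induction on the size of the family: each part keeps a proportion \<open>c\<close>, and
  \<open>1 \<le> 2 * c powr \<kappa>\<close> is exactly what lets the powers of the two sizes add up
  to that of the whole. A single function shatters the empty map.\<close>

lemma card_powr_le_shattered_maps:
  fixes \<kappa> c :: real
  assumes I: "finite I" and G: "finite G" and \<gamma>: "\<gamma> > 0" and \<kappa>: "\<kappa> > 0" and c: "c > 0" "1 \<le> 2 * c powr \<kappa>"
    and split: "\<And>F'. F' \<subseteq> F \<Longrightarrow> 2 \<le> card F' \<Longrightarrow> \<exists>i\<in>I. \<exists>a\<in>G.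
        c * card F' \<le> card {f\<in>F'. f i \<le> a} \<and> c * card F' \<le> card {f\<in>F'. a + \<gamma> \<le> f i}"
    and F: "finite F" "F \<noteq> {}"
  shows "real (card F) powr \<kappa> \<le> card (shattered_maps \<gamma> I G F)"
  using F split
proof (induction "card F" arbitrary: F rule: less_induct)
  case less
  show ?case
  proof (cases "2 \<le> card F")
    case False
    then have "card F = 1" using less.prems by (metis One_nat_def Suc_leI card_gt_0_iff le_antisym not_less_eq_eq numeral_2_eq_2)
    moreover have "Map.empty \<in> shattered_maps \<gamma> I G F"
      using less.prems by (auto simp: shattered_maps_def shattered_def)
    then have "card (shattered_maps \<gamma> I G F) \<ge> 1"
      using finite_shattered_maps[OF I G, of \<gamma> F] by (metis One_nat_def Suc_leI card_gt_0_iff empty_iff)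
    ultimately show ?thesis by simp
  next
    case True
    then obtain i a where ia: "i \<in> I" "a \<in> G"
      and le: "c * card F \<le> card {f\<in>F. f i \<le> a}" "c * card F \<le> card {f\<in>F. a + \<gamma> \<le> f i}"
      using less.prems(3)[of F] by blast
    let ?F1 = "{f\<in>F. f i \<le> a}" and ?F2 = "{f\<in>F. a + \<gamma> \<le> f i}"
    have pos: "c * card F > 0" using c True by simp
    then have ne: "?F1 \<noteq> {}" "?F2 \<noteq> {}" using le by (metis card.empty of_nat_0 not_le)+
    have sub: "?F1 \<subset> F" "?F2 \<subset> F" using ne \<gamma> by force+
    have IH: "real (card F') powr \<kappa> \<le> card (shattered_maps \<gamma> I G F')"
      if F': "F' \<subset> F" "F' \<noteq> {}" for F'
    proof (rule less.hyps)
      show "card F' < card F" using F' less.prems by (simp add: psubset_card_mono)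
      show "finite F'" using F' less.prems finite_subset by blast
      show "\<exists>i\<in>I. \<exists>a\<in>G. c * card E \<le> card {f\<in>E. f i \<le> a} \<and> c * card E \<le> card {f\<in>E. a + \<gamma> \<le> f i}"
        if "E \<subseteq> F'" "2 \<le> card E" for E
        using less.prems(3)[of E] that F' by blast
    qed (fact F')
    have "real (card F) powr \<kappa> \<le> (2 * c powr \<kappa>) * real (card F) powr \<kappa>"
      using mult_right_mono[OF c(2), of "real (card F) powr \<kappa>"] by simp
    also have "\<dots> = (c * card F) powr \<kappa> + (c * card F) powr \<kappa>"
      using c by (simp add: powr_mult)
    also have "\<dots> \<le> real (card ?F1) powr \<kappa> + real (card ?F2) powr \<kappa>"
      using le pos \<kappa> by (intro add_mono powr_mono2) auto
    also have "\<dots> \<le> card (shattered_maps \<gamma> I G ?F1) + card (shattered_maps \<gamma> I G ?F2)"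
      using IH[OF sub(1) ne(1)] IH[OF sub(2) ne(2)] by simp
    also have "\<dots> \<le> card (shattered_maps \<gamma> I G F)"
      using card_shattered_maps_split[OF I G ia \<gamma>, of F] by linarith
    finally show ?thesis .
  qed
qed

text \<open>Double counting of the triples \<open>(f, f', i)\<close> with \<open>f i\<close> and \<open>f' i\<close> far apart, followed by the
  pigeonhole principle for the thresholds.\<close>

lemma separated_family_splits:
  fixes \<epsilon> \<delta> \<gamma> :: real and F :: "('i \<Rightarrow> real) set"
  assumes I: "finite I" "I \<noteq> {}" and G: "finite G" "G \<noteq> {}"
    and grid: "\<And>x y. \<bar>x\<bar> \<le> 1 \<Longrightarrow> \<bar>y\<bar> \<le> 1 \<Longrightarrow> x + \<epsilon> \<le> y \<Longrightarrow> \<exists>a\<in>G. x \<le> a \<and> a + \<gamma> \<le> y"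
    and F: "finite F" "2 \<le> card F" and bd: "\<And>f i. f \<in> F \<Longrightarrow> i \<in> I \<Longrightarrow> \<bar>f i\<bar> \<le> 1"
    and \<delta>: "\<delta> > 0"
    and sep: "\<And>f f'. f \<in> F \<Longrightarrow> f' \<in> F \<Longrightarrow> f \<noteq> f' \<Longrightarrow> \<delta> * card I \<le> card {i\<in>I. \<epsilon> \<le> \<bar>f i - f' i\<bar>}"
  shows "\<exists>i\<in>I. \<exists>a\<in>G. \<delta> / (4 * real (card G)) * card F \<le> card {f\<in>F. f i \<le> a} \<and>
    \<delta> / (4 * real (card G)) * card F \<le> card {f\<in>F. a + \<gamma> \<le> f i}"
proof (rule ccontr)
  assume "\<not> ?thesis"
  then have no: "card {f\<in>F. f i \<le> a} < \<delta> / (4 * real (card G)) * card F \<or>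
      card {f\<in>F. a + \<gamma> \<le> f i} < \<delta> / (4 * real (card G)) * card F" if "i \<in> I" "a \<in> G" for i a
    using that by force
  let ?n = "real (card F)" and ?q = "real (card G)"
  have q: "?q > 0" using G by (simp add: card_gt_0_iff)
  have n: "?n \<ge> 2" using F by simp
  have prod: "real (card {f\<in>F. f i \<le> a}) * real (card {f\<in>F. a + \<gamma> \<le> f i}) < \<delta> / (4 * ?q) * ?n * ?n"
    if ia: "i \<in> I" "a \<in> G" for i a
  proof -
    let ?x = "real (card {f\<in>F. f i \<le> a})" and ?y = "real (card {f\<in>F. a + \<gamma> \<le> f i})"
    have "?x \<le> ?n" "?y \<le> ?n" using F by (auto intro: card_mono)
    then have xy: "?x * ?y \<le> ?x * ?n" "?x * ?y \<le> ?n * ?y"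
      by (auto intro: mult_left_mono mult_right_mono)
    consider "?x < \<delta> / (4 * ?q) * ?n" | "?y < \<delta> / (4 * ?q) * ?n" using no[OF ia] by blast
    then show ?thesis
    proof cases
      assume "?x < \<delta> / (4 * ?q) * ?n"
      then have "?x * ?n < \<delta> / (4 * ?q) * ?n * ?n" using n by (intro mult_strict_right_mono) auto
      then show ?thesis using xy by linarith
    next
      assume "?y < \<delta> / (4 * ?q) * ?n"
      then have "?n * ?y < ?n * (\<delta> / (4 * ?q) * ?n)" using n by (intro mult_strict_left_mono) auto
      then show ?thesis using xy by (simp only: mult_ac)
    qed
  qed
  let ?D = "\<lambda>i. {p \<in> F \<times> F. \<epsilon> \<le> \<bar>fst p i - snd p i\<bar>}"
  \<comment> \<open>A pair far apart at \<open>i\<close> has one member below some threshold and the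
    other above it with margin; the two possible orders give the first factor two of the constant
    4.\<close>
  have Di: "real (card (?D i)) < \<delta> / 2 * ?n * ?n" if i: "i \<in> I" for i
  proof -
    let ?L = "\<lambda>a. {f\<in>F. f i \<le> a}" and ?R = "\<lambda>a. {f\<in>F. a + \<gamma> \<le> f i}"
    have "?D i \<subseteq> (\<Union>a\<in>G. ?L a \<times> ?R a \<union> ?R a \<times> ?L a)"
    proof
      fix p assume "p \<in> ?D i"
      then obtain f f' where p: "p = (f, f')" "f \<in> F" "f' \<in> F" "\<epsilon> \<le> \<bar>f i - f' i\<bar>" by (cases p) auto
      then consider "f i + \<epsilon> \<le> f' i" | "f' i + \<epsilon> \<le> f i" by linarith
      then show "p \<in> (\<Union>a\<in>G. ?L a \<times> ?R a \<union> ?R a \<times> ?L a)"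
      proof cases
        case 1
        then obtain a where "a \<in> G" "f i \<le> a" "a + \<gamma> \<le> f' i" using grid[of "f i" "f' i"] bd p i by blast
        then show ?thesis using p by blast
      next
        case 2
        then obtain a where "a \<in> G" "f' i \<le> a" "a + \<gamma> \<le> f i" using grid[of "f' i" "f i"] bd p i by blast
        then show ?thesis using p by blast
      qed
    qed
    then have "card (?D i) \<le> card (\<Union>a\<in>G. ?L a \<times> ?R a \<union> ?R a \<times> ?L a)"
      using F G by (intro card_mono) auto
    also have "\<dots> \<le> (\<Sum>a\<in>G. card (?L a \<times> ?R a \<union> ?R a \<times> ?L a))" using G by (intro card_UN_le)
    also have "\<dots> \<le> (\<Sum>a\<in>G. 2 * (card (?L a) * card (?R a)))"
      by (intro sum_mono order.trans[OF card_Un_le]) (simp add: card_cartesian_product)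
    finally have "real (card (?D i)) \<le> (\<Sum>a\<in>G. 2 * (real (card (?L a)) * real (card (?R a))))"
      by (metis (mono_tags, lifting) of_nat_le_iff of_nat_sum of_nat_mult of_nat_numeral sum.cong)
    also have "\<dots> < (\<Sum>a\<in>G. 2 * (\<delta> / (4 * ?q) * ?n * ?n))"
      using G by (intro sum_strict_mono mult_strict_left_mono[OF prod[OF i]]) auto
    also have "\<dots> = \<delta> / 2 * ?n * ?n" using q by (simp add: field_simps)
    finally show ?thesis .
  qed
  have "(\<Sum>i\<in>I. real (card (?D i))) < (\<Sum>i\<in>I. \<delta> / 2 * ?n * ?n)"
    using Di I by (intro sum_strict_mono) auto
  then have up: "(\<Sum>i\<in>I. real (card (?D i))) < card I * (\<delta> / 2 * ?n * ?n)" by simp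
  have "(\<Sum>i\<in>I. real (card (?D i))) = (\<Sum>i\<in>I. \<Sum>p\<in>F \<times> F. if \<epsilon> \<le> \<bar>fst p i - snd p i\<bar> then 1 else 0)"
    using F by (intro sum.cong refl) (simp add: sum.If_cases Int_def)
  also have "\<dots> = (\<Sum>p\<in>F \<times> F. \<Sum>i\<in>I. if \<epsilon> \<le> \<bar>fst p i - snd p i\<bar> then 1 else 0)" by (rule sum.swap)
  also have "\<dots> = (\<Sum>p\<in>F \<times> F. real (card {i\<in>I. \<epsilon> \<le> \<bar>fst p i - snd p i\<bar>}))"
    using I by (intro sum.cong refl) (simp add: sum.If_cases Int_def)
  also have "\<dots> \<ge> (\<Sum>p\<in>F \<times> F. if fst p = snd p then 0 else \<delta> * card I)"
    using sep by (intro sum_mono) auto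
  also have "(\<Sum>p\<in>F \<times> F. if fst p = snd p then 0 else \<delta> * card I) = (\<Sum>f\<in>F. \<Sum>f'\<in>F. if f = f' then 0 else \<delta> * card I)"
    by (simp add: sum.cartesian_product case_prod_unfold)
  also have "\<dots> = (\<Sum>f\<in>F. (?n - 1) * (\<delta> * card I))"
  proof (intro sum.cong refl)
    fix f assume f: "f \<in> F"
    have "(\<Sum>f'\<in>F. if f = f' then 0 else \<delta> * card I) = (\<Sum>f'\<in>F - {f}. \<delta> * card I)"
      using F by (intro sum.mono_neutral_cong_right) auto
    then show "(\<Sum>f'\<in>F. if f = f' then 0 else \<delta> * card I) = (?n - 1) * (\<delta> * card I)"
      using F f by (simp add: of_nat_diff)
  qed
  also have "\<dots> = ?n * ((?n - 1) * (\<delta> * card I))" by simp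
  finally have "?n * ((?n - 1) * (\<delta> * card I)) < card I * (\<delta> / 2 * ?n * ?n)" using up by linarith
  \<comment> \<open>The second factor two: \<open>n - 1 \<ge> n / 2\<close> pays for leaving out the
    diagonal pairs.\<close>
  moreover have "?n * (?n / 2 * (\<delta> * card I)) \<le> ?n * ((?n - 1) * (\<delta> * card I))"
    using n \<delta> by (intro mult_left_mono mult_right_mono) auto
  ultimately show False by (simp add: mult_ac)
qed

text \<open>In a grid of mesh \<open>\<epsilon> / 2\<close> the first point at or above
  \<open>x\<close> exceeds it by at most half of the gap; the other half remains as margin.\<close>

lemma threshold_grid:
  fixes \<epsilon> :: real
  assumes "\<epsilon> > 0"
  obtains G :: "real set" where "finite G" "G \<noteq> {}"
    "\<And>x y. \<bar>x\<bar> \<le> 1 \<Longrightarrow> \<bar>y\<bar> \<le> 1 \<Longrightarrow> x + \<epsilon> \<le> y \<Longrightarrow> \<exists>a\<in>G. x \<le> a \<and> a + \<epsilon> / 2 \<le> y"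
proof
  define K where "K = nat \<lceil>4 / \<epsilon>\<rceil>"
  let ?G = "(\<lambda>k::nat. -1 + real k * (\<epsilon>/2)) ` {..K}"
  show "finite ?G" "?G \<noteq> {}" by auto
  fix x y :: real assume xy: "\<bar>x\<bar> \<le> 1" "\<bar>y\<bar> \<le> 1" "x + \<epsilon> \<le> y"
  define k where "k = nat \<lceil>(x + 1) * 2 / \<epsilon>\<rceil>"
  have nn: "(x + 1) * 2 / \<epsilon> \<ge> 0" using xy assms by simp
  have k1: "(x + 1) * 2 / \<epsilon> \<le> real k" unfolding k_def using real_nat_ceiling_ge by blast
  have k2: "real k \<le> (x + 1) * 2 / \<epsilon> + 1"
    unfolding k_def using nn of_nat_ceiling by (simp add: of_nat_nat le_of_int_ceiling)
  have "k \<le> K"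
    unfolding k_def K_def using xy assms by (intro nat_mono ceiling_mono divide_right_mono) auto
  moreover have "x \<le> -1 + real k * (\<epsilon>/2)" using k1 assms by (simp add: field_simps)
  moreover have "-1 + real k * (\<epsilon>/2) + \<epsilon>/2 \<le> y"
  proof -
    have "real k * (\<epsilon>/2) \<le> ((x + 1) * 2 / \<epsilon> + 1) * (\<epsilon>/2)"
      using k2 assms by (intro mult_right_mono) auto
    also have "\<dots> = x + 1 + \<epsilon>/2" using assms by (simp add: field_simps)
    finally show ?thesis using xy by simp
  qed
  ultimately show "\<exists>a\<in>?G. x \<le> a \<and> a + \<epsilon> / 2 \<le> y" by blast
qed

text \<open>With \<open>None\<close> as an additional value a partial map becomes a total one, and
  the size of its domain is the Hamming distance from the everywhere undefined map.\<close>

lemma card_maps_small_domain_le: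
  fixes t v :: real and \<S> :: "('i \<rightharpoonup> real) set"
  assumes I: "finite I" and G: "finite G" and t: "0 < t" "t \<le> 1"
    and S: "\<And>g. g \<in> \<S> \<Longrightarrow> dom g \<subseteq> I \<and> ran g \<subseteq> G \<and> real (card (dom g)) \<le> v"
  shows "real (card \<S>) \<le> t powr (- v) * (1 + t * (card G + 1)) ^ card I"
proof -
  let ?G = "insert None (Some ` G)"
  let ?B = "{g \<in> I \<rightarrow>\<^sub>E ?G. real (card {i\<in>I. g i \<noteq> None}) \<le> v}"
  have "inj_on (\<lambda>g. restrict g I) \<S>"
  proof (rule inj_onI)
    fix g g' assume *: "g \<in> \<S>" "g' \<in> \<S>" "restrict g I = restrict g' I"
    show "g = g'"
    proof
      fix i show "g i = g' i"
        using *(3) S[OF *(1)] S[OF *(2)] by (cases "i \<in> I") (auto simp: fun_eq_iff restrict_def domIff split: if_splits, metis domIff subsetD)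
    qed
  qed
  moreover have "(\<lambda>g. restrict g I) ` \<S> \<subseteq> ?B"
  proof (rule image_subsetI)
    fix g assume g: "g \<in> \<S>"
    have "{i \<in> I. restrict g I i \<noteq> None} = dom g" using S[OF g] by auto
    moreover have "restrict g I \<in> I \<rightarrow>\<^sub>E ?G"
    proof (rule PiE_I)
      fix i assume "i \<in> I"
      then show "restrict g I i \<in> ?G" using S[OF g] by (cases "g i") (auto simp: ran_def)
    qed auto
    ultimately show "restrict g I \<in> ?B" using S[OF g] by simp
  qed
  moreover have "finite ?B" using I G by (simp add: finite_PiE)
  ultimately have "card \<S> \<le> card ?B" by (rule card_inj_on_le)
  also have "real (card ?B) \<le> t powr (- v) * (1 + t * card ?G) ^ card I"
    by (rule card_hamming_ball_le) (use I G t in auto)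
  also have "card ?G = card G + 1" using G by (subst card_insert_disjoint) (auto simp: card_image)
  finally show ?thesis by (simp add: add.commute)
qed

text \<open>\<open>K\<close> and \<open>q\<close> are fixed before the index set and the family.
  When \<open>v\<close> is a small multiple of \<open>card I\<close>, a suitable small
  \<open>t\<close> makes the bound grow at an arbitrarily small exponential rate, and that is why
  \<open>t\<close> is left free.\<close>

lemma separated_family_bound:
  fixes \<epsilon> \<delta> :: real
  assumes "\<epsilon> > 0" "0 < \<delta>" "\<delta> \<le> 1"
  obtains K q :: real where "K > 0" "q > 0"
    "\<forall>(I :: 'i set) F t v. finite I \<longrightarrow> I \<noteq> {} \<longrightarrow> finite F \<longrightarrow> F \<noteq> {} \<longrightarrow> 0 < t \<longrightarrow> t \<le> 1 \<longrightarrow>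
      (\<forall>f\<in>F. \<forall>i\<in>I. \<bar>f i\<bar> \<le> 1) \<longrightarrow>
      (\<forall>f\<in>F. \<forall>f'\<in>F. f \<noteq> f' \<longrightarrow> \<delta> * real (card I) \<le> real (card {i\<in>I. \<epsilon> \<le> \<bar>f i - f' i\<bar>})) \<longrightarrow>
      (\<forall>g. dom g \<subseteq> I \<longrightarrow> shattered (\<epsilon>/2) F g \<longrightarrow> real (card (dom g)) \<le> v) \<longrightarrow>
      real (card F) \<le> (t powr (- v) * (1 + t * q) ^ card I) powr K"
proof -
  obtain G :: "real set" where G: "finite G" "G \<noteq> {}"
    and grid: "\<And>x y. \<bar>x\<bar> \<le> 1 \<Longrightarrow> \<bar>y\<bar> \<le> 1 \<Longrightarrow> x + \<epsilon> \<le> y \<Longrightarrow> \<exists>a\<in>G. x \<le> a \<and> a + \<epsilon> / 2 \<le> y"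
    using threshold_grid[OF assms(1)] by blast
  define c where "c = \<delta> / (4 * real (card G))"
  have cG: "real (card G) \<ge> 1" using G by (simp add: Suc_leI card_gt_0_iff)
  have c: "c > 0" "c < 1" unfolding c_def using assms cG by (auto simp: field_simps)
  \<comment> \<open>The exponent solves \<open>2 * c powr \<kappa> = 1\<close>.\<close>
  define \<kappa> where "\<kappa> = ln 2 / ln (1 / c)"
  have lc: "ln (1 / c) > 0" using c by (simp add: ln_div)
  then have \<kappa>: "\<kappa> > 0" by (simp add: \<kappa>_def)
  have "c powr \<kappa> = exp (- ln 2)" using c lc by (simp add: powr_def \<kappa>_def ln_div)
  then have ck: "1 \<le> 2 * c powr \<kappa>" by (simp add: exp_minus)
  show ?thesis
  proof (rule that[of "1 / \<kappa>" "real (card G) + 1"]; (intro allI impI)?)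
    fix I :: "'i set" and F and t v :: real
    assume I: "finite I" "I \<noteq> {}" and F: "finite F" "F \<noteq> {}" and t: "0 < t" "t \<le> 1"
      and bd: "\<forall>f\<in>F. \<forall>i\<in>I. \<bar>f i\<bar> \<le> 1"
      and sep: "\<forall>f\<in>F. \<forall>f'\<in>F. f \<noteq> f' \<longrightarrow> \<delta> * real (card I) \<le> real (card {i\<in>I. \<epsilon> \<le> \<bar>f i - f' i\<bar>})"
      and sh: "\<forall>g. dom g \<subseteq> I \<longrightarrow> shattered (\<epsilon>/2) F g \<longrightarrow> real (card (dom g)) \<le> v"
    have "real (card F) powr \<kappa> \<le> card (shattered_maps (\<epsilon>/2) I G F)"
    proof (rule card_powr_le_shattered_maps[where c = c])
      fix F' assume F': "F' \<subseteq> F" "2 \<le> card F'"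
      show "\<exists>i\<in>I. \<exists>a\<in>G. c * card F' \<le> card {f\<in>F'. f i \<le> a} \<and> c * card F' \<le> card {f\<in>F'. a + \<epsilon> / 2 \<le> f i}"
        unfolding c_def
      proof (rule separated_family_splits[where \<epsilon> = \<epsilon>, OF I G])
        show "\<exists>a\<in>G. x \<le> a \<and> a + \<epsilon> / 2 \<le> y" if "\<bar>x\<bar> \<le> 1" "\<bar>y\<bar> \<le> 1" "x + \<epsilon> \<le> y" for x y
          using grid that .
        show "\<delta> * card I \<le> card {i\<in>I. \<epsilon> \<le> \<bar>f i - f' i\<bar>}" if "f \<in> F'" "f' \<in> F'" "f \<noteq> f'" for f f'
          using sep that F' by blast
        show "\<bar>f i\<bar> \<le> 1" if "f \<in> F'" "i \<in> I" for f i using bd that F' by blast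
      qed (use F' F assms finite_subset in auto)
    qed (use I G assms \<kappa> c ck F in auto)
    also have "\<dots> \<le> t powr (- v) * (1 + t * (card G + 1)) ^ card I"
      by (rule card_maps_small_domain_le) (use I G t sh in \<open>auto simp: shattered_maps_def\<close>)
    finally have *: "real (card F) powr \<kappa> \<le> t powr (- v) * (1 + t * (real (card G) + 1)) ^ card I"
      by (simp add: add.commute)
    have "real (card F) = (real (card F) powr \<kappa>) powr (1 / \<kappa>)"
      using F \<kappa> by (simp add: powr_powr card_gt_0_iff)
    also have "\<dots> \<le> (t powr (- v) * (1 + t * (real (card G) + 1)) ^ card I) powr (1 / \<kappa>)"
      using * \<kappa> by (intro powr_mono2) auto
    finally show "real (card F) \<le> (t powr (- v) * (1 + t * (real (card G) + 1)) ^ card I) powr (1 / \<kappa>)" .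
  qed (use \<kappa> in auto)
qed

section \<open>Hilbert spaces\<close>

context hilbert_space
begin

notation vadd (infixl "\<oplus>" 65) and vminus (infixl "\<ominus>" 65) and vscale (infixr "\<odot>" 75)

abbreviation ip where "ip \<equiv> hb_inner H"
abbreviation nrm where "nrm \<equiv> hb_norm H"

lemma inner_minus: "\<lbrakk>x \<in> carr; y \<in> carr; z \<in> carr\<rbrakk> \<Longrightarrow> ip (x \<ominus> y) z = ip x z - ip y z"
  by (simp add: cv_minus_def inner_add inner_scale closed)

lemma inner_add_right: "\<lbrakk>x \<in> carr; y \<in> carr; z \<in> carr\<rbrakk> \<Longrightarrow> ip z (x \<oplus> y) = ip z x + ip z y"
  using inner_commute[of _ z] by (simp add: inner_add closed)

lemma inner_scale_right: "\<lbrakk>x \<in> carr; z \<in> carr\<rbrakk> \<Longrightarrow> ip z (c \<odot> x) = cnj c * ip z x"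
  using inner_commute[of _ z] by (simp add: inner_scale closed)

lemma inner_minus_right: "\<lbrakk>x \<in> carr; y \<in> carr; z \<in> carr\<rbrakk> \<Longrightarrow> ip z (x \<ominus> y) = ip z x - ip z y"
  by (simp add: cv_minus_def inner_add_right inner_scale_right closed)

lemmas inner_simps = inner_add inner_scale inner_minus inner_add_right inner_scale_right inner_minus_right

lemma inner_self: "x \<in> carr \<Longrightarrow> ip x x = complex_of_real ((nrm x)\<^sup>2)"
  using inner_commute[of x x] inner_nonneg[of x] by (simp add: hb_norm_def complex_eq_iff)

lemma nrm_square: "x \<in> carr \<Longrightarrow> (nrm x)\<^sup>2 = Re (ip x x)"
  by (simp add: inner_self)

lemma nrm_nonneg: "x \<in> carr \<Longrightarrow> 0 \<le> nrm x"
  by (simp add: hb_norm_def inner_nonneg)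

lemma nrm_eq_zero: "x \<in> carr \<Longrightarrow> nrm x = 0 \<longleftrightarrow> x = cv_zero H"
  using inner_self[of x] inner_definite[of x] inner_scale[of x x 0]
  by (auto simp: scale_zero_left)

lemma cauchy_schwarz:
  assumes x: "x \<in> carr" "y \<in> carr"
  shows "cmod (ip x y) \<le> nrm x * nrm y"
proof (cases "nrm y = 0")
  case True
  then have "y = cv_zero H" using nrm_eq_zero x by blast
  then have "ip x y = 0" using inner_scale_right[of y x 0] x by (simp add: scale_zero_right)
  then show ?thesis using x by (simp add: nrm_nonneg)
next
  case False
  define r where "r = (nrm y)\<^sup>2"
  have r: "r > 0" using False by (simp add: r_def)
  define a where "a = ip x y"
  have yx: "ip y x = cnj a" using inner_commute[of x y] x by (simp add: a_def)
  let ?z = "x \<ominus> (a / r) \<odot> y"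
  have yy: "ip y y = complex_of_real r" using x by (simp add: inner_self r_def)
  have "ip ?z ?z = ip x x - a * cnj a / r"
    using x r by (simp add: inner_simps closed minus_closed yx yy a_def[symmetric])
  also have "\<dots> = complex_of_real ((nrm x)\<^sup>2 - (cmod a)\<^sup>2 / r)"
    using x by (simp add: inner_self complex_norm_square[symmetric])
  finally have "0 \<le> (nrm x)\<^sup>2 - (cmod a)\<^sup>2 / r"
    using inner_nonneg[of ?z] x by (simp add: closed minus_closed)
  then have "(cmod a)\<^sup>2 \<le> (nrm x)\<^sup>2 * r"
    using r by (metis diff_ge_0_iff_ge pos_divide_le_eq)
  then have "(cmod a)\<^sup>2 \<le> (nrm x * nrm y)\<^sup>2"
    unfolding r_def power_mult_distrib .
  then show ?thesis unfolding a_def by (rule power2_le_imp_le) (simp add: x nrm_nonneg)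
qed

lemma nrm_scale: "x \<in> carr \<Longrightarrow> nrm (c \<odot> x) = cmod c * nrm x"
proof -
  assume x: "x \<in> carr"
  have "complex_of_real ((nrm (c \<odot> x))\<^sup>2) = ip (c \<odot> x) (c \<odot> x)"
    using x by (intro inner_self[symmetric] closed)
  also have "\<dots> = (c * cnj c) * ip x x" using x by (simp add: closed inner_simps)
  also have "\<dots> = (c * cnj c) * complex_of_real ((nrm x)\<^sup>2)" by (simp only: inner_self[OF x])
  also have "\<dots> = complex_of_real ((cmod c * nrm x)\<^sup>2)"
    by (simp add: complex_norm_square[symmetric] power_mult_distrib)
  finally have "(nrm (c \<odot> x))\<^sup>2 = (cmod c * nrm x)\<^sup>2" by (simp only: of_real_eq_iff)
  then show ?thesis using x by (simp add: closed nrm_nonneg)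
qed

lemma nrm_triangle:
  assumes x: "x \<in> carr" "y \<in> carr"
  shows "nrm (x \<oplus> y) \<le> nrm x + nrm y"
proof (rule power2_le_imp_le)
  have "Re (ip x y) \<le> nrm x * nrm y" using cauchy_schwarz[OF x] complex_Re_le_cmod order.trans by blast
  then show "(nrm (x \<oplus> y))\<^sup>2 \<le> (nrm x + nrm y)\<^sup>2"
    using x inner_commute[OF x] by (simp add: nrm_square closed inner_simps power2_sum algebra_simps)
qed (simp add: x nrm_nonneg)

end

sublocale hilbert_space \<subseteq> normed_vs H "hb_norm H"
  by unfold_locales (auto simp: nrm_nonneg nrm_eq_zero nrm_triangle nrm_scale)

section \<open>Riesz representation, adjoints and the operator norm\<close>

context hilbert_space
begin

lemma parallelogram:
  assumes "x \<in> carr" "y \<in> carr"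
  shows "(nrm (x \<ominus> y))\<^sup>2 + (nrm (x \<oplus> y))\<^sup>2 = 2 * (nrm x)\<^sup>2 + 2 * (nrm y)\<^sup>2"
  using assms by (simp add: nrm_square closed minus_closed inner_simps)

text \<open>Riesz: the representing vector minimizes \<open>|x|\<^sup>2 - 2 Re f(x)\<close>.\<close>

lemma riesz:
  assumes f: "linfun f" and bound: "\<And>x. x \<in> carr \<Longrightarrow> cmod (f x) \<le> C * nrm x"
  obtains z where "z \<in> carr" "\<And>x. x \<in> carr \<Longrightarrow> f x = ip x z"
proof -
  define m where "m x = (nrm x)\<^sup>2 - 2 * Re (f x)" for x
  have below: "- C\<^sup>2 \<le> m x" if x: "x \<in> carr" for x
  proof -
    have "Re (f x) \<le> C * nrm x" using bound[OF x] complex_Re_le_cmod order.trans by blast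
    moreover have "2 * (C * nrm x) \<le> (nrm x)\<^sup>2 + C\<^sup>2"
      using zero_le_power2[of "nrm x - C"] by (simp add: power2_diff mult_ac)
    ultimately show ?thesis unfolding m_def by linarith
  qed
  define m0 where "m0 = Inf (m ` carr)"
  have bdd: "bdd_below (m ` carr)" using below by (intro bdd_belowI[of _ "- C\<^sup>2"]) auto
  have m0: "m0 \<le> m x" if "x \<in> carr" for x unfolding m0_def using bdd that by (intro cInf_lower) auto
  have "\<exists>x\<in>carr. m x < m0 + 1 / real (Suc n)" for n
    using cInf_lessD[of "m ` carr" "m0 + 1 / real (Suc n)"] zero_closed unfolding m0_def by auto
  then obtain X where X: "\<And>n. X n \<in> carr" "\<And>n. m (X n) < m0 + 1 / real (Suc n)" by metis
  \<comment> \<open>The value of \<open>m\<close> at a midpoint is at least the infimum, so the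
    parallelogram law makes the minimizing sequence Cauchy.\<close>
  have close: "(nrm (X i \<ominus> X j))\<^sup>2 \<le> 2 / real (Suc i) + 2 / real (Suc j)" for i j
  proof -
    let ?h = "(1/2) \<odot> (X i \<oplus> X j)"
    have "4 * m ?h = (nrm (X i \<oplus> X j))\<^sup>2 - 4 * Re (f (X i)) - 4 * Re (f (X j))"
      unfolding m_def using X f by (simp add: nrm_scale closed linfun_simps power_divide; simp add: field_simps)
    moreover have "m0 \<le> m ?h" using X by (intro m0) (simp add: closed)
    ultimately have "4 * m0 \<le> (nrm (X i \<oplus> X j))\<^sup>2 - 4 * Re (f (X i)) - 4 * Re (f (X j))" by linarith
    then show ?thesis using parallelogram[OF X(1)[of i] X(1)[of j]] X(2)[of i] X(2)[of j] unfolding m_def by argo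
  qed
  have "\<exists>K. \<forall>i\<ge>K. \<forall>j\<ge>K. nrm (X i \<ominus> X j) < \<epsilon>" if \<epsilon>: "\<epsilon> > 0" for \<epsilon>
  proof -
    obtain K where K: "inverse (real (Suc K)) < \<epsilon>\<^sup>2 / 4"
      using reals_Archimedean[of "\<epsilon>\<^sup>2 / 4"] \<epsilon> by auto
    have "nrm (X i \<ominus> X j) < \<epsilon>" if "i \<ge> K" "j \<ge> K" for i j
    proof -
      have "1 / real (Suc i) \<le> 1 / real (Suc K)" "1 / real (Suc j) \<le> 1 / real (Suc K)"
        using that by (auto intro: divide_left_mono)
      then have "(nrm (X i \<ominus> X j))\<^sup>2 < \<epsilon>\<^sup>2" using close[of i j] K by (simp add: inverse_eq_divide)
      then show ?thesis using \<epsilon> power_less_imp_less_base by fastforce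
    qed
    then show ?thesis by blast
  qed
  then obtain z where z: "z \<in> carr" "(\<lambda>n. nrm (X n \<ominus> z)) \<longlonglongrightarrow> 0"
    using complete_limit[OF complete, of X] X(1) by blast
  have Re: "Re (ip z x) = Re (f x)" if x: "x \<in> carr" for x
  proof -
    define D where "D = Re (ip z x) - Re (f x)"
    have lim: "(\<lambda>n. Re (ip (X n) x)) \<longlonglongrightarrow> Re (ip z x)"
    proof (rule LIM_zero_cancel, rule Lim_null_comparison)
      show "\<forall>\<^sub>F n in sequentially. norm (Re (ip (X n) x) - Re (ip z x)) \<le> nrm (X n \<ominus> z) * nrm x"
      proof (rule always_eventually, rule allI)
        fix n
        have "\<bar>Re (ip (X n \<ominus> z) x)\<bar> \<le> nrm (X n \<ominus> z) * nrm x"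
          using cauchy_schwarz[of "X n \<ominus> z" x] abs_Re_le_cmod order.trans X z x minus_closed by meson
        then show "norm (Re (ip (X n) x) - Re (ip z x)) \<le> nrm (X n \<ominus> z) * nrm x"
          using X z x by (simp add: inner_minus)
      qed
      show "(\<lambda>n. nrm (X n \<ominus> z) * nrm x) \<longlonglongrightarrow> 0" using tendsto_mult_right[OF z(2), of "nrm x"] by simp
    qed
    \<comment> \<open>Only the pairings with \<open>X n\<close> are passed to the limit;
      \<open>m\<close> is never evaluated at \<open>z\<close>.\<close>
    have quad: "0 \<le> 2 * t * D + t\<^sup>2 * (nrm x)\<^sup>2" for t
    proof -
      have "0 \<le> 1 / real (Suc n) + (2 * t * (Re (ip (X n) x) - Re (f x)) + t\<^sup>2 * (nrm x)\<^sup>2)" for n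
      proof -
        have "(nrm (X n \<oplus> complex_of_real t \<odot> x))\<^sup>2 = (nrm (X n))\<^sup>2 + 2 * t * Re (ip (X n) x) + t\<^sup>2 * (nrm x)\<^sup>2"
          using X(1)[of n] x inner_commute[of "X n" x]
          by (simp add: nrm_square closed inner_simps; simp add: power2_eq_square algebra_simps)
        then have "m (X n \<oplus> complex_of_real t \<odot> x) = m (X n) + 2 * t * (Re (ip (X n) x) - Re (f x)) + t\<^sup>2 * (nrm x)\<^sup>2"
          unfolding m_def using X(1)[of n] x f by (simp add: closed linfun_simps algebra_simps)
        moreover have "m0 \<le> m (X n \<oplus> complex_of_real t \<odot> x)" using X x by (intro m0) (simp add: closed)
        ultimately show ?thesis using X(2)[of n] by linarith
      qed
      moreover have "(\<lambda>n. 1 / real (Suc n) + (2 * t * (Re (ip (X n) x) - Re (f x)) + t\<^sup>2 * (nrm x)\<^sup>2))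
          \<longlonglongrightarrow> 0 + (2 * t * D + t\<^sup>2 * (nrm x)\<^sup>2)"
        unfolding D_def by (intro tendsto_intros lim) (rule LIMSEQ_Suc[OF lim_1_over_n])
      ultimately show ?thesis
        using tendsto_lowerbound[of _ "0 + (2 * t * D + t\<^sup>2 * (nrm x)\<^sup>2)" sequentially 0]
        by (simp add: always_eventually)
    qed
    define B where "B = (nrm x)\<^sup>2"
    \<comment> \<open>At \<open>t = - u\<close> the quadratic is \<open>- u^2 (2 + B)\<close>; the
      denominator \<open>1 + B\<close> covers \<open>x = 0\<close>.\<close>
    define u where "u = D / (1 + B)"
    have B: "B \<ge> 0" by (simp add: B_def)
    then have D: "D = u * (1 + B)" by (simp add: u_def)
    have "0 \<le> - (u\<^sup>2 * (2 + B))"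
      using quad[of "- u"] unfolding B_def[symmetric] D by (simp add: power2_eq_square algebra_simps)
    then have "u = 0" using B by (simp add: mult_le_0_iff)
    then have "D = 0" using D by simp
    then show ?thesis by (simp add: D_def)
  qed
  have "f x = ip x z" if x: "x \<in> carr" for x
  proof (rule complex_eqI)
    show "Re (f x) = Re (ip x z)" using Re[OF x] inner_commute[OF z(1) x] by simp
    have "Re (f (\<i> \<odot> x)) = Re (ip (\<i> \<odot> x) z)"
      using Re[of "\<i> \<odot> x"] inner_commute[of z "\<i> \<odot> x"] x z by (simp add: closed)
    then show "Im (f x) = Im (ip x z)" using x f z by (simp add: linfun_simps inner_simps)
  qed
  then show ?thesis using that z by blast
qed

lemma bounded_ops_closed: "\<lbrakk>T \<in> bounded_ops H; x \<in> carr\<rbrakk> \<Longrightarrow> T x \<in> carr"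
  by (auto simp: bounded_ops_def lin_map_def)

lemma eq_of_inner_right:
  assumes "x \<in> carr" "y \<in> carr" "\<And>z. z \<in> carr \<Longrightarrow> ip z x = ip z y"
  shows "x = y"
proof -
  have "ip (x \<ominus> y) (x \<ominus> y) = 0" using assms(3)[of "x \<ominus> y"] assms(1,2) by (simp add: inner_minus_right minus_closed)
  then show ?thesis using inner_definite minus_eq_zero_iff minus_closed assms(1,2) by metis
qed

lemma adjoint_exists:
  assumes T: "T \<in> bounded_ops H"
  obtains S where "S \<in> bounded_ops H" "\<And>x y. \<lbrakk>x \<in> carr; y \<in> carr\<rbrakk> \<Longrightarrow> ip (T x) y = ip x (S y)"
proof -
  note Tc = bounded_ops_closed[OF T]
  have Tadd: "T (x \<oplus> y) = T x \<oplus> T y" if "x \<in> carr" "y \<in> carr" for x y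
    using T that by (auto simp: bounded_ops_def lin_map_def)
  have Tscale: "T (c \<odot> x) = c \<odot> T x" if "x \<in> carr" for x c
    using T that by (auto simp: bounded_ops_def lin_map_def)
  obtain C0 where "\<And>x. x \<in> carr \<Longrightarrow> nrm (T x) \<le> C0 * nrm x"
    using T by (auto simp: bounded_ops_def)
  then have C: "nrm (T x) \<le> \<bar>C0\<bar> * nrm x" if "x \<in> carr" for x
    using that nonneg[of x] by (meson abs_ge_self mult_right_mono order_trans)
  have "\<exists>z\<in>carr. \<forall>x\<in>carr. ip (T x) y = ip x z" if y: "y \<in> carr" for y
  proof -
    have "linfun (\<lambda>x. ip (T x) y)" unfolding linfun_def using y Tc by (auto simp: Tadd Tscale inner_simps)
    moreover have "cmod (ip (T x) y) \<le> \<bar>C0\<bar> * nrm y * nrm x" if "x \<in> carr" for x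
      using cauchy_schwarz[OF Tc[OF that] y] mult_right_mono[OF C[OF that] nonneg[OF y]] by (simp add: mult_ac)
    ultimately show ?thesis using riesz[of "\<lambda>x. ip (T x) y" "\<bar>C0\<bar> * nrm y"] by metis
  qed
  then obtain S0 where S0: "\<And>y. y \<in> carr \<Longrightarrow> S0 y \<in> carr \<and> (\<forall>x\<in>carr. ip (T x) y = ip x (S0 y))" by metis
  define S where "S = restrict S0 carr"
  have S: "S y \<in> carr" "\<And>x. x \<in> carr \<Longrightarrow> ip (T x) y = ip x (S y)" if "y \<in> carr" for y
    using S0[OF that] that by (auto simp: S_def)
  have "lin_map H H S" unfolding lin_map_def
  proof (intro conjI ballI allI)
    show "S \<in> carr \<rightarrow> carr" using S by auto
    show "S (x \<oplus> y) = S x \<oplus> S y" if "x \<in> carr" "y \<in> carr" for x y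
      using that S by (intro eq_of_inner_right) (auto simp: closed inner_simps Tc S(2)[symmetric])
    show "S (c \<odot> x) = c \<odot> S x" if "x \<in> carr" for x c
      using that S by (intro eq_of_inner_right) (auto simp: closed inner_simps Tc S(2)[symmetric])
  qed
  moreover have "nrm (S y) \<le> \<bar>C0\<bar> * nrm y" if y: "y \<in> carr" for y
  proof -
    have "(nrm (S y))\<^sup>2 = Re (ip (T (S y)) y)" using S y by (simp add: nrm_square)
    also have "\<dots> \<le> nrm (T (S y)) * nrm y"
      using cauchy_schwarz[OF Tc[OF S(1)[OF y]] y] complex_Re_le_cmod order.trans by blast
    also have "\<dots> \<le> \<bar>C0\<bar> * nrm (S y) * nrm y" using C S(1) y nonneg by (intro mult_right_mono) auto
    finally have "nrm (S y) * nrm (S y) \<le> nrm (S y) * (\<bar>C0\<bar> * nrm y)" by (simp add: power2_eq_square mult_ac)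
    then show ?thesis using nonneg[OF S(1)[OF y]] nonneg[OF y] by (cases "nrm (S y) = 0") auto
  qed
  ultimately have "S \<in> bounded_ops H" unfolding bounded_ops_def by (auto simp: S_def)
  then show ?thesis using S that by blast
qed

text \<open>\<open>hb_adjoint\<close> is a definite description. Existence is Riesz's theorem; for
  uniqueness the operators are extensional and so agree off the carrier too.\<close>

lemma inner_adjoint:
  assumes T: "T \<in> bounded_ops H" and xy: "x \<in> carr" "y \<in> carr"
  shows "ip (T x) y = ip x (hb_adjoint H T y)"
proof -
  let ?P = "\<lambda>S. S \<in> bounded_ops H \<and> (\<forall>x\<in>carr. \<forall>y\<in>carr. ip (T x) y = ip x (S y))"
  have "\<exists>!S. ?P S"
  proof (rule ex_ex1I)
    show "\<exists>S. ?P S" using adjoint_exists[OF T] by metis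
    fix S S' assume *: "?P S" "?P S'"
    show "S = S'"
    proof (rule extensionalityI[of _ carr])
      show "S \<in> extensional carr" "S' \<in> extensional carr" using * by (auto simp: bounded_ops_def)
      show "S y = S' y" if "y \<in> carr" for y
        by (rule eq_of_inner_right) (use * that bounded_ops_closed in metis)+
    qed
  qed
  from theI'[OF this] show ?thesis unfolding hb_adjoint_def[symmetric] using xy by blast
qed

lemma op_norm_bound:
  assumes T: "T \<in> bounded_ops H" and x: "x \<in> carr"
  shows "nrm (T x) \<le> cs_norm (BH H) T * nrm x"
proof (cases "nrm x = 0")
  case True
  then have "T x = T (0 \<odot> x)" using x nrm_eq_zero by (simp add: scale_zero_right)
  also have "\<dots> = 0 \<odot> T x" using T x by (auto simp: bounded_ops_def lin_map_def)
  finally have "T x = cv_zero H" using T x by (simp add: scale_zero_left bounded_ops_closed)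
  then show ?thesis using True by (simp add: N_zero)
next
  case False
  let ?r = "complex_of_real (1 / nrm x)"
  have pos: "nrm x > 0" using False nonneg[OF x] by simp
  obtain C where C: "\<And>x. x \<in> carr \<Longrightarrow> nrm (T x) \<le> C * nrm x"
    using T by (auto simp: bounded_ops_def)
  have "bdd_above {nrm (T x) | x. x \<in> carr \<and> nrm x \<le> 1}"
  proof (rule bdd_aboveI)
    fix a assume "a \<in> {nrm (T x) | x. x \<in> carr \<and> nrm x \<le> 1}"
    then obtain x where x: "a = nrm (T x)" "x \<in> carr" "nrm x \<le> 1" by blast
    then have "a \<le> \<bar>C\<bar> * nrm x" using C[OF x(2)] nonneg[OF x(2)] by (meson abs_ge_self mult_right_mono order_trans)
    also have "\<dots> \<le> \<bar>C\<bar> * 1" using x by (intro mult_left_mono) auto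
    finally show "a \<le> \<bar>C\<bar>" by simp
  qed
  moreover have "nrm (T (?r \<odot> x)) \<in> {nrm (T x) | x. x \<in> carr \<and> nrm x \<le> 1}"
    using x pos by (auto simp: closed nrm_scale norm_divide intro!: exI[of _ "?r \<odot> x"])
  ultimately have "nrm (T (?r \<odot> x)) \<le> cs_norm (BH H) T"
    unfolding BH_def by (simp add: cSup_upper)
  moreover have "T (?r \<odot> x) = ?r \<odot> T x" using T x by (auto simp: bounded_ops_def lin_map_def)
  ultimately show ?thesis using x T pos by (simp add: nrm_scale bounded_ops_closed norm_divide field_simps)
qed

end

section \<open>Faithful representations are isometric\<close>

locale cstar_representation = A: cstar_algebra A + H: hilbert_space H
  for A :: "'a cstar" and H :: "'h hilb" +
  fixes \<pi> :: "'a \<Rightarrow> 'h \<Rightarrow> 'h"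
  assumes rep: "representation A H \<pi>"
begin

notation A.vadd (infixl "\<oplus>" 65) and A.vminus (infixl "\<ominus>" 65) and A.vscale (infixr "\<odot>" 75)

lemma pi_ops: "x \<in> A.carr \<Longrightarrow> \<pi> x \<in> bounded_ops H"
  using rep by (auto simp: representation_def star_hom_def lin_map_def BH_def)

lemma pi_closed: "\<lbrakk>x \<in> A.carr; u \<in> H.carr\<rbrakk> \<Longrightarrow> \<pi> x u \<in> H.carr"
  by (rule H.bounded_ops_closed[OF pi_ops])

lemma pi_add: "\<lbrakk>x \<in> A.carr; y \<in> A.carr; u \<in> H.carr\<rbrakk> \<Longrightarrow> \<pi> (x \<oplus> y) u = cv_add H (\<pi> x u) (\<pi> y u)"
  using rep by (auto simp: representation_def star_hom_def lin_map_def BH_def)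

lemma pi_scale: "\<lbrakk>x \<in> A.carr; u \<in> H.carr\<rbrakk> \<Longrightarrow> \<pi> (c \<odot> x) u = cv_scale H c (\<pi> x u)"
  using rep by (auto simp: representation_def star_hom_def lin_map_def BH_def)

lemma pi_minus: "\<lbrakk>x \<in> A.carr; y \<in> A.carr; u \<in> H.carr\<rbrakk> \<Longrightarrow> \<pi> (x \<ominus> y) u = cv_minus H (\<pi> x u) (\<pi> y u)"
  by (simp add: cv_minus_def pi_add pi_scale A.closed)

lemma pi_mult: "\<lbrakk>x \<in> A.carr; y \<in> A.carr; u \<in> H.carr\<rbrakk> \<Longrightarrow> \<pi> (x \<otimes> y) u = \<pi> x (\<pi> y u)"
  using rep by (auto simp: representation_def star_hom_def BH_def compose_def)

lemma pi_star:
  assumes "x \<in> A.carr" "u \<in> H.carr" "v \<in> H.carr"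
  shows "H.ip (\<pi> x u) v = H.ip u (\<pi> (x\<^sup>\<star>) v)"
proof -
  have "\<pi> (x\<^sup>\<star>) = hb_adjoint H (\<pi> x)"
    using rep assms by (auto simp: representation_def star_hom_def BH_def)
  then show ?thesis using H.inner_adjoint[OF pi_ops] assms by simp
qed

lemmas pi_simps = pi_add pi_scale pi_minus pi_mult pi_closed

lemma nrm_pi_square:
  "\<lbrakk>x \<in> A.carr; u \<in> H.carr\<rbrakk> \<Longrightarrow> (H.nrm (\<pi> x u))\<^sup>2 = Re (H.ip u (\<pi> (x\<^sup>\<star> \<otimes> x) u))"
  by (simp add: H.nrm_square pi_closed pi_star pi_mult A.cs_closed)

text \<open>The left side is the quadratic form of \<open>(1 - y)^2\<close>, of which the algebra
  contains only \<open>1 - (1 - y)^2 = 2 y - y^2\<close>. For a square root \<open>1 - y\<close> of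
  \<open>1 - z\<close> this expresses the positivity of \<open>1 - z\<close> in the
  representation.\<close>

lemma nrm_one_minus_pi_square:
  assumes y: "y \<in> A.carr" "y\<^sup>\<star> = y" and u: "u \<in> H.carr"
  shows "(H.nrm (cv_minus H u (\<pi> y u)))\<^sup>2
    = (H.nrm u)\<^sup>2 - Re (H.ip u (\<pi> (2 \<odot> y \<ominus> y \<otimes> y) u))"
proof -
  have "H.ip (\<pi> y u) u = H.ip u (\<pi> y u)" "H.ip (\<pi> y u) (\<pi> y u) = H.ip u (\<pi> y (\<pi> y u))"
    using pi_star[of y u] y u pi_closed by simp_all
  then show ?thesis
    using y u by (simp add: H.nrm_square pi_simps A.cs_closed H.closed H.minus_closed H.inner_simps)
qed

text \<open>For a square root \<open>1 - y\<close> of \<open>1 - c^2\<close>, the squared norms of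
  \<open>u\<close> and \<open>\<pi> c u\<close> differ by the squared norm of
  \<open>(1 - \<pi> y) u\<close>.\<close>

lemma pi_contractive_aux:
  assumes c: "c \<in> A.carr" "c\<^sup>\<star> = c" "cs_norm A c \<le> 1" and u: "u \<in> H.carr"
  shows "H.nrm (\<pi> c u) \<le> H.nrm u"
proof -
  have "cs_norm A (c \<otimes> c) \<le> 1"
    using A.norm_selfadjoint_square[OF c(1,2)] c A.nonneg by (simp add: power_le_one)
  moreover have "(c \<otimes> c)\<^sup>\<star> = c \<otimes> c" using c by (simp add: A.star_mult)
  ultimately obtain y where y: "y \<in> A.carr" "2 \<odot> y = c \<otimes> c \<oplus> y \<otimes> y" "y\<^sup>\<star> = y"
    using A.sqrt_one_minus[of "c \<otimes> c"] c A.mult_closed by metis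
  have cc: "2 \<odot> y \<ominus> y \<otimes> y = c \<otimes> c"
    unfolding y(2) by (rule A.lin_eqI) (use y(1) c in \<open>auto simp: A.linfun_simps A.cs_closed\<close>)
  have "0 \<le> (H.nrm u)\<^sup>2 - (H.nrm (\<pi> c u))\<^sup>2"
    using nrm_one_minus_pi_square[OF y(1,3) u] nrm_pi_square[OF c(1) u] c(2)
    unfolding cc by (metis zero_le_power2)
  then have "(H.nrm (\<pi> c u))\<^sup>2 \<le> (H.nrm u)\<^sup>2" by simp
  then show ?thesis by (rule power2_le_imp_le) (rule H.nonneg[OF u])
qed

lemma pi_contractive:
  assumes x: "x \<in> A.carr" and u: "u \<in> H.carr"
  shows "H.nrm (\<pi> x u) \<le> cs_norm A x * H.nrm u"
proof -
  have sa: "H.nrm (\<pi> c u) \<le> cs_norm A c * H.nrm u" if c: "c \<in> A.carr" "c\<^sup>\<star> = c" for c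
  proof (cases "cs_norm A c = 0")
    case True
    then have "c = 0 \<odot> c" using A.definite c by (simp add: A.scale_zero_right)
    then have "\<pi> c u = cv_scale H 0 (\<pi> c u)" using pi_scale c u by metis
    then show ?thesis using True H.scale[of "\<pi> c u" 0] c u pi_closed by simp
  next
    case False
    let ?r = "complex_of_real (1 / cs_norm A c)"
    have pos: "cs_norm A c > 0" using False A.nonneg[OF c(1)] by simp
    have "H.nrm (\<pi> (?r \<odot> c) u) \<le> H.nrm u"
      using c u pos by (intro pi_contractive_aux) (auto simp: A.closed A.star_scale A.scale norm_divide)
    then show ?thesis using c u pos by (simp add: pi_scale H.scale pi_closed norm_divide field_simps)
  qed
  let ?b = "x\<^sup>\<star> \<otimes> x"
  have b: "?b \<in> A.carr" "?b\<^sup>\<star> = ?b" using x by (simp_all add: A.cs_closed A.star_mult A.star_star)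
  have "(H.nrm (\<pi> x u))\<^sup>2 \<le> cmod (H.ip u (\<pi> ?b u))"
    unfolding nrm_pi_square[OF x u] by (rule complex_Re_le_cmod)
  also have "\<dots> \<le> H.nrm u * H.nrm (\<pi> ?b u)" using u b by (intro H.cauchy_schwarz pi_closed)
  also have "\<dots> \<le> H.nrm u * (cs_norm A ?b * H.nrm u)" using sa[OF b] u H.nonneg by (intro mult_left_mono)
  also have "\<dots> = (cs_norm A x * H.nrm u)\<^sup>2"
    using x by (simp add: A.cstar_identity power2_eq_square)
  finally show ?thesis by (rule power2_le_imp_le) (simp add: x u A.nonneg H.nonneg)
qed

end

text \<open>With \<open>a = c\<^sup>2\<close> (where \<open>c = \<surd>2 g\<close>) the elements \<open>1 - y\<^sub>1\<close> and \<open>1 - y\<^sub>2\<close> below are \<open>|1 - a|\<close> and its square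
  root.  Since \<open>\<pi> (1 - a)\<close> is positive, \<open>\<pi>\<close> identifies \<open>1 - a\<close> with \<open>|1 - a|\<close>, and so \<open>1 - a\<close> is a square.\<close>

locale faithful_representation = cstar_representation +
  assumes inj: "inj_on \<pi> A.carr"
begin

notation A.vadd (infixl "\<oplus>" 65) and A.vminus (infixl "\<ominus>" 65) and A.vscale (infixr "\<odot>" 75)

lemma eq_of_pi_eq:
  assumes "x \<in> A.carr" "y \<in> A.carr" "\<And>u. u \<in> H.carr \<Longrightarrow> H.nrm (\<pi> (x \<ominus> y) u) = 0"
  shows "x = y"
proof -
  have "\<pi> x u = \<pi> y u" if u: "u \<in> H.carr" for u
    using assms(3)[OF u] assms(1,2) u pi_minus[of x y u] H.nrm_eq_zero H.minus_eq_zero_iff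
    by (simp add: pi_closed H.minus_closed)
  moreover have "\<pi> x \<in> extensional H.carr" "\<pi> y \<in> extensional H.carr"
    using pi_ops assms by (auto simp: bounded_ops_def)
  ultimately have "\<pi> x = \<pi> y" by (meson extensionalityI)
  then show ?thesis using inj assms by (auto dest: inj_onD)
qed

lemma norm_le_one_if_pi_contraction:
  assumes c: "c \<in> A.carr" "c\<^sup>\<star> = c" "cs_norm A c \<le> sqrt 2"
    and \<rho>: "\<rho> < 1" "\<And>u. u \<in> H.carr \<Longrightarrow> H.nrm (\<pi> c u) \<le> \<rho> * H.nrm u"
  shows "cs_norm A c \<le> 1"
proof -
  have s2: "complex_of_real (sqrt 2) * complex_of_real (sqrt 2) = 2"
    by (simp flip: of_real_mult)
  \<comment> \<open>The bound \<open>sqrt 2\<close> on \<open>c\<close> makes \<open>g\<close> a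
    contraction, so \<open>1 - g^2\<close> has a square root \<open>1 - y\<close>. Then
    \<open>e = 2 g (1 - y)\<close>, the sine of a double angle, is a contraction as well, which
    provides the root \<open>1 - y1\<close> of \<open>1 - e^2 = (1 - a)^2\<close>.\<close>
  define g where "g = complex_of_real (1 / sqrt 2) \<odot> c"
  have g: "g \<in> A.carr" "g\<^sup>\<star> = g" using c by (simp_all add: g_def A.closed A.star_scale)
  have cg: "c \<otimes> c = 2 \<odot> (g \<otimes> g)"
    using c s2 by (simp add: g_def A.expand A.closed A.scale_scale A.mult_closed A.scale_one divide_simps mult.commute)
  have "cs_norm A g \<le> 1" using c by (simp add: g_def A.scale norm_divide)
  then have "cs_norm A (g \<otimes> g) \<le> 1" using A.norm_selfadjoint_square[OF g] A.nonneg[OF g(1)] by (simp add: power_le_one)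
  moreover have gsa: "(g \<otimes> g)\<^sup>\<star> = g \<otimes> g" using g by (simp add: A.star_mult)
  ultimately obtain y where y: "y \<in> A.carr" "2 \<odot> y = g \<otimes> g \<oplus> y \<otimes> y" "y\<^sup>\<star> = y"
    and ycomm: "\<And>w. w \<in> A.carr \<Longrightarrow> w \<otimes> (g \<otimes> g) = (g \<otimes> g) \<otimes> w \<Longrightarrow> w \<otimes> y = y \<otimes> w"
    using A.sqrt_one_minus[of "g \<otimes> g"] g A.mult_closed by metis
  have gy: "g \<otimes> y = y \<otimes> g" using ycomm[OF g(1)] g A.mult_assoc by simp
  define e where "e = 2 \<odot> (g \<ominus> g \<otimes> y)"
  have e: "e \<in> A.carr" "e\<^sup>\<star> = e" using g y gy by (simp_all add: e_def A.cs_closed A.expand)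
  have "cs_norm A e \<le> 1" unfolding e_def by (rule A.norm_sin_double_le_one) (use g y gy in auto)
  then have "cs_norm A (e \<otimes> e) \<le> 1" using A.norm_selfadjoint_square[OF e] A.nonneg[OF e(1)] by (simp add: power_le_one)
  moreover have esa: "(e \<otimes> e)\<^sup>\<star> = e \<otimes> e" using e by (simp add: A.star_mult)
  ultimately obtain y1 where y1: "y1 \<in> A.carr" "2 \<odot> y1 = e \<otimes> e \<oplus> y1 \<otimes> y1" "y1\<^sup>\<star> = y1" "cs_norm A y1 \<le> 1"
    and y1comm: "\<And>w. w \<in> A.carr \<Longrightarrow> w \<otimes> (e \<otimes> e) = (e \<otimes> e) \<otimes> w \<Longrightarrow> w \<otimes> y1 = y1 \<otimes> w"
    using A.sqrt_one_minus[of "e \<otimes> e"] e A.mult_closed by metis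
  obtain y2 where y2: "y2 \<in> A.carr" "2 \<odot> y2 = y1 \<oplus> y2 \<otimes> y2" "y2\<^sup>\<star> = y2"
    and y2comm: "\<And>w. w \<in> A.carr \<Longrightarrow> w \<otimes> y1 = y1 \<otimes> w \<Longrightarrow> w \<otimes> y2 = y2 \<otimes> w"
    using A.sqrt_one_minus[of y1] y1 by metis
  have cg1: "c \<otimes> g = g \<otimes> c" using c g by (simp add: g_def A.expand A.closed)
  then have "c \<otimes> (g \<otimes> g) = (g \<otimes> g) \<otimes> c" using c g by (metis A.mult_assoc)
  then have cy: "c \<otimes> y = y \<otimes> c" using ycomm c by blast
  have "c \<otimes> (g \<otimes> y) = (g \<otimes> y) \<otimes> c" using c g y cg1 cy by (metis A.mult_assoc)
  then have ce: "c \<otimes> e = e \<otimes> c" using c g y cg1 by (simp add: e_def A.expand A.cs_closed)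
  then have "c \<otimes> (e \<otimes> e) = (e \<otimes> e) \<otimes> c" using c e by (metis A.mult_assoc)
  then have cy1: "c \<otimes> y1 = y1 \<otimes> c" using y1comm c by blast
  then have cy2: "c \<otimes> y2 = y2 \<otimes> c" using y2comm c by blast
  define a where "a = c \<otimes> c"
  have a: "a \<in> A.carr" "a\<^sup>\<star> = a" using c by (simp_all add: a_def A.cs_closed A.star_mult)
  have ay1: "a \<otimes> y1 = y1 \<otimes> a" unfolding a_def using c y1(1) cy1 by (metis A.mult_assoc)
  have gyx: "y \<otimes> (g \<otimes> x) = g \<otimes> (y \<otimes> x)" if "x \<in> A.carr" for x
    using gy g y that by (metis A.mult_assoc)
  have gg: "g \<otimes> g = 2 \<odot> y \<ominus> y \<otimes> y"
    unfolding y(2) by (rule A.lin_eqI) (use y(1) g in \<open>auto simp: A.linfun_simps A.cs_closed\<close>)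
  have ggx: "g \<otimes> (g \<otimes> x) = 2 \<odot> (y \<otimes> x) \<ominus> y \<otimes> (y \<otimes> x)" if "x \<in> A.carr" for x
    using g(1) y(1) that by (simp add: A.mult_assoc[symmetric] gg A.expand A.cs_closed)
  have ee: "e \<otimes> e = 2 \<odot> a \<ominus> a \<otimes> a"
    unfolding a_def cg e_def
    by (rule A.lin_eqI) (use g(1) y(1) in \<open>auto simp: A.linfun_simps A.cs_closed A.expand A.mult_assoc gy[symmetric]
        gyx ggx gg algebra_simps\<close>)
  \<comment> \<open>The squares of \<open>1 - a\<close> and \<open>1 - y1\<close> agree and these
    elements commute, so \<open>(2 - a - y1) d\<close> vanishes.\<close>
  define d where "d = a \<ominus> y1"
  have d: "d \<in> A.carr" using a y1 by (simp add: d_def A.minus_closed)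
  have y1y1: "y1 \<otimes> y1 = 2 \<odot> y1 \<ominus> e \<otimes> e"
    unfolding y1(2) by (rule A.lin_eqI) (use y1(1) e in \<open>auto simp: A.linfun_simps A.cs_closed\<close>)
  have d2: "2 \<odot> d = (a \<oplus> y1) \<otimes> d"
    unfolding d_def
    by (rule A.lin_eqI) (use a(1) y1(1) in \<open>auto simp: A.linfun_simps A.cs_closed A.expand y1y1 ee ay1 algebra_simps\<close>)
  have y2y2: "2 \<odot> y2 \<ominus> y2 \<otimes> y2 = y1"
    unfolding y2(2) by (rule A.lin_eqI) (use y1(1) y2 in \<open>auto simp: A.linfun_simps A.cs_closed\<close>)
  have "a = y1"
  proof (rule eq_of_pi_eq)
    \<comment> \<open>At \<open>?v\<close> the quadratic forms of \<open>a\<close> and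
      \<open>y1\<close> add up to \<open>2 |?v|^2\<close>. That of \<open>y1\<close> is at most
      \<open>|?v|^2\<close> because \<open>1 - y1\<close> is a square, and that of \<open>a\<close>
      is smaller than \<open>|?v|^2\<close> unless \<open>?v\<close> is zero.\<close>
    fix u assume u: "u \<in> H.carr"
    let ?v = "\<pi> d u"
    have v: "?v \<in> H.carr" using d u by (simp add: pi_closed)
    have "cv_scale H 2 ?v = cv_add H (\<pi> a ?v) (\<pi> y1 ?v)"
      using arg_cong[OF d2, of "\<lambda>x. \<pi> x u"] a y1 d u v by (simp add: pi_scale pi_mult A.cs_closed pi_add)
    then have "H.ip ?v (cv_scale H 2 ?v) = H.ip ?v (cv_add H (\<pi> a ?v) (\<pi> y1 ?v))" by (simp only:)
    then have "2 * H.ip ?v ?v = H.ip ?v (\<pi> a ?v) + H.ip ?v (\<pi> y1 ?v)"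
      using a(1) y1(1) v by (simp add: H.inner_simps pi_closed)
    then have 1: "2 * (H.nrm ?v)\<^sup>2 = Re (H.ip ?v (\<pi> a ?v)) + Re (H.ip ?v (\<pi> y1 ?v))"
      using v by (simp add: H.nrm_square complex_eq_iff)
    have 2: "(H.nrm ?v)\<^sup>2 - Re (H.ip ?v (\<pi> y1 ?v)) \<ge> 0"
      using nrm_one_minus_pi_square[OF y2(1,3) v] unfolding y2y2 by (metis zero_le_power2)
    have 3: "Re (H.ip ?v (\<pi> a ?v)) = (H.nrm (\<pi> c ?v))\<^sup>2"
      using nrm_pi_square[OF c(1) v] c(2) by (simp add: a_def)
    have 4: "H.nrm (\<pi> c ?v) \<le> \<rho> * H.nrm ?v" by (rule \<rho>(2)[OF v])
    show "H.nrm (\<pi> (a \<ominus> y1) u) = 0"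
    proof (rule ccontr)
      assume "\<not> ?thesis"
      then have pos: "H.nrm ?v > 0" using H.nonneg[OF v] by (simp add: d_def)
      then have "H.nrm (\<pi> c ?v) < H.nrm ?v"
        using 4 mult_strict_right_mono[OF \<rho>(1) pos] by linarith
      then have "(H.nrm (\<pi> c ?v))\<^sup>2 < (H.nrm ?v)\<^sup>2"
        using c v by (intro power_strict_mono) (auto simp: H.nonneg pi_closed)
      then show False using 1 2 3 by linarith
    qed
  qed (use a y1 in auto)
  then have "2 \<odot> y2 = c \<otimes> c \<oplus> y2 \<otimes> y2" using y2(2) by (simp add: a_def)
  \<comment> \<open>Now \<open>c^2 + (1 - y2)^2 = 1\<close>, so \<open>c\<close> is the cosine of a
    unitary.\<close>
  then show ?thesis by (intro A.norm_cos_le_one[of c y2]) (use c y2 cy2 in auto)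
qed

lemma norm_le_if_pi_le_selfadjoint:
  assumes b: "b \<in> A.carr" "b\<^sup>\<star> = b"
    and r: "r \<ge> 0" "\<And>u. u \<in> H.carr \<Longrightarrow> H.nrm (\<pi> b u) \<le> r * H.nrm u"
  shows "cs_norm A b \<le> r"
proof (rule ccontr)
  let ?R = "cs_norm A b"
  assume "\<not> ?R \<le> r"
  then have R: "r < ?R" by simp
  \<comment> \<open>The first bound keeps the scaled element within \<open>sqrt 2\<close>, the
    second brings its image below norm one; as \<open>r < ?R\<close>, both leave its own norm above
    one.\<close>
  define t where "t = min (sqrt 2 / ?R) (2 / (?R + r))"
  have t: "t > 0" "t * ?R \<le> sqrt 2" "t * r < 1" "1 < t * ?R"
  proof -
    show "t > 0" using R r by (auto simp: t_def)
    have "t * ?R \<le> sqrt 2 / ?R * ?R" using R r by (intro mult_right_mono) (auto simp: t_def)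
    then show "t * ?R \<le> sqrt 2" using R r by simp
    have "t * r \<le> 2 / (?R + r) * r" using r by (intro mult_right_mono) (auto simp: t_def)
    also have "\<dots> < 1" using R r by (simp add: field_simps)
    finally show "t * r < 1" .
    have "1 < sqrt 2 / ?R * ?R" "1 < 2 / (?R + r) * ?R" using R r by (simp_all add: field_simps)
    then show "1 < t * ?R" by (simp add: t_def min_def)
  qed
  have "cs_norm A (complex_of_real t \<odot> b) \<le> 1"
  proof (rule norm_le_one_if_pi_contraction[where \<rho> = "t * r"])
    show "H.nrm (\<pi> (complex_of_real t \<odot> b) u) \<le> t * r * H.nrm u" if u: "u \<in> H.carr" for u
      using mult_left_mono[OF r(2)[OF u], of t] b u t by (simp add: pi_scale H.scale pi_closed)
  qed (use b t in \<open>auto simp: A.closed A.star_scale A.scale\<close>)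
  then show False using t b by (simp add: A.scale)
qed

lemma norm_le_if_pi_le:
  assumes x: "x \<in> A.carr"
    and r: "r \<ge> 0" "\<And>u. u \<in> H.carr \<Longrightarrow> H.nrm (\<pi> x u) \<le> r * H.nrm u"
  shows "cs_norm A x \<le> r"
proof -
  have star: "H.nrm (\<pi> (x\<^sup>\<star>) u) \<le> r * H.nrm u" if u: "u \<in> H.carr" for u
  proof -
    let ?v = "\<pi> (x\<^sup>\<star>) u"
    have v: "?v \<in> H.carr" using x u by (simp add: pi_closed A.cs_closed)
    have "(H.nrm ?v)\<^sup>2 = Re (H.ip (\<pi> x ?v) u)" using x u v by (simp add: H.nrm_square pi_star)
    also have "\<dots> \<le> H.nrm (\<pi> x ?v) * H.nrm u"
      using H.cauchy_schwarz[OF pi_closed[OF x v] u] complex_Re_le_cmod order.trans by blast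
    also have "\<dots> \<le> r * H.nrm ?v * H.nrm u" using r(2)[OF v] H.nonneg[OF u] by (intro mult_right_mono)
    finally have "H.nrm ?v * H.nrm ?v \<le> H.nrm ?v * (r * H.nrm u)" by (simp add: power2_eq_square mult_ac)
    then show ?thesis using H.nonneg[OF v] H.nonneg[OF u] r(1) by (cases "H.nrm ?v = 0") auto
  qed
  let ?b = "x\<^sup>\<star> \<otimes> x"
  have "cs_norm A ?b \<le> r\<^sup>2"
  proof (rule norm_le_if_pi_le_selfadjoint)
    show "H.nrm (\<pi> ?b u) \<le> r\<^sup>2 * H.nrm u" if u: "u \<in> H.carr" for u
    proof -
      have "H.nrm (\<pi> ?b u) \<le> r * H.nrm (\<pi> x u)" using star[OF pi_closed[OF x u]] x u by (simp add: pi_mult A.cs_closed)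
      also have "\<dots> \<le> r * (r * H.nrm u)" using r u by (intro mult_left_mono)
      finally show ?thesis by (simp add: power2_eq_square)
    qed
  qed (use x in \<open>auto simp: A.cs_closed A.star_mult A.star_star\<close>)
  then have "(cs_norm A x)\<^sup>2 \<le> r\<^sup>2" by (simp only: A.cstar_identity[OF x])
  then show ?thesis by (rule power2_le_imp_le) (rule r(1))
qed

end

section \<open>Signed sums through finite-dimensional approximations\<close>

context hilbert_space
begin

lemma bounded_ops_minus:
  assumes S: "S \<in> bounded_ops H" and T: "T \<in> bounded_ops H"
  shows "cv_minus (BH H) S T \<in> bounded_ops H"
    and "u \<in> carr \<Longrightarrow> cv_minus (BH H) S T u = S u \<ominus> T u"
proof -
  have minus: "cv_minus (BH H) S T = (\<lambda>u\<in>carr. S u \<ominus> T u)"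
    by (auto simp: cv_minus_def BH_def)
  then show "u \<in> carr \<Longrightarrow> cv_minus (BH H) S T u = S u \<ominus> T u" by simp
  have lin: "lin_map H H S" "lin_map H H T" using S T by (auto simp: bounded_ops_def)
  obtain C D where C: "\<And>x. x \<in> carr \<Longrightarrow> nrm (S x) \<le> C * nrm x" and D: "\<And>x. x \<in> carr \<Longrightarrow> nrm (T x) \<le> D * nrm x"
    using S T unfolding bounded_ops_def by blast
  have "nrm (S x \<ominus> T x) \<le> (C + D) * nrm x" if "x \<in> carr" for x
    using N_minus_le[of "S x" "T x"] C[OF that] D[OF that] bounded_ops_closed[OF S that] bounded_ops_closed[OF T that]
    by (simp add: distrib_right)
  moreover have "lin_map H H (\<lambda>u\<in>carr. S u \<ominus> T u)"
    unfolding lin_map_def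
  proof (intro conjI ballI allI)
    show "(\<lambda>u\<in>carr. S u \<ominus> T u) \<in> carr \<rightarrow> carr"
      using bounded_ops_closed[OF S] bounded_ops_closed[OF T] by (auto simp: minus_closed)
    fix x y assume xy: "x \<in> carr" "y \<in> carr"
    have "S (x \<oplus> y) \<ominus> T (x \<oplus> y) = S x \<ominus> T x \<oplus> (S y \<ominus> T y)"
      by (rule lin_eqI) (use xy lin bounded_ops_closed[OF S] bounded_ops_closed[OF T]
        in \<open>auto simp: linfun_simps closed minus_closed lin_map_def\<close>)
    then show "(\<lambda>u\<in>carr. S u \<ominus> T u) (x \<oplus> y) = (\<lambda>u\<in>carr. S u \<ominus> T u) x \<oplus> (\<lambda>u\<in>carr. S u \<ominus> T u) y"
      using xy by (simp add: closed)
  next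
    fix c x assume x: "x \<in> carr"
    have "S (c \<odot> x) \<ominus> T (c \<odot> x) = c \<odot> (S x \<ominus> T x)"
      by (rule lin_eqI) (use x lin bounded_ops_closed[OF S] bounded_ops_closed[OF T]
        in \<open>auto simp: linfun_simps closed minus_closed lin_map_def algebra_simps\<close>)
    then show "(\<lambda>u\<in>carr. S u \<ominus> T u) (c \<odot> x) = c \<odot> (\<lambda>u\<in>carr. S u \<ominus> T u) x"
      using x by (simp add: closed)
  qed
  ultimately show "cv_minus (BH H) S T \<in> bounded_ops H"
    unfolding minus bounded_ops_def by (auto intro!: exI[of _ "C + D"])
qed

end

context faithful_representation
begin

text \<open>Each of the \<open>n\<close> terms is approximated up to \<open>\<delta>\<close>, so the
  signed sum is approximated up to \<open>\<delta> * n\<close>, and the surplus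
  \<open>\<delta>\<close> in the hypothesis pays for that. Isometry of \<open>\<pi>\<close>
  transfers the lower bound to operators, and contractivity of \<open>\<psi>\<close> transfers it to
  \<open>B\<close>.\<close>

lemma large_signed_sums_force_rank:
  assumes cpa: "(\<phi>, \<psi>, B) \<in> CPA A H \<pi> W \<delta>" and rank: "has_rank B r" and \<delta>: "\<delta> > 0"
    and y: "\<And>s. s < n \<Longrightarrow> y s \<in> W" "\<And>s. s < n \<Longrightarrow> y s \<in> A.carr" "\<And>s. s < n \<Longrightarrow> cs_norm A (y s) \<le> 1"
    and c: "0 < c" "c \<le> 1"
    and large: "\<And>\<epsilon>. \<epsilon> \<in> signs n \<Longrightarrow> (c + \<delta>) * real n \<le> cs_norm A (A.signed_sum y n \<epsilon>)"
  shows "exp (c\<^sup>2 * real n / 16) \<le> 3 * real (max r 1)"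
proof -
  have B: "cstar_algebra B" and \<phi>: "lin_map A B \<phi>" "contractive A B \<phi>"
    and \<psi>: "lin_map B (BH H) \<psi>" "contractive B (BH H) \<psi>"
    and approx: "\<And>x. x \<in> W \<Longrightarrow> cs_norm (BH H) (cv_minus (BH H) (\<psi> (\<phi> x)) (\<pi> x)) < \<delta>"
    using cpa by (auto simp: CPA_def fin_dim_cstar_def completely_positive_def)
  interpret B: cstar_algebra B by (rule B)
  have \<phi>c: "\<phi> x \<in> B.carr" if "x \<in> A.carr" for x using \<phi>(1) that by (auto simp: lin_map_def)
  have \<psi>c: "\<psi> b \<in> bounded_ops H" if "b \<in> B.carr" for b
    using \<psi>(1) that by (auto simp: lin_map_def BH_def)
  have A: "complex_vs A" and H: "complex_vs H" by unfold_locales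
  show ?thesis
  proof (rule B.exp_le_rank_if_signed_sums_large[OF rank, where z = "\<lambda>s. \<phi> (y s)"])
    show "\<phi> (y s) \<in> B.carr" if "s < n" for s using y \<phi>c that by blast
    show "cs_norm B (\<phi> (y s)) \<le> 1" if "s < n" for s
      using y(2,3)[OF that] \<phi>(2) order.trans unfolding contractive_def by blast
    fix \<epsilon> assume \<epsilon>: "\<epsilon> \<in> signs n"
    let ?Y = "A.signed_sum y n \<epsilon>" and ?S = "B.signed_sum (\<lambda>s. \<phi> (y s)) n \<epsilon>"
    have Y: "?Y \<in> A.carr" using y by (intro A.vsum_closed) (simp add: A.closed)
    have \<phi>Y: "\<phi> ?Y = ?S"
    proof -
      have "\<phi> ?Y = B.vsum (\<lambda>s. \<phi> (complex_of_real (\<epsilon> s) \<odot> y s)) n"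
        using y by (intro lin_map_vsum[OF A B.complex_vs_axioms \<phi>(1)]) (simp add: A.closed)
      also have "\<dots> = ?S" using y \<phi>(1) by (intro B.vsum_cong) (simp add: lin_map_def)
      finally show ?thesis .
    qed
    have S: "?S \<in> B.carr" using \<phi>c[OF Y] by (simp add: \<phi>Y)
    have "cs_norm A ?Y \<le> cs_norm B ?S + \<delta> * real n"
    proof (rule norm_le_if_pi_le[OF Y])
      show "0 \<le> cs_norm B ?S + \<delta> * real n" using B.nonneg[OF S] \<delta> by simp
      fix u assume u: "u \<in> H.carr"
      have lin1: "lin_map A H (\<lambda>x. \<pi> x u)" unfolding lin_map_def using u by (auto simp: pi_simps)
      have \<psi>u: "\<psi> (\<phi> x) u \<in> H.carr" if "x \<in> A.carr" for x
        using that u \<phi>c \<psi>c by (simp add: H.bounded_ops_closed)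
      have lin2: "lin_map A H (\<lambda>x. \<psi> (\<phi> x) u)"
        using \<phi>(1) \<psi>(1) u \<phi>c \<psi>u unfolding lin_map_def by (simp add: BH_def)
      let ?d = "\<lambda>s. cv_minus H (\<psi> (\<phi> (y s)) u) (\<pi> (y s) u)"
      have dc: "?d s \<in> H.carr" if "s < n" for s
        using that y u \<phi>c \<psi>c by (simp add: H.minus_closed H.bounded_ops_closed pi_closed)
      let ?e = "\<lambda>s. cv_scale H (complex_of_real (\<epsilon> s)) (?d s)"
      have ec: "H.vsum ?e n \<in> H.carr" using dc by (intro H.vsum_closed) (simp add: H.closed)
      have \<psi>S: "\<psi> ?S u \<in> H.carr" using S u \<psi>c by (simp add: H.bounded_ops_closed)
      have eq: "\<pi> ?Y u = cv_minus H (\<psi> ?S u) (H.vsum ?e n)"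
      proof (rule H.lin_eqI)
        fix g assume g: "H.linfun g"
        have "g (\<pi> ?Y u) = g (H.vsum (\<lambda>s. \<pi> (complex_of_real (\<epsilon> s) \<odot> y s) u) n)"
          using lin_map_vsum[OF A H lin1, of n "\<lambda>s. complex_of_real (\<epsilon> s) \<odot> y s"] y by (simp add: A.closed)
        also have "\<dots> = (\<Sum>s<n. complex_of_real (\<epsilon> s) * g (\<pi> (y s) u))"
          using g y u by (subst H.linfun_vsum) (auto simp: A.closed pi_simps H.linfun_simps H.closed)
        finally have 1: "g (\<pi> ?Y u) = (\<Sum>s<n. complex_of_real (\<epsilon> s) * g (\<pi> (y s) u))" .
        have "g (\<psi> (\<phi> ?Y) u) = g (H.vsum (\<lambda>s. \<psi> (\<phi> (complex_of_real (\<epsilon> s) \<odot> y s)) u) n)"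
          using lin_map_vsum[OF A H lin2, of n "\<lambda>s. complex_of_real (\<epsilon> s) \<odot> y s"] y by (simp add: A.closed)
        also have "\<dots> = (\<Sum>s<n. g (\<psi> (\<phi> (complex_of_real (\<epsilon> s) \<odot> y s)) u))"
          using g y u \<psi>u by (subst H.linfun_vsum) (auto simp: A.closed)
        also have "\<dots> = (\<Sum>s<n. complex_of_real (\<epsilon> s) * g (\<psi> (\<phi> (y s)) u))"
          using g y lin2 \<psi>u by (intro sum.cong) (auto simp: lin_map_def H.linfun_simps)
        finally have 2: "g (\<psi> ?S u) = (\<Sum>s<n. complex_of_real (\<epsilon> s) * g (\<psi> (\<phi> (y s)) u))" unfolding \<phi>Y .
        have "g (H.vsum ?e n) = (\<Sum>s<n. complex_of_real (\<epsilon> s) * (g (\<psi> (\<phi> (y s)) u) - g (\<pi> (y s) u)))"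
          using g y dc u \<psi>u by (subst H.linfun_vsum) (auto simp: H.closed pi_closed H.linfun_simps)
        then show "g (\<pi> ?Y u) = g (cv_minus H (\<psi> ?S u) (H.vsum ?e n))"
          using 1 2 by (simp add: H.linfun_minus[OF g \<psi>S ec] right_diff_distrib sum_subtractf)
      qed (use Y u ec \<psi>S in \<open>auto simp: pi_closed H.minus_closed\<close>)
      have "H.nrm (\<pi> ?Y u) \<le> H.nrm (\<psi> ?S u) + H.nrm (H.vsum ?e n)"
        unfolding eq by (rule H.N_minus_le[OF \<psi>S ec])
      also have "H.nrm (\<psi> ?S u) \<le> cs_norm B ?S * H.nrm u"
      proof -
        have "H.nrm (\<psi> ?S u) \<le> cs_norm (BH H) (\<psi> ?S) * H.nrm u" using S u \<psi>c by (intro H.op_norm_bound)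
        also have "\<dots> \<le> cs_norm B ?S * H.nrm u"
          using \<psi>(2) S H.nonneg[OF u] by (intro mult_right_mono) (auto simp: contractive_def)
        finally show ?thesis .
      qed
      also have "H.nrm (H.vsum ?e n) \<le> (\<Sum>s<n. \<delta> * H.nrm u)"
      proof (rule order.trans[OF H.N_vsum sum_mono])
        show "?e s \<in> H.carr" if "s < n" for s using dc that by (simp add: H.closed)
        fix s assume "s \<in> {..<n}"
        then have s: "s < n" by simp
        have ops: "\<psi> (\<phi> (y s)) \<in> bounded_ops H" "\<pi> (y s) \<in> bounded_ops H" using s y \<phi>c \<psi>c pi_ops by auto
        have "\<epsilon> s = 1 \<or> \<epsilon> s = -1" using \<epsilon> s by auto
        then have "H.nrm (?e s) = H.nrm (?d s)" using H.scale[OF dc[OF s]] by auto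
        also have "\<dots> = H.nrm (cv_minus (BH H) (\<psi> (\<phi> (y s))) (\<pi> (y s)) u)"
          using H.bounded_ops_minus(2)[OF ops u] by simp
        also have "\<dots> \<le> cs_norm (BH H) (cv_minus (BH H) (\<psi> (\<phi> (y s))) (\<pi> (y s))) * H.nrm u"
          by (rule H.op_norm_bound[OF H.bounded_ops_minus(1)[OF ops] u])
        also have "\<dots> \<le> \<delta> * H.nrm u"
          using approx[OF y(1)[OF s]] H.nonneg[OF u] by (intro mult_right_mono) auto
        finally show "H.nrm (?e s) \<le> \<delta> * H.nrm u" .
      qed
      finally show "H.nrm (\<pi> ?Y u) \<le> (cs_norm B ?S + \<delta> * real n) * H.nrm u"
        by (simp add: algebra_simps)
    qed
    then show "c * real n \<le> cs_norm B ?S" using large[OF \<epsilon>] by (simp add: algebra_simps)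
  qed (use c in auto)
qed

text \<open>Composed with \<open>\<alpha>\<close> the representation stays contractive, while
  \<open>\<pi>\<close> itself does not decrease norms.\<close>

lemma automorphism_norm_le:
  assumes \<alpha>: "star_automorphism A \<alpha>" and x: "x \<in> A.carr"
  shows "cs_norm A (\<alpha> x) \<le> cs_norm A x"
proof (rule norm_le_if_pi_le)
  have hom: "star_hom A A \<alpha>" using \<alpha> by (simp add: star_automorphism_def)
  then have \<alpha>c: "\<alpha> x \<in> A.carr" if "x \<in> A.carr" for x using that by (auto simp: star_hom_def lin_map_def)
  then show "\<alpha> x \<in> A.carr" using x by blast
  show "0 \<le> cs_norm A x" by (rule A.nonneg[OF x])
  have "representation A H (\<lambda>x. \<pi> (\<alpha> x))"
    using hom rep \<alpha>c unfolding representation_def star_hom_def lin_map_def by (auto simp: A.cs_closed)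
  then interpret R: cstar_representation A H "\<lambda>x. \<pi> (\<alpha> x)" by unfold_locales
  show "H.nrm (\<pi> (\<alpha> x) u) \<le> cs_norm A x * H.nrm u" if "u \<in> H.carr" for u
    by (rule R.pi_contractive[OF x that])
qed

end

text \<open>A finite infimum of extended naturals is attained, so vanishing entropy yields actual
  triples. Under the convention \<open>ln 0 = 0\<close> the numbers \<open>r\<close> and
  \<open>max r 1\<close> have the same logarithm.\<close>

lemma eventually_small_rank:
  assumes ht: "ht A H \<pi> \<alpha> = 0" and W: "finite W" "W \<subseteq> cv_carrier A" and pos: "\<delta> > 0" "\<kappa> > 0"
  shows "\<forall>\<^sub>F n in sequentially. \<exists>\<phi> \<psi> B r.
    (\<phi>, \<psi>, B) \<in> CPA A H \<pi> (\<Union>i<n. (\<alpha> ^^ i) ` W) \<delta> \<and> has_rank B r \<and> real (max r 1) \<le> exp (\<kappa> * real n)"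
proof -
  let ?W = "\<lambda>n. \<Union>i<n. (\<alpha> ^^ i) ` W"
  have "ht_local A H \<pi> \<alpha> W \<delta> \<le> (SUP \<delta>\<in>{0<..}. ht_local A H \<pi> \<alpha> W \<delta>)"
    using pos by (intro SUP_upper) auto
  also have "\<dots> \<le> ht A H \<pi> \<alpha>" unfolding ht_def using W by (intro SUP_upper) auto
  finally have "ht_local A H \<pi> \<alpha> W \<delta> < ereal \<kappa>" using ht pos by (simp add: order_le_less_trans)
  then have ev: "\<forall>\<^sub>F n in sequentially. ereal (1 / real n) * log_enat (rcp A H \<pi> (?W n) \<delta>) < ereal \<kappa>"
    unfolding ht_local_def by (simp add: Limsup_lessD)
  show ?thesis
    using ev eventually_gt_at_top[of 0]
  proof eventually_elim
    case (elim n)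
    let ?X = "{enat r | r. \<exists>\<phi> \<psi> B. (\<phi>, \<psi>, B) \<in> CPA A H \<pi> (?W n) \<delta> \<and> has_rank B r}"
    have rcp: "rcp A H \<pi> (?W n) \<delta> = Inf ?X" by (simp add: rcp_def)
    have "rcp A H \<pi> (?W n) \<delta> \<noteq> \<infinity>"
    proof
      assume "rcp A H \<pi> (?W n) \<delta> = \<infinity>"
      then show False using elim by (simp add: log_enat_def)
    qed
    then obtain r where r: "rcp A H \<pi> (?W n) \<delta> = enat r" by (metis not_infinity_eq)
    have "?X \<noteq> {}" using r rcp by (metis Inf_enat_def enat.distinct(1) infinity_enat_def)
    then have "Inf ?X \<in> ?X" by (metis (no_types, lifting) Inf_enat_def LeastI_ex ex_in_conv)
    then obtain \<phi> \<psi> B where *: "(\<phi>, \<psi>, B) \<in> CPA A H \<pi> (?W n) \<delta>" "has_rank B r"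
      using r rcp by auto
    have "ln (real r) < \<kappa> * real n" using elim r by (simp add: log_enat_def field_simps)
    then have "real r \<le> exp (\<kappa> * real n)"
      using exp_less_mono[of "ln (real r)" "\<kappa> * real n"] by (cases "r = 0") auto
    moreover have "1 \<le> exp (\<kappa> * real n)" using pos by simp
    ultimately have "real (max r 1) \<le> exp (\<kappa> * real n)" by (simp add: max_def)
    then show ?case using * by blast
  qed
qed

section \<open>Covers and the dual ball\<close>

lemma topspace_weak_star: "S \<subseteq> extensional (cv_carrier A) \<Longrightarrow> topspace (weak_star A S) = S"
  by (auto simp: weak_star_def PiE_def)

text \<open>The Lebesgue number argument in the uniformity of pointwise convergence: the basic
  neighbourhood of radius \<open>2 * \<epsilon>\<close> of each centre lies in one member of the
  cover, finitely many neighbourhoods of half the radius cover by compactness, and the triangle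
  inequality uses the other half.\<close>

lemma weak_star_lebesgue:
  assumes comp: "compact_space (weak_star A S)" and S: "S \<subseteq> extensional (cv_carrier A)"
    and cover: "finite_open_cover (weak_star A S) \<U>"
  obtains \<Omega> and \<epsilon> :: real where "finite \<Omega>" "\<Omega> \<subseteq> cv_carrier A" "\<epsilon> > 0"
    "\<And>\<sigma>. \<sigma> \<in> S \<Longrightarrow> \<exists>U\<in>\<U>. \<forall>\<tau>\<in>S. (\<forall>x\<in>\<Omega>. cmod (\<tau> x - \<sigma> x) < \<epsilon>) \<longrightarrow> \<tau> \<in> U"
proof -
  let ?C = "cv_carrier A" and ?X = "weak_star A S"
  let ?P = "product_topology (\<lambda>_. euclidean :: complex topology) ?C"
  have top: "topspace ?X = S" by (rule topspace_weak_star[OF S])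
  have basic: "\<exists>\<Omega> \<epsilon>. finite \<Omega> \<and> \<Omega> \<subseteq> ?C \<and> 0 < \<epsilon> \<and> (\<exists>U\<in>\<U>. \<forall>\<tau>\<in>S. (\<forall>x\<in>\<Omega>. cmod (\<tau> x - \<sigma> x) < 2 * \<epsilon>) \<longrightarrow> \<tau> \<in> U)"
    if \<sigma>: "\<sigma> \<in> S" for \<sigma>
  proof -
    obtain U where U: "U \<in> \<U>" "\<sigma> \<in> U" "openin ?X U"
      using cover \<sigma> top unfolding finite_open_cover_def by blast
    then obtain W where W: "openin ?P W" "U = W \<inter> S"
      by (auto simp: weak_star_def openin_subtopology)
    then have "\<sigma> \<in> W" using U by blast
    then obtain V where V: "finite {i \<in> ?C. V i \<noteq> topspace (euclidean :: complex topology)}"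
      "\<forall>i\<in>?C. openin euclidean (V i)" "\<sigma> \<in> Pi\<^sub>E ?C V" "Pi\<^sub>E ?C V \<subseteq> W"
      using W(1) unfolding openin_product_topology_alt by blast
    define \<Omega> where "\<Omega> = {i \<in> ?C. V i \<noteq> UNIV}"
    have fin: "finite \<Omega>" using V(1) by (simp add: \<Omega>_def)
    have "\<forall>x\<in>\<Omega>. \<exists>e>0. ball (\<sigma> x) e \<subseteq> V x"
    proof
      fix x assume x: "x \<in> \<Omega>"
      then have "open (V x)" "\<sigma> x \<in> V x" using V(2,3) by (auto simp: \<Omega>_def)
      then show "\<exists>e>0. ball (\<sigma> x) e \<subseteq> V x" by (rule openE) blast
    qed
    then obtain e where e: "\<And>x. x \<in> \<Omega> \<Longrightarrow> 0 < e x" "\<And>x. x \<in> \<Omega> \<Longrightarrow> ball (\<sigma> x) (e x) \<subseteq> V x"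
      by metis
    define \<epsilon> where "\<epsilon> = Min (insert 1 (e ` \<Omega>)) / 2"
    have \<epsilon>: "0 < \<epsilon>" unfolding \<epsilon>_def using fin e(1) by auto
    have le: "2 * \<epsilon> \<le> e x" if "x \<in> \<Omega>" for x unfolding \<epsilon>_def using fin that by auto
    have "\<tau> \<in> U" if \<tau>: "\<tau> \<in> S" "\<forall>x\<in>\<Omega>. cmod (\<tau> x - \<sigma> x) < 2 * \<epsilon>" for \<tau>
    proof -
      have "\<tau> x \<in> V x" if x: "x \<in> ?C" for x
      proof (cases "x \<in> \<Omega>")
        case True
        then have "\<tau> x \<in> ball (\<sigma> x) (e x)" using \<tau>(2) le[OF True] by (force simp: dist_norm norm_minus_commute)
        then show ?thesis using e(2) True by blast
      qed (use x in \<open>auto simp: \<Omega>_def\<close>)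
      then have "\<tau> \<in> Pi\<^sub>E ?C V" using \<tau>(1) S by (auto simp: PiE_def)
      then show ?thesis using V(4) W(2) \<tau>(1) by blast
    qed
    then show ?thesis using fin \<epsilon> U(1) by (intro exI[of _ \<Omega>] exI[of _ \<epsilon>]) (auto simp: \<Omega>_def)
  qed
  then obtain \<Omega> \<epsilon> where fin: "\<And>\<sigma>. \<sigma> \<in> S \<Longrightarrow> finite (\<Omega> \<sigma>)" and sub: "\<And>\<sigma>. \<sigma> \<in> S \<Longrightarrow> \<Omega> \<sigma> \<subseteq> ?C"
    and pos: "\<And>\<sigma>. \<sigma> \<in> S \<Longrightarrow> 0 < (\<epsilon> \<sigma> :: real)"
    and leb: "\<And>\<sigma>. \<sigma> \<in> S \<Longrightarrow> \<exists>U\<in>\<U>. \<forall>\<tau>\<in>S. (\<forall>x\<in>\<Omega> \<sigma>. cmod (\<tau> x - \<sigma> x) < 2 * \<epsilon> \<sigma>) \<longrightarrow> \<tau> \<in> U"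
    by metis
  define N where "N \<sigma> = {\<tau> \<in> S. \<forall>x\<in>\<Omega> \<sigma>. cmod (\<tau> x - \<sigma> x) < \<epsilon> \<sigma>}" for \<sigma>
  have "openin ?X (N \<sigma>)" if \<sigma>: "\<sigma> \<in> S" for \<sigma>
  proof -
    let ?V = "\<lambda>x. if x \<in> \<Omega> \<sigma> then ball (\<sigma> x) (\<epsilon> \<sigma>) else UNIV"
    have "finite {x \<in> ?C. ?V x \<noteq> UNIV}" by (rule finite_subset[OF _ fin[OF \<sigma>]]) auto
    then have "openin ?P (Pi\<^sub>E ?C ?V)" by (simp add: openin_PiE_gen)
    moreover have "N \<sigma> = Pi\<^sub>E ?C ?V \<inter> S"
      using S sub[OF \<sigma>] by (auto simp: N_def PiE_def Pi_def dist_norm norm_minus_commute subset_iff)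
    ultimately show ?thesis unfolding weak_star_def openin_subtopology by blast
  qed
  moreover have "\<Union> (N ` S) = S" using pos by (auto simp: N_def)
  ultimately obtain \<F> where \<F>: "finite \<F>" "\<F> \<subseteq> N ` S" "\<Union> \<F> = S"
    using comp unfolding compact_space top by (metis (no_types, lifting) imageE)
  then obtain F where F: "finite F" "F \<subseteq> S" "\<F> = N ` F" by (metis finite_subset_image)
  define \<Omega>0 where "\<Omega>0 = (\<Union>\<sigma>\<in>F. \<Omega> \<sigma>)"
  define \<epsilon>0 where "\<epsilon>0 = Min (insert 1 (\<epsilon> ` F))"
  have \<epsilon>0: "\<epsilon>0 \<le> \<epsilon> \<sigma>" if "\<sigma> \<in> F" for \<sigma> unfolding \<epsilon>0_def using F that by auto
  show ?thesis
  proof (rule that[of \<Omega>0 \<epsilon>0])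
    show "finite \<Omega>0" "\<Omega>0 \<subseteq> ?C" "\<epsilon>0 > 0" using F fin sub pos by (auto simp: \<Omega>0_def \<epsilon>0_def)
    fix \<sigma> assume "\<sigma> \<in> S"
    then obtain \<rho> where \<rho>: "\<rho> \<in> F" "\<sigma> \<in> N \<rho>" using \<F>(3) F(3) by blast
    have \<rho>S: "\<rho> \<in> S" using \<rho> F by blast
    obtain U where U: "U \<in> \<U>" "\<And>\<tau>. \<tau> \<in> S \<Longrightarrow> (\<forall>x\<in>\<Omega> \<rho>. cmod (\<tau> x - \<rho> x) < 2 * \<epsilon> \<rho>) \<Longrightarrow> \<tau> \<in> U"
      using leb[OF \<rho>S] by blast
    have "\<tau> \<in> U" if \<tau>: "\<tau> \<in> S" "\<forall>x\<in>\<Omega>0. cmod (\<tau> x - \<sigma> x) < \<epsilon>0" for \<tau>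
    proof (rule U(2)[OF \<tau>(1)], rule ballI)
      fix x assume x: "x \<in> \<Omega> \<rho>"
      have "cmod (\<tau> x - \<sigma> x) < \<epsilon> \<rho>" using \<tau>(2) x \<rho> \<epsilon>0[OF \<rho>(1)] by (force simp: \<Omega>0_def)
      moreover have "cmod (\<sigma> x - \<rho> x) < \<epsilon> \<rho>" using \<rho> x by (auto simp: N_def)
      ultimately show "cmod (\<tau> x - \<rho> x) < 2 * \<epsilon> \<rho>"
        using norm_triangle_ineq[of "\<tau> x - \<sigma> x" "\<sigma> x - \<rho> x"] by simp
    qed
    then show "\<exists>U\<in>\<U>. \<forall>\<tau>\<in>S. (\<forall>x\<in>\<Omega>0. cmod (\<tau> x - \<sigma> x) < \<epsilon>0) \<longrightarrow> \<tau> \<in> U" using U(1) by blast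
  qed
qed

lemma iterated_join_member:
  "(\<And>i. i < n \<Longrightarrow> g i \<in> \<U>) \<Longrightarrow> {x \<in> topspace X. \<forall>i<n. (T ^^ i) x \<in> g i} \<in> iterated_join X T \<U> n"
proof (induction n)
  case (Suc n)
  have "{x \<in> topspace X. \<forall>i<Suc n. (T ^^ i) x \<in> g i}
      = {x \<in> topspace X. \<forall>i<n. (T ^^ i) x \<in> g i} \<inter> {x \<in> topspace X. (T ^^ n) x \<in> g n}"
    by (auto simp: less_Suc_eq)
  moreover have "{x \<in> topspace X. (T ^^ n) x \<in> g n} \<in> cover_preimage X (T ^^ n) \<U>"
    using Suc.prems[of n] by (auto simp: cover_preimage_def)
  ultimately show ?case using Suc by (auto simp: cover_join_def)
qed simp

text \<open>Every point has an itinerary in the Hamming ball of radius \<open>v\<close> about some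
  reference itinerary, so the itineraries in these balls index a subcover of the join.\<close>

lemma cover_number_iterated_join_le:
  fixes t v :: real
  assumes cover: "finite_open_cover X \<U>" and T: "\<And>x. x \<in> topspace X \<Longrightarrow> T x \<in> topspace X"
    and K: "finite K" and g: "\<And>y i. y \<in> K \<Longrightarrow> g y i \<in> \<U>" and t: "0 < t" "t \<le> 1"
    and close: "\<And>x. x \<in> topspace X \<Longrightarrow> \<exists>y\<in>K. real (card {i\<in>{..<n}. (T ^^ i) x \<notin> g y i}) \<le> v"
  shows "real (cover_number X (iterated_join X T \<U> n))
    \<le> real (card K) * (t powr (- v) * (1 + t * real (card \<U>)) ^ n)"
proof -
  have fin: "finite \<U>" and un: "\<Union>\<U> = topspace X" using cover by (auto simp: finite_open_cover_def)
  define B where "B y = {f \<in> {..<n} \<rightarrow>\<^sub>E \<U>. real (card {i\<in>{..<n}. f i \<noteq> g y i}) \<le> v}" for y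
  define W where "W f = {x \<in> topspace X. \<forall>i<n. (T ^^ i) x \<in> f i}" for f
  let ?V = "W ` (\<Union>y\<in>K. B y)"
  have finB: "finite (B y)" for y
    by (rule finite_subset[of _ "{..<n} \<rightarrow>\<^sub>E \<U>"]) (auto simp: B_def fin finite_PiE)
  have Ti: "(T ^^ i) x \<in> topspace X" if "x \<in> topspace X" for i x
    using that by (induction i) (auto intro: T)
  have "\<exists>f\<in>\<Union>y\<in>K. B y. x \<in> W f" if x: "x \<in> topspace X" for x
  proof -
    obtain y where y: "y \<in> K" "real (card {i\<in>{..<n}. (T ^^ i) x \<notin> g y i}) \<le> v" using close[OF x] by blast
    have "\<forall>i. \<exists>U\<in>\<U>. (T ^^ i) x \<in> U" using Ti[OF x] un by blast
    then obtain u where u: "\<And>i. u i \<in> \<U>" "\<And>i. (T ^^ i) x \<in> u i" by metis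
    \<comment> \<open>Follow the reference itinerary where it is correct, and any member of the
      cover containing the orbit point elsewhere.\<close>
    define f where "f = (\<lambda>i\<in>{..<n}. if (T ^^ i) x \<in> g y i then g y i else u i)"
    have "card {i\<in>{..<n}. f i \<noteq> g y i} \<le> card {i\<in>{..<n}. (T ^^ i) x \<notin> g y i}"
      by (intro card_mono) (auto simp: f_def)
    then have "f \<in> B y" using y(2) g[OF y(1)] u by (auto simp: B_def f_def)
    moreover have "x \<in> W f" using x u by (auto simp: W_def f_def)
    ultimately show ?thesis using y(1) by blast
  qed
  then have "\<Union>?V = topspace X" by (auto simp: W_def)
  moreover have "?V \<subseteq> iterated_join X T \<U> n"
  proof -
    have "W f \<in> iterated_join X T \<U> n" if "f \<in> B y" for f y
      unfolding W_def by (rule iterated_join_member) (use that in \<open>auto simp: B_def\<close>)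
    then show ?thesis by blast
  qed
  moreover have "finite ?V" using K finB by auto
  ultimately have "cover_number X (iterated_join X T \<U> n) \<le> card ?V"
    unfolding cover_number_def by (intro Least_le) blast
  also have "\<dots> \<le> card (\<Union>y\<in>K. B y)" using K finB by (intro card_image_le) auto
  also have "\<dots> \<le> (\<Sum>y\<in>K. card (B y))" by (rule card_UN_le[OF K])
  finally have "real (cover_number X (iterated_join X T \<U> n)) \<le> (\<Sum>y\<in>K. real (card (B y)))"
    by (metis of_nat_le_iff of_nat_sum)
  also have "\<dots> \<le> (\<Sum>y\<in>K. t powr (- v) * (1 + t * card \<U>) ^ n)"
  proof (rule sum_mono)
    fix y
    show "real (card (B y)) \<le> t powr (- v) * (1 + t * card \<U>) ^ n"
      using card_hamming_ball_le[OF _ fin t, of "{..<n}" "g y" v] by (simp add: B_def)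
  qed
  finally show ?thesis by simp
qed

text \<open>The quotients are nonnegative, so eventual upper bounds make them converge and determine
  \<open>lim\<close>. The trivial cover keeps the supremum from being one over the empty
  set.\<close>

lemma htop_eq_zeroI:
  assumes "\<And>\<U> \<eta>. finite_open_cover X \<U> \<Longrightarrow> \<eta> > 0 \<Longrightarrow>
    \<forall>\<^sub>F n in sequentially. ln (real (cover_number X (iterated_join X T \<U> n))) \<le> \<eta> * real n"
  shows "htop X T = 0"
proof -
  have "htop_cover X T \<U> = 0" if \<U>: "finite_open_cover X \<U>" for \<U>
  proof -
    let ?h = "\<lambda>n. 1 / real n * ln (real (cover_number X (iterated_join X T \<U> n)))"
    \<comment> \<open>A cover number zero, as on an empty space, enters with
      \<open>ln 0 = 0\<close>.\<close>
    have nonneg: "0 \<le> ?h n" for n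
      by (cases "cover_number X (iterated_join X T \<U> n) = 0") (auto intro!: divide_nonneg_nonneg ln_ge_zero)
    have "?h \<longlonglongrightarrow> 0"
    proof (rule tendstoI)
      fix e :: real assume e: "e > 0"
      show "\<forall>\<^sub>F n in sequentially. dist (?h n) 0 < e"
        using assms[OF \<U> half_gt_zero[OF e]] eventually_gt_at_top[of 0]
      proof eventually_elim
        case (elim n)
        then have "?h n \<le> e / 2" by (simp add: field_simps)
        then show ?case unfolding dist_real_def using nonneg[of n] e by linarith
      qed
    qed
    then show ?thesis unfolding htop_cover_def by (rule limI)
  qed
  moreover have "finite_open_cover X {topspace X}" by (simp add: finite_open_cover_def)
  ultimately show ?thesis unfolding htop_def by (intro antisym SUP_least SUP_upper2[of "{topspace X}"]) auto
qed

section \<open>The dual ball: test elements and shattering\<close>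

context cstar_algebra
begin

lemma dual_ball_bound:
  assumes "\<sigma> \<in> dual_ball A" "x \<in> carr"
  shows "cmod (\<sigma> x) \<le> cs_norm A x"
proof (cases "cs_norm A x = 0")
  case True
  obtain C where "\<forall>x\<in>carr. cmod (\<sigma> x) \<le> C * cs_norm A x"
    using assms(1) by (auto simp: dual_ball_def dual_space_def)
  then show ?thesis using True assms(2) by force
next
  case False
  then have pos: "cs_norm A x > 0" using nonneg[OF assms(2)] by simp
  obtain C where C: "\<And>x. x \<in> carr \<Longrightarrow> cmod (\<sigma> x) \<le> C * cs_norm A x"
    and lin: "lin_functional A \<sigma>" and le: "dual_norm A \<sigma> \<le> 1"
    using assms(1) by (auto simp: dual_ball_def dual_space_def)
  let ?r = "complex_of_real (1 / cs_norm A x)"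
  let ?V = "{cmod (\<sigma> x) | x. x \<in> carr \<and> cs_norm A x \<le> 1}"
  have "bdd_above ?V"
  proof (rule bdd_aboveI)
    fix a assume "a \<in> ?V"
    then obtain z where z: "a = cmod (\<sigma> z)" "z \<in> carr" "cs_norm A z \<le> 1" by blast
    then have "a \<le> \<bar>C\<bar> * cs_norm A z"
      using C[OF z(2)] nonneg[OF z(2)] by (meson abs_ge_self mult_right_mono order_trans)
    also have "\<dots> \<le> \<bar>C\<bar> * 1" using z by (intro mult_left_mono) auto
    finally show "a \<le> \<bar>C\<bar>" by simp
  qed
  moreover have "cmod (\<sigma> (?r \<odot> x)) \<in> ?V"
    using assms(2) pos by (auto simp: closed scale norm_divide intro!: exI[of _ "?r \<odot> x"])
  ultimately have "cmod (\<sigma> (?r \<odot> x)) \<le> 1"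
    using le unfolding dual_norm_def by (meson cSup_upper order_trans)
  then show ?thesis using lin assms(2) pos by (simp add: lin_functional_def Real_Vector_Spaces.norm_mult norm_divide)
qed

lemma dual_ballI:
  assumes "lin_functional A \<sigma>" "\<And>x. x \<in> carr \<Longrightarrow> cmod (\<sigma> x) \<le> cs_norm A x"
  shows "\<sigma> \<in> dual_ball A"
proof -
  have "dual_norm A \<sigma> \<le> 1"
    unfolding dual_norm_def
  proof (rule cSup_least)
    have "cv_zero A \<in> carr \<and> cs_norm A (cv_zero A) \<le> 1" by (simp add: closed N_zero)
    then show "{cmod (\<sigma> x) | x. x \<in> carr \<and> cs_norm A x \<le> 1} \<noteq> {}" by blast
  qed (use assms(2) order.trans in blast)
  then show ?thesis using assms by (auto simp: dual_ball_def dual_space_def intro!: exI[of _ 1])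
qed

text \<open>Normalization for the combinatorics: from here on only real parts at finitely many
  contractions are compared.\<close>

lemma dual_ball_lebesgue:
  assumes comp: "compact_space (weak_star A S)" and S: "S \<subseteq> dual_ball A"
    and cover: "finite_open_cover (weak_star A S) \<U>"
  obtains \<Omega> and \<epsilon> :: real where "finite \<Omega>" "\<Omega> \<noteq> {}" "\<Omega> \<subseteq> carr" "\<And>x. x \<in> \<Omega> \<Longrightarrow> cs_norm A x \<le> 1"
    "0 < \<epsilon>" "\<epsilon> \<le> 1"
    "\<And>\<sigma>. \<sigma> \<in> S \<Longrightarrow> \<exists>U\<in>\<U>. \<forall>\<tau>\<in>S. (\<forall>x\<in>\<Omega>. \<bar>Re (\<tau> x) - Re (\<sigma> x)\<bar> < \<epsilon>) \<longrightarrow> \<tau> \<in> U"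
proof -
  have lin: "lin_functional A \<sigma>" if "\<sigma> \<in> S" for \<sigma> using S that by (auto simp: dual_ball_def dual_space_def)
  then have ext: "S \<subseteq> extensional carr" by (auto simp: lin_functional_def)
  obtain \<Omega>0 and \<epsilon>0 :: real where fin: "finite \<Omega>0" "\<Omega>0 \<subseteq> carr" and \<epsilon>0: "\<epsilon>0 > 0"
    and leb: "\<And>\<sigma>. \<sigma> \<in> S \<Longrightarrow> \<exists>U\<in>\<U>. \<forall>\<tau>\<in>S. (\<forall>x\<in>\<Omega>0. cmod (\<tau> x - \<sigma> x) < \<epsilon>0) \<longrightarrow> \<tau> \<in> U"
    using weak_star_lebesgue[OF comp ext cover] by metis
  define R where "R = 1 + (\<Sum>x\<in>\<Omega>0. cs_norm A x)"
  have R: "R \<ge> 1" unfolding R_def using fin nonneg by (auto intro!: sum_nonneg)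
  have le: "cs_norm A x \<le> R" if "x \<in> \<Omega>0" for x
  proof -
    have "cs_norm A x \<le> (\<Sum>x\<in>\<Omega>0. cs_norm A x)"
      using that fin nonneg by (intro member_le_sum) auto
    then show ?thesis by (simp add: R_def)
  qed
  let ?a = "complex_of_real (1 / R)" and ?b = "- \<i> * complex_of_real (1 / R)"
  \<comment> \<open>\<open>?b\<close> turns the imaginary part of \<open>\<sigma> x\<close> into a
    real part, and the zero vector keeps the set nonempty.\<close>
  define \<Omega> where "\<Omega> = insert (cv_zero A) ((\<lambda>x. ?a \<odot> x) ` \<Omega>0 \<union> (\<lambda>x. ?b \<odot> x) ` \<Omega>0)"
  \<comment> \<open>The factor 2 pays for bounding a modulus by the real and the imaginary part, the
    factor \<open>R\<close> undoes the scaling.\<close>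
  define \<epsilon> where "\<epsilon> = min 1 (\<epsilon>0 / (2 * R))"
  show ?thesis
  proof (rule that[of \<Omega> \<epsilon>])
    show "finite \<Omega>" "\<Omega> \<noteq> {}" "\<Omega> \<subseteq> carr" using fin by (auto simp: \<Omega>_def closed)
    show "0 < \<epsilon>" "\<epsilon> \<le> 1" using \<epsilon>0 R by (auto simp: \<epsilon>_def)
    show "cs_norm A x \<le> 1" if "x \<in> \<Omega>" for x
    proof -
      have "cs_norm A (?a \<odot> y) \<le> 1 \<and> cs_norm A (?b \<odot> y) \<le> 1" if "y \<in> \<Omega>0" for y
        using le[OF that] R fin that by (auto simp: scale Real_Vector_Spaces.norm_mult norm_divide)
      then show ?thesis using that by (auto simp: \<Omega>_def N_zero)
    qed
    fix \<sigma> assume \<sigma>: "\<sigma> \<in> S"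
    obtain U where U: "U \<in> \<U>" "\<And>\<tau>. \<tau> \<in> S \<Longrightarrow> (\<forall>x\<in>\<Omega>0. cmod (\<tau> x - \<sigma> x) < \<epsilon>0) \<Longrightarrow> \<tau> \<in> U"
      using leb[OF \<sigma>] by blast
    have "\<tau> \<in> U" if \<tau>: "\<tau> \<in> S" "\<forall>x\<in>\<Omega>. \<bar>Re (\<tau> x) - Re (\<sigma> x)\<bar> < \<epsilon>" for \<tau>
    proof (rule U(2)[OF \<tau>(1)], rule ballI)
      fix x assume x: "x \<in> \<Omega>0"
      then have xc: "x \<in> carr" using fin by blast
      have l: "\<rho> (c \<odot> x) = c * \<rho> x" if "\<rho> \<in> S" for c \<rho>
        using lin[OF that] xc by (auto simp: lin_functional_def)
      have "\<bar>Re (\<tau> (?a \<odot> x)) - Re (\<sigma> (?a \<odot> x))\<bar> < \<epsilon>" "\<bar>Re (\<tau> (?b \<odot> x)) - Re (\<sigma> (?b \<odot> x))\<bar> < \<epsilon>"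
        using \<tau>(2) x by (auto simp: \<Omega>_def)
      then have "\<bar>Re (\<tau> x - \<sigma> x)\<bar> / R < \<epsilon>" "\<bar>Im (\<tau> x - \<sigma> x)\<bar> / R < \<epsilon>"
        using R unfolding l[OF \<tau>(1)] l[OF \<sigma>] by (simp_all add: diff_divide_distrib[symmetric])
      then have "\<bar>Re (\<tau> x - \<sigma> x)\<bar> < \<epsilon> * R" "\<bar>Im (\<tau> x - \<sigma> x)\<bar> < \<epsilon> * R"
        using R by (simp_all add: pos_divide_less_eq)
      moreover have "\<epsilon> * R \<le> \<epsilon>0 / (2 * R) * R" using R by (intro mult_right_mono) (auto simp: \<epsilon>_def)
      moreover have "\<epsilon>0 / (2 * R) * R = \<epsilon>0 / 2" using R by simp
      ultimately show "cmod (\<tau> x - \<sigma> x) < \<epsilon>0" using cmod_le[of "\<tau> x - \<sigma> x"] by linarith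
    qed
    then show "\<exists>U\<in>\<U>. \<forall>\<tau>\<in>S. (\<forall>x\<in>\<Omega>. \<bar>Re (\<tau> x) - Re (\<sigma> x)\<bar> < \<epsilon>) \<longrightarrow> \<tau> \<in> U" using U(1) by blast
  qed
qed

lemma lin_functional_linfun: "lin_functional A \<sigma> \<Longrightarrow> linfun \<sigma>"
  by (auto simp: lin_functional_def linfun_def)

text \<open>One functional realizes the set of positive signs, another its complement. In their
  difference the thresholds cancel and each coordinate contributes at least \<open>\<gamma>\<close>
  with the required sign; the difference has norm at most two, whence
  \<open>\<gamma> / 2\<close>.\<close>

lemma shattered_signed_sum_large:
  assumes K: "K \<subseteq> dual_ball A" and y: "\<And>p. p \<in> dom g \<Longrightarrow> y p \<in> carr"
    and sh: "shattered \<gamma> ((\<lambda>\<sigma> p. Re (\<sigma> (y p))) ` K) g"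
    and e: "bij_betw e {..<n} (dom g)" and \<epsilon>: "\<epsilon> \<in> signs n"
  shows "\<gamma> / 2 * real n \<le> cs_norm A (signed_sum (y \<circ> e) n \<epsilon>)"
proof -
  let ?P = "e ` {s\<in>{..<n}. \<epsilon> s = 1}"
  have edom: "e s \<in> dom g" if "s < n" for s using e that by (auto simp: bij_betw_def)
  have inj: "inj_on e {..<n}" using e by (simp add: bij_betw_def)
  have eP: "e s \<in> ?P \<longleftrightarrow> \<epsilon> s = 1" if "s < n" for s using inj that by (auto dest: inj_onD)
  have "?P \<subseteq> dom g" "dom g - ?P \<subseteq> dom g" using edom by auto
  have shat: "\<exists>\<sigma>\<in>K. \<forall>p\<in>dom g. (p \<in> P \<longrightarrow> the (g p) + \<gamma> \<le> Re (\<sigma> (y p))) \<and> (p \<notin> P \<longrightarrow> Re (\<sigma> (y p)) \<le> the (g p))"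
    if "P \<subseteq> dom g" for P
    using sh[unfolded shattered_def, rule_format, OF that] by auto
  obtain \<sigma> where \<sigma>1: "\<sigma> \<in> K"
    and s1: "\<And>p. p \<in> dom g \<Longrightarrow> (p \<in> ?P \<longrightarrow> the (g p) + \<gamma> \<le> Re (\<sigma> (y p))) \<and> (p \<notin> ?P \<longrightarrow> Re (\<sigma> (y p)) \<le> the (g p))"
    using shat[OF \<open>?P \<subseteq> dom g\<close>] by blast
  obtain \<sigma>' where \<sigma>2: "\<sigma>' \<in> K"
    and s2: "\<And>p. p \<in> dom g \<Longrightarrow> (p \<in> dom g - ?P \<longrightarrow> the (g p) + \<gamma> \<le> Re (\<sigma>' (y p))) \<and>
      (p \<notin> dom g - ?P \<longrightarrow> Re (\<sigma>' (y p)) \<le> the (g p))"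
    using shat[OF \<open>dom g - ?P \<subseteq> dom g\<close>] by blast
  note \<sigma> = \<sigma>1 \<sigma>2
  let ?Y = "signed_sum (y \<circ> e) n \<epsilon>"
  have yc: "y (e s) \<in> carr" if "s < n" for s using y edom that by blast
  have Y: "?Y \<in> carr" using yc by (intro vsum_closed) (simp add: closed)
  have val: "Re (\<rho> ?Y) = (\<Sum>s<n. \<epsilon> s * Re (\<rho> (y (e s))))" if "\<rho> \<in> K" for \<rho>
  proof -
    have lin: "linfun \<rho>" using K that by (intro lin_functional_linfun) (auto simp: dual_ball_def dual_space_def)
    have "\<rho> ?Y = (\<Sum>s<n. \<rho> (complex_of_real (\<epsilon> s) \<odot> (y \<circ> e) s))"
      by (rule linfun_vsum[OF lin]) (use yc in \<open>simp add: closed\<close>)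
    then show ?thesis using lin yc by (simp add: linfun_simps)
  qed
  have "(\<Sum>s<n. \<gamma>) \<le> (\<Sum>s<n. \<epsilon> s * (Re (\<sigma> (y (e s))) - Re (\<sigma>' (y (e s)))))"
  proof (rule sum_mono)
    fix s assume "s \<in> {..<n}"
    then have s: "s < n" by simp
    then have "\<epsilon> s = 1 \<or> \<epsilon> s = -1" using \<epsilon> by auto
    then show "\<gamma> \<le> \<epsilon> s * (Re (\<sigma> (y (e s))) - Re (\<sigma>' (y (e s))))"
      using s1[OF edom[OF s]] s2[OF edom[OF s]] eP[OF s] edom[OF s] by auto
  qed
  also have "\<dots> = Re (\<sigma> ?Y) - Re (\<sigma>' ?Y)"
    by (simp only: val[OF \<sigma>1] val[OF \<sigma>2] right_diff_distrib sum_subtractf)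
  also have "\<dots> \<le> cmod (\<sigma> ?Y) + cmod (\<sigma>' ?Y)"
    using complex_Re_le_cmod[of "\<sigma> ?Y"] abs_Re_le_cmod[of "\<sigma>' ?Y"] by linarith
  also have "\<dots> \<le> cs_norm A ?Y + cs_norm A ?Y"
    using \<sigma> K Y by (intro add_mono dual_ball_bound) auto
  finally show ?thesis by (simp add: mult.commute)
qed

lemma dual_map_funpow:
  assumes \<alpha>: "\<And>x. x \<in> carr \<Longrightarrow> \<alpha> x \<in> carr" and x: "x \<in> carr"
  shows "(dual_map A \<alpha> ^^ i) \<sigma> x = \<sigma> ((\<alpha> ^^ i) x)"
  using x
proof (induction i arbitrary: x)
  case (Suc i)
  have "(dual_map A \<alpha> ^^ Suc i) \<sigma> x = (dual_map A \<alpha> ^^ i) \<sigma> (\<alpha> x)"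
    using Suc.prems by (simp add: dual_map_def compose_def)
  also have "\<dots> = \<sigma> ((\<alpha> ^^ i) (\<alpha> x))" using Suc \<alpha> by blast
  finally show ?case by (simp add: funpow_swap1)
qed simp

end

section \<open>Entropy zero\<close>

context faithful_representation
begin

text \<open>A largest separated family of functionals provides reference orbits. Its size is
  controlled by the shattering bound, since small rank excludes large shattered sets, and by
  maximality every orbit stays close to a reference orbit at most times. Four parameters are tuned
  to cost a quarter of \<open>\<eta>\<close> each.\<close>

lemma htop_dual_map_eq_zero:
  assumes \<alpha>: "star_automorphism A \<alpha>" and ht: "ht A H \<pi> \<alpha> = 0"
    and S: "S \<subseteq> dual_ball A" and comp: "compact_space (weak_star A S)"
    and inv: "\<And>\<sigma>. \<sigma> \<in> S \<Longrightarrow> dual_map A \<alpha> \<sigma> \<in> S"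
  shows "htop (weak_star A S) (dual_map A \<alpha>) = 0"
proof (rule htop_eq_zeroI)
  let ?X = "weak_star A S" and ?T = "dual_map A \<alpha>"
  fix \<U> and \<eta> :: real assume \<U>: "finite_open_cover ?X \<U>" and \<eta>: "\<eta> > 0"
  have top: "topspace ?X = S"
    using S by (intro topspace_weak_star) (auto simp: dual_ball_def dual_space_def lin_functional_def)
  have \<alpha>c: "\<alpha> x \<in> A.carr" if "x \<in> A.carr" for x
    using \<alpha> that by (auto simp: star_automorphism_def star_hom_def lin_map_def)
  have \<alpha>i: "(\<alpha> ^^ i) x \<in> A.carr \<and> cs_norm A ((\<alpha> ^^ i) x) \<le> cs_norm A x" if "x \<in> A.carr" for i x
  proof (induction i)
    case (Suc i)
    then show ?case using automorphism_norm_le[OF \<alpha>, of "(\<alpha> ^^ i) x"] \<alpha>c by auto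
  qed (simp add: that)
  have Ti: "(?T ^^ i) \<sigma> \<in> S" if "\<sigma> \<in> S" for i \<sigma> using that by (induction i) (auto intro: inv)
  obtain \<Omega> and \<epsilon> :: real where \<Omega>: "finite \<Omega>" "\<Omega> \<noteq> {}" "\<Omega> \<subseteq> A.carr" "\<And>x. x \<in> \<Omega> \<Longrightarrow> cs_norm A x \<le> 1"
    and \<epsilon>: "0 < \<epsilon>" "\<epsilon> \<le> 1"
    and leb: "\<And>\<sigma>. \<sigma> \<in> S \<Longrightarrow> \<exists>U\<in>\<U>. \<forall>\<tau>\<in>S. (\<forall>x\<in>\<Omega>. \<bar>Re (\<tau> x) - Re (\<sigma> x)\<bar> < \<epsilon>) \<longrightarrow> \<tau> \<in> U"
    using A.dual_ball_lebesgue[OF comp S \<U>] by metis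
  define pick where "pick \<sigma> = (SOME U. U \<in> \<U> \<and> (\<forall>\<tau>\<in>S. (\<forall>x\<in>\<Omega>. \<bar>Re (\<tau> x) - Re (\<sigma> x)\<bar> < \<epsilon>) \<longrightarrow> \<tau> \<in> U))" for \<sigma>
  have pick: "pick \<sigma> \<in> \<U>" "\<And>\<tau>. \<tau> \<in> S \<Longrightarrow> (\<forall>x\<in>\<Omega>. \<bar>Re (\<tau> x) - Re (\<sigma> x)\<bar> < \<epsilon>) \<Longrightarrow> \<tau> \<in> pick \<sigma>" if "\<sigma> \<in> S" for \<sigma>
    using someI_ex[OF leb[OF that, unfolded Bex_def]] unfolding pick_def by blast+
  define m where "m = real (card \<Omega>)"
  have m: "m \<ge> 1" using \<Omega> by (simp add: m_def Suc_leI card_gt_0_iff)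
  define L where "L = real (card \<U>)"
  \<comment> \<open>The factor \<open>(1 + t * L) ^ n\<close> of the Hamming balls then costs at
    most \<open>\<eta> / 4\<close> per time; afterwards \<open>\<delta>1\<close> is chosen for the
    factor \<open>t powr (- (\<delta>1 * n))\<close>.\<close>
  define t where "t = min 1 (\<eta> / (4 * (L + 1)))"
  have t: "0 < t" "t \<le> 1" "t * L \<le> \<eta> / 4"
  proof -
    have L: "L \<ge> 0" by (simp add: L_def)
    show "0 < t" "t \<le> 1" using \<eta> L by (auto simp: t_def)
    have "t * L \<le> \<eta> / (4 * (L + 1)) * L" using L by (intro mult_right_mono) (auto simp: t_def)
    also have "\<dots> \<le> \<eta> / 4" using L \<eta> by (simp add: field_simps)
    finally show "t * L \<le> \<eta> / 4" .
  qed
  have param: "min 1 (\<eta> / (4 * c * (1 + l))) * l * c \<le> \<eta> / 4 \<and> 0 < min 1 (\<eta> / (4 * c * (1 + l)))"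
    if "l \<ge> 0" "c > 0" for l c :: real
  proof -
    have "min 1 (\<eta> / (4 * c * (1 + l))) * l * c \<le> \<eta> / (4 * c * (1 + l)) * l * c"
      using that by (intro mult_right_mono) auto
    also have "\<dots> = \<eta> / 4 * (l / (1 + l))" using that by (simp add: divide_simps)
    also have "\<dots> \<le> \<eta> / 4 * 1" using that \<eta> by (intro mult_left_mono) auto
    finally show ?thesis using that \<eta> by simp
  qed
  have ln_t: "ln (1 / t) \<ge> 0" using t by (intro ln_ge_zero) simp
  define \<delta>1 where "\<delta>1 = min 1 (\<eta> / (4 * 1 * (1 + ln (1 / t))))"
  have \<delta>1: "0 < \<delta>1" "\<delta>1 \<le> 1" "\<delta>1 * ln (1 / t) \<le> \<eta> / 4"
    using param[OF ln_t, of 1] by (auto simp: \<delta>1_def)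
  \<comment> \<open>There are \<open>n * m\<close> coordinates, so a proportion
    \<open>\<delta>\<close> of them amounts to \<open>\<delta>1 * n\<close>.\<close>
  define \<delta> where "\<delta> = \<delta>1 / m"
  have \<delta>: "0 < \<delta>" "\<delta> \<le> 1" using \<delta>1 m by (auto simp: \<delta>_def field_simps)
  obtain Kc q :: real where Kc: "Kc > 0" "q > 0" and
    "\<forall>(I :: (nat \<times> 'a) set) F t v. finite I \<longrightarrow> I \<noteq> {} \<longrightarrow> finite F \<longrightarrow> F \<noteq> {} \<longrightarrow> 0 < t \<longrightarrow> t \<le> 1 \<longrightarrow>
      (\<forall>f\<in>F. \<forall>i\<in>I. \<bar>f i\<bar> \<le> 1) \<longrightarrow>
      (\<forall>f\<in>F. \<forall>f'\<in>F. f \<noteq> f' \<longrightarrow> \<delta> * real (card I) \<le> real (card {i\<in>I. \<epsilon> \<le> \<bar>f i - f' i\<bar>})) \<longrightarrow>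
      (\<forall>g. dom g \<subseteq> I \<longrightarrow> shattered (\<epsilon>/2) F g \<longrightarrow> real (card (dom g)) \<le> v) \<longrightarrow>
      real (card F) \<le> (t powr (- v) * (1 + t * q) ^ card I) powr Kc"
    by (rule separated_family_bound[OF \<epsilon>(1) \<delta>, where 'i = "nat \<times> 'a"])
  note sep_bound = this(3)[rule_format]
  \<comment> \<open>\<open>t2\<close> and \<open>\<beta>\<close> do for the separated families what
    \<open>t\<close> and \<open>\<delta>1\<close> do for the Hamming balls, now with the exponent
    \<open>Kc\<close> and \<open>m\<close> coordinates per time.\<close>
  define t2 where "t2 = min 1 (\<eta> / (4 * Kc * (1 + m * q)))"
  have mq: "m * q \<ge> 0" using m Kc by simp
  have t2: "0 < t2" "t2 \<le> 1" "t2 * (m * q) * Kc \<le> \<eta> / 4" using param[OF mq Kc(1)] by (auto simp: t2_def)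
  have ln_t2: "ln (1 / t2) \<ge> 0" using t2 by (intro ln_ge_zero) simp
  define \<beta> where "\<beta> = min 1 (\<eta> / (4 * Kc * (1 + ln (1 / t2))))"
  have \<beta>: "0 < \<beta>" "\<beta> * ln (1 / t2) * Kc \<le> \<eta> / 4" using param[OF ln_t2 Kc(1)] by (auto simp: \<beta>_def)
  \<comment> \<open>Shattering with margin \<open>\<epsilon> / 2\<close> gives signed sums of norm
    at least \<open>\<epsilon> / 4\<close> per term. Half of this is \<open>c\<close>, and the other
    half is the tolerance of the approximation.\<close>
  define c where "c = \<epsilon> / 8"
  have c: "0 < c" "c \<le> 1" using \<epsilon> by (auto simp: c_def)
  \<comment> \<open>With this value \<open>c^2 * j / 16 \<le> 2 * \<kappa> * n\<close> says exactly
    \<open>j \<le> \<beta> * n\<close>.\<close>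
  define \<kappa> where "\<kappa> = \<beta> * c\<^sup>2 / 32"
  have \<kappa>: "\<kappa> > 0" using \<beta> c by (simp add: \<kappa>_def)
  \<comment> \<open>For these \<open>n\<close> the constant 3 of the rank estimate is at most
    \<open>exp (\<kappa> * n)\<close>.\<close>
  have "\<forall>\<^sub>F n in sequentially. ln 3 / \<kappa> \<le> real n"
    using filterlim_real_sequentially by (auto simp: filterlim_at_top)
  then show "\<forall>\<^sub>F n in sequentially. ln (real (cover_number ?X (iterated_join ?X ?T \<U> n))) \<le> \<eta> * real n"
    using eventually_small_rank[OF ht \<Omega>(1,3) c(1) \<kappa>] eventually_gt_at_top[of 0]
  proof eventually_elim
    case (elim n)
    obtain \<phi> \<psi> B r where cpa: "(\<phi>, \<psi>, B) \<in> CPA A H \<pi> (\<Union>i<n. (\<alpha> ^^ i) ` \<Omega>) c"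
      and rank: "has_rank B r" and r: "real (max r 1) \<le> exp (\<kappa> * real n)"
      using elim(2) by blast
    let ?I = "{..<n} \<times> \<Omega>"
    define y where "y p = (\<alpha> ^^ fst p) (snd p)" for p :: "nat \<times> 'a"
    define ev where "ev \<sigma> p = Re (\<sigma> (y p))" for \<sigma> p
    have finI: "finite ?I" and neI: "?I \<noteq> {}" using \<Omega> elim(3) by auto
    have cardI: "real (card ?I) = real n * m" by (simp add: card_cartesian_product m_def)
    have y: "y p \<in> A.carr" "cs_norm A (y p) \<le> 1" "y p \<in> (\<Union>i<n. (\<alpha> ^^ i) ` \<Omega>)" if "p \<in> ?I" for p
    proof -
      show "y p \<in> A.carr" using that \<alpha>i \<Omega> by (auto simp: y_def)
      have "cs_norm A (y p) \<le> cs_norm A (snd p)" using that \<alpha>i \<Omega> by (auto simp: y_def)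
      then show "cs_norm A (y p) \<le> 1" using \<Omega>(4)[of "snd p"] that by auto
      show "y p \<in> (\<Union>i<n. (\<alpha> ^^ i) ` \<Omega>)" using that by (intro UN_I[of "fst p"]) (auto simp: y_def)
    qed
    have ev1: "\<bar>ev \<sigma> p\<bar> \<le> 1" if "\<sigma> \<in> S" "p \<in> ?I" for \<sigma> p
      using A.dual_ball_bound[of \<sigma> "y p"] y[OF that(2)] S that abs_Re_le_cmod[of "\<sigma> (y p)"]
      unfolding ev_def by fastforce
    have shat: "real (card (dom g)) \<le> \<beta> * real n"
      if K: "K \<subseteq> S" and dom: "dom g \<subseteq> ?I" and sh: "shattered (\<epsilon>/2) (ev ` K) g" for K g
    proof -
      let ?j = "card (dom g)"
      have "finite (dom g)" using dom finI finite_subset by blast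
      then obtain e where e: "bij_betw e {..<?j} (dom g)"
        using ex_bij_betw_nat_finite atLeast0LessThan by metis
      have "e s \<in> dom g" if "s < ?j" for s using e that by (auto simp: bij_betw_def)
      then have eI: "e s \<in> ?I" if "s < ?j" for s using dom that by blast
      have "exp (c\<^sup>2 * real ?j / 16) \<le> 3 * real (max r 1)"
      proof (rule large_signed_sums_force_rank[OF cpa rank c(1), where y = "y \<circ> e"])
        show "(y \<circ> e) s \<in> (\<Union>i<n. (\<alpha> ^^ i) ` \<Omega>)" "(y \<circ> e) s \<in> A.carr" "cs_norm A ((y \<circ> e) s) \<le> 1"
          if "s < ?j" for s using y[OF eI[OF that]] by auto
        fix s assume s: "s \<in> signs ?j"
        have "\<epsilon> / 2 / 2 * real ?j \<le> cs_norm A (A.signed_sum (y \<circ> e) ?j s)"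
        proof (rule A.shattered_signed_sum_large[OF _ _ _ e s])
          show "K \<subseteq> dual_ball A" using K S by blast
          show "y p \<in> A.carr" if "p \<in> dom g" for p using y dom that by blast
          show "shattered (\<epsilon> / 2) ((\<lambda>\<sigma> p. Re (\<sigma> (y p))) ` K) g" using sh unfolding ev_def .
        qed
        then show "(c + c) * real ?j \<le> cs_norm A (A.signed_sum (y \<circ> e) ?j s)" by (simp add: c_def)
      qed (use c in auto)
      also have "\<dots> \<le> exp (ln 3) * exp (\<kappa> * real n)" using r by simp
      also have "\<dots> \<le> exp (\<kappa> * real n) * exp (\<kappa> * real n)"
      proof (rule mult_right_mono)
        have "ln 3 \<le> \<kappa> * real n" using elim(1) \<kappa> by (simp add: field_simps)
        then show "exp (ln 3) \<le> exp (\<kappa> * real n)" by (simp only: exp_le_cancel_iff)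
      qed simp
      also have "\<dots> = exp (2 * \<kappa> * real n)" by (simp flip: exp_add)
      finally have "c\<^sup>2 * real ?j / 16 \<le> 2 * \<kappa> * real n" by simp
      then show ?thesis using c by (simp add: \<kappa>_def field_simps)
    qed
    define sep where "sep K \<longleftrightarrow> finite K \<and> K \<subseteq> S \<and>
      (\<forall>\<sigma>\<in>K. \<forall>\<tau>\<in>K. \<sigma> \<noteq> \<tau> \<longrightarrow> \<delta> * real (card ?I) \<le> real (card {p\<in>?I. \<epsilon> \<le> \<bar>ev \<sigma> p - ev \<tau> p\<bar>}))" for K
    have sepD: "\<delta> * real (card ?I) \<le> real (card {p\<in>?I. \<epsilon> \<le> \<bar>ev \<sigma> p - ev \<tau> p\<bar>})"
      if "sep K" "\<sigma> \<in> K" "\<tau> \<in> K" "\<sigma> \<noteq> \<tau>" for K \<sigma> \<tau>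
      using that(1)[unfolded sep_def, THEN conjunct2, THEN conjunct2, rule_format, OF that(2-4)] .
    define M where "M = (t2 powr (- (\<beta> * real n)) * (1 + t2 * q) ^ card ?I) powr Kc"
    have posI: "\<delta> * real (card ?I) > 0" using \<delta> cardI m elim(3) by simp
    have bound: "real (card K) \<le> M" if K: "sep K" for K
    proof (cases "K = {}")
      case True
      then show ?thesis by (simp add: M_def)
    next
      case False
      \<comment> \<open>Separated functionals differ at some coordinate, so none is lost in passing
        to \<open>ev\<close>.\<close>
      have inj: "inj_on ev K"
      proof (rule inj_onI, rule ccontr)
        fix \<sigma> \<tau> assume *: "\<sigma> \<in> K" "\<tau> \<in> K" "ev \<sigma> = ev \<tau>" "\<sigma> \<noteq> \<tau>"
        then have "\<delta> * real (card ?I) \<le> real (card {p\<in>?I. \<epsilon> \<le> \<bar>ev \<sigma> p - ev \<tau> p\<bar>})" using sepD[OF K] by blast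
        then show False using posI *(3) \<epsilon> by simp
      qed
      have "real (card (ev ` K)) \<le> M"
        unfolding M_def
      proof (rule sep_bound)
        show "finite (ev ` K)" "ev ` K \<noteq> {}" using K False by (auto simp: sep_def)
        show "\<bar>f p\<bar> \<le> 1" if "f \<in> ev ` K" "p \<in> ?I" for f p using that K ev1 by (auto simp: sep_def)
        show "\<delta> * real (card ?I) \<le> real (card {p\<in>?I. \<epsilon> \<le> \<bar>f p - f' p\<bar>})"
          if ff: "f \<in> ev ` K" "f' \<in> ev ` K" "f \<noteq> f'" for f f'
        proof -
          obtain \<sigma> \<tau> where \<sigma>\<tau>: "\<sigma> \<in> K" "\<tau> \<in> K" "f = ev \<sigma>" "f' = ev \<tau>" using ff by blast
          then have "\<sigma> \<noteq> \<tau>" using ff(3) by blast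
          then show ?thesis unfolding \<sigma>\<tau>(3,4) by (rule sepD[OF K \<sigma>\<tau>(1,2)])
        qed
        show "real (card (dom g)) \<le> \<beta> * real n" if "dom g \<subseteq> ?I" "shattered (\<epsilon>/2) (ev ` K) g" for g
          using shat[of K g] K that by (simp add: sep_def)
      qed (use finI neI t2 in auto)
      then show ?thesis by (simp add: card_image[OF inj])
    qed
    \<comment> \<open>The bound \<open>M\<close> on the sizes makes a separated family of largest
      size exist.\<close>
    have "\<exists>K. sep K \<and> (\<forall>K'. sep K' \<longrightarrow> card K' \<le> card K)"
    proof -
      let ?R = "{k. \<exists>K. sep K \<and> card K = k}"
      have "?R \<subseteq> {..nat \<lfloor>M\<rfloor>}" using bound by (auto simp: le_nat_floor)
      then have "finite ?R" by (rule finite_subset) simp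
      moreover have "0 \<in> ?R" by (auto simp: sep_def intro!: exI[of _ "{}"])
      ultimately have "Max ?R \<in> ?R" "\<forall>k\<in>?R. k \<le> Max ?R"
        using Max_in[of ?R] Max_ge[of ?R] by blast+
      moreover from this(1) obtain K where "sep K" "card K = Max ?R" by blast
      ultimately show ?thesis by (intro exI[of _ K]) auto
    qed
    then obtain K where K: "sep K" and Kmax: "\<And>K'. sep K' \<Longrightarrow> card K' \<le> card K" by blast
    have Kfin: "finite K" and KS: "K \<subseteq> S" using K by (auto simp: sep_def)
    have dense: "\<exists>\<tau>\<in>K. real (card {p\<in>?I. \<epsilon> \<le> \<bar>ev \<sigma> p - ev \<tau> p\<bar>}) < \<delta> * real (card ?I)" if \<sigma>: "\<sigma> \<in> S" for \<sigma>
    proof (rule ccontr)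
      assume "\<not> ?thesis"
      then have far: "\<And>\<tau>. \<tau> \<in> K \<Longrightarrow> \<delta> * real (card ?I) \<le> real (card {p\<in>?I. \<epsilon> \<le> \<bar>ev \<sigma> p - ev \<tau> p\<bar>})"
        by force
      then have "\<sigma> \<notin> K" using posI \<epsilon> by fastforce
      moreover have "sep (insert \<sigma> K)"
      proof -
        have far': "\<delta> * real (card ?I) \<le> real (card {p\<in>?I. \<epsilon> \<le> \<bar>ev \<tau> p - ev \<sigma> p\<bar>})" if "\<tau> \<in> K" for \<tau>
          using far[OF that] by (simp only: abs_minus_commute[of "ev \<sigma> _"])
        show ?thesis unfolding sep_def
        proof (intro conjI ballI impI)
          fix \<rho> \<tau> assume "\<rho> \<in> insert \<sigma> K" "\<tau> \<in> insert \<sigma> K" "\<rho> \<noteq> \<tau>"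
          then consider "\<rho> = \<sigma>" "\<tau> \<in> K" | "\<tau> = \<sigma>" "\<rho> \<in> K" | "\<rho> \<in> K" "\<tau> \<in> K" by blast
          then show "\<delta> * real (card ?I) \<le> real (card {p\<in>?I. \<epsilon> \<le> \<bar>ev \<rho> p - ev \<tau> p\<bar>})"
          proof cases
            case 3
            then show ?thesis by (rule sepD[OF K _ _ \<open>\<rho> \<noteq> \<tau>\<close>])
          qed (use far far' in blast)+
        qed (use Kfin KS \<sigma> in auto)
      qed
      ultimately show False using Kmax[of "insert \<sigma> K"] Kfin by simp
    qed
    have "real (cover_number ?X (iterated_join ?X ?T \<U> n))
      \<le> real (card K) * (t powr (- (\<delta>1 * real n)) * (1 + t * real (card \<U>)) ^ n)"
    proof (rule cover_number_iterated_join_le[OF \<U> _ Kfin _ t(1,2), where g = "\<lambda>\<tau> i. if \<tau> \<in> S then pick ((?T ^^ i) \<tau>) else undefined"])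
      show "?T x \<in> topspace ?X" if "x \<in> topspace ?X" for x using that inv by (simp add: top)
      show "(if \<tau> \<in> S then pick ((?T ^^ i) \<tau>) else undefined) \<in> \<U>" if "\<tau> \<in> K" for \<tau> i
        using that KS pick(1)[OF Ti] by auto
      fix \<sigma> assume "\<sigma> \<in> topspace ?X"
      then have \<sigma>: "\<sigma> \<in> S" by (simp add: top)
      obtain \<tau> where \<tau>: "\<tau> \<in> K" "real (card {p\<in>?I. \<epsilon> \<le> \<bar>ev \<sigma> p - ev \<tau> p\<bar>}) < \<delta> * real (card ?I)"
        using dense[OF \<sigma>] by blast
      have \<tau>S: "\<tau> \<in> S" using \<tau> KS by blast
      let ?bad = "{p\<in>?I. \<epsilon> \<le> \<bar>ev \<sigma> p - ev \<tau> p\<bar>}"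
      \<comment> \<open>A time is bad only if some test element is bad at that time, so there are no
        more bad times than bad coordinates.\<close>
      have "{i \<in> {..<n}. (?T ^^ i) \<sigma> \<notin> pick ((?T ^^ i) \<tau>)} \<subseteq> fst ` ?bad"
      proof
        fix i assume "i \<in> {i \<in> {..<n}. (?T ^^ i) \<sigma> \<notin> pick ((?T ^^ i) \<tau>)}"
        then have i: "i < n" "(?T ^^ i) \<sigma> \<notin> pick ((?T ^^ i) \<tau>)" by auto
        then obtain x where x: "x \<in> \<Omega>" "\<not> \<bar>Re ((?T ^^ i) \<sigma> x) - Re ((?T ^^ i) \<tau> x)\<bar> < \<epsilon>"
          using pick(2)[OF Ti[OF \<tau>S] Ti[OF \<sigma>]] by blast
        have "x \<in> A.carr" using x \<Omega> by blast
        then have "(i, x) \<in> ?bad"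
          using x i by (auto simp: ev_def y_def A.dual_map_funpow[OF \<alpha>c])
        then show "i \<in> fst ` ?bad" by force
      qed
      then have "card {i \<in> {..<n}. (?T ^^ i) \<sigma> \<notin> pick ((?T ^^ i) \<tau>)} \<le> card (fst ` ?bad)"
        using finI by (intro card_mono) auto
      also have "\<dots> \<le> card ?bad" using finI by (intro card_image_le) auto
      finally have "real (card {i \<in> {..<n}. (?T ^^ i) \<sigma> \<notin> pick ((?T ^^ i) \<tau>)}) \<le> \<delta> * real (card ?I)" using \<tau>(2) by linarith
      also have "\<dots> = \<delta>1 * real n" using m by (simp add: cardI \<delta>_def)
      finally show "\<exists>\<tau>\<in>K. real (card {i \<in> {..<n}. (?T ^^ i) \<sigma> \<notin> (if \<tau> \<in> S then pick ((?T ^^ i) \<tau>) else undefined)}) \<le> \<delta>1 * real n"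
        using \<tau>(1) \<tau>S by (intro bexI[of _ \<tau>]) simp_all
    qed
    also have "\<dots> \<le> M * (t powr (- (\<delta>1 * real n)) * (1 + t * L) ^ n)"
      unfolding L_def using bound[OF K] t by (intro mult_right_mono) auto
    finally have cn: "real (cover_number ?X (iterated_join ?X ?T \<U> n)) \<le> M * (t powr (- (\<delta>1 * real n)) * (1 + t * L) ^ n)" .
    have L0: "L \<ge> 0" by (simp add: L_def)
    have pos: "M > 0" "t powr (- (\<delta>1 * real n)) > 0" "(1 + t * L) ^ n > 0"
    proof -
      show "M > 0" unfolding M_def using t2 Kc
        by (metis add_pos_pos mult_pos_pos powr_gt_zero zero_less_one zero_less_power less_irrefl)
      show "t powr (- (\<delta>1 * real n)) > 0" using t by simp
      show "(1 + t * L) ^ n > 0" using t L0 by (simp add: add_pos_nonneg)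
    qed
    have ln1: "ln ((1 + x) ^ k) \<le> real k * x" if "x \<ge> 0" for x :: real and k
      using ln_add_one_self_le_self[OF that] that by (simp add: ln_realpow mult_left_mono)
    have lnM: "ln M \<le> \<eta> / 2 * real n"
    proof -
      have p: "(1 + t2 * q) ^ card ?I > 0" using t2 Kc by (simp add: add_pos_pos)
      have "ln M = Kc * (\<beta> * real n * ln (1 / t2) + ln ((1 + t2 * q) ^ card ?I))"
        unfolding M_def using t2 p by (simp add: ln_powr ln_mult_pos ln_div)
      also have "\<dots> \<le> Kc * (\<beta> * real n * ln (1 / t2) + real (card ?I) * (t2 * q))"
        using Kc t2 by (intro mult_left_mono add_left_mono ln1) auto
      also have "\<dots> = real n * (\<beta> * ln (1 / t2) * Kc) + real n * (t2 * (m * q) * Kc)"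
        unfolding cardI by (simp add: algebra_simps)
      also have "\<dots> \<le> real n * (\<eta> / 4) + real n * (\<eta> / 4)"
        using \<beta> t2 by (intro add_mono mult_left_mono) auto
      finally show ?thesis by (simp add: mult.commute)
    qed
    show ?case
    proof (cases "cover_number ?X (iterated_join ?X ?T \<U> n) = 0")
      case True
      then show ?thesis using \<eta> by simp
    next
      case False
      then have "ln (real (cover_number ?X (iterated_join ?X ?T \<U> n))) \<le> ln (M * (t powr (- (\<delta>1 * real n)) * (1 + t * L) ^ n))"
        using cn by (intro ln_mono) auto
      also have "\<dots> = ln M + (\<delta>1 * real n * ln (1 / t) + ln ((1 + t * L) ^ n))"
        using pos t by (simp add: ln_mult_pos ln_powr ln_div)
      also have "\<dots> \<le> \<eta> / 2 * real n + (real n * (\<eta> / 4) + real n * (\<eta> / 4))"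
      proof (intro add_mono lnM)
        show "\<delta>1 * real n * ln (1 / t) \<le> real n * (\<eta> / 4)"
          using mult_left_mono[OF \<delta>1(3), of "real n"] by (simp add: mult_ac)
        have "ln ((1 + t * L) ^ n) \<le> real n * (t * L)" using t L0 by (intro ln1) simp
        also have "\<dots> \<le> real n * (\<eta> / 4)" using t by (intro mult_left_mono) auto
        finally show "ln ((1 + t * L) ^ n) \<le> real n * (\<eta> / 4)" .
      qed
      finally show ?thesis by (simp add: mult.commute)
    qed
  qed
qed

end

section \<open>Weak* compactness of the dual ball, the quasi-states and the states\<close>

context cstar_algebra
begin

abbreviation pointwise :: "('a \<Rightarrow> complex) topology" where
  "pointwise \<equiv> product_topology (\<lambda>_. euclidean) carr"

lemma closedin_pointwise_Ball:
  assumes "\<And>i. i \<in> I \<Longrightarrow> closedin pointwise {\<sigma> \<in> extensional carr. R i \<sigma>}"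
  shows "closedin pointwise {\<sigma> \<in> extensional carr. \<forall>i\<in>I. R i \<sigma>}"
\<comment> \<open>An intersection over the empty index set would not be confined to extensional
  functions.\<close>
proof (cases "I = {}")
  case True
  have "closedin pointwise (topspace pointwise)" by (rule closedin_topspace)
  then show ?thesis using True by (simp add: PiE_def)
next
  case False
  then have "{\<sigma> \<in> extensional carr. \<forall>i\<in>I. R i \<sigma>} = (\<Inter>i\<in>I. {\<sigma> \<in> extensional carr. R i \<sigma>})" by auto
  then show ?thesis using assms False by (auto intro!: closedin_Inter)
qed

lemma closedin_pointwise_preimage:
  assumes "continuous_map pointwise euclidean f" "closed (Z :: complex set)"
  shows "closedin pointwise {\<sigma> \<in> extensional carr. f \<sigma> \<in> Z}"
  using closedin_continuous_map_preimage[OF assms(1), of Z] assms(2) by (simp add: PiE_def)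

lemma continuous_map_evaluation: "x \<in> carr \<Longrightarrow> continuous_map pointwise euclidean (\<lambda>\<sigma>. \<sigma> x)"
  by (rule continuous_map_product_projection)

text \<open>Banach-Alaoglu: by Tychonoff the product of the closed discs of radius
  \<open>cs_norm A x\<close> is compact, and additivity and homogeneity are closed conditions on
  it.\<close>

lemma compactin_dual_ball: "compactin pointwise (dual_ball A)"
proof -
  let ?B = "Pi\<^sub>E carr (\<lambda>x. cball 0 (cs_norm A x) :: complex set)"
  let ?E1 = "{\<sigma> \<in> extensional carr. \<forall>p\<in>carr \<times> carr. \<sigma> (fst p \<oplus> snd p) - \<sigma> (fst p) - \<sigma> (snd p) \<in> {0}}"
  let ?E2 = "{\<sigma> \<in> extensional carr. \<forall>p\<in>UNIV \<times> carr. \<sigma> (fst p \<odot> snd p) - fst p * \<sigma> (snd p) \<in> {0}}"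
  have "compactin pointwise ?B" by (simp add: compactin_PiE)
  moreover have "closedin pointwise ?E1"
    by (intro closedin_pointwise_Ball closedin_pointwise_preimage continuous_map_diff continuous_map_evaluation)
      (auto simp: closed)
  moreover have "closedin pointwise ?E2"
  proof (intro closedin_pointwise_Ball closedin_pointwise_preimage continuous_map_diff)
    fix p assume p: "p \<in> (UNIV :: complex set) \<times> carr"
    show "continuous_map pointwise euclidean (\<lambda>\<sigma>. \<sigma> (fst p \<odot> snd p))"
      using p by (intro continuous_map_evaluation) (auto simp: closed)
    have "continuous_map pointwise euclidean ((\<lambda>z. fst p * z) \<circ> (\<lambda>\<sigma>. \<sigma> (snd p)))"
      using p by (intro continuous_map_compose[OF continuous_map_evaluation])
        (auto simp: continuous_map_iff_continuous2 intro!: continuous_intros)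
    then show "continuous_map pointwise euclidean (\<lambda>\<sigma>. fst p * \<sigma> (snd p))" by (simp add: o_def)
  qed auto
  ultimately have "compactin pointwise (?B \<inter> ?E1 \<inter> ?E2)" by (intro compact_Int_closedin)
  also have "?B \<inter> ?E1 \<inter> ?E2 = dual_ball A"
  proof
    show "?B \<inter> ?E1 \<inter> ?E2 \<subseteq> dual_ball A"
      by (auto intro!: dual_ballI simp: lin_functional_def algebra_simps PiE_def Pi_def)
    show "dual_ball A \<subseteq> ?B \<inter> ?E1 \<inter> ?E2"
    proof
      fix \<sigma> assume \<sigma>: "\<sigma> \<in> dual_ball A"
      then have "lin_functional A \<sigma>" by (simp add: dual_ball_def dual_space_def)
      then show "\<sigma> \<in> ?B \<inter> ?E1 \<inter> ?E2"
        using dual_ball_bound[OF \<sigma>] by (auto simp: lin_functional_def PiE_def)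
    qed
  qed
  finally show ?thesis .
qed

lemma closedin_positive: "closedin pointwise {\<sigma> \<in> extensional carr. \<forall>x\<in>carr. \<sigma> (x\<^sup>\<star> \<otimes> x) \<in> \<real>\<^sub>\<ge>\<^sub>0}"
  by (intro closedin_pointwise_Ball closedin_pointwise_preimage continuous_map_evaluation closed_nonneg_Reals_complex)
    (auto simp: cs_closed)

lemma quasi_states_eq: "quasi_states A = dual_ball A \<inter> {\<sigma> \<in> extensional carr. \<forall>x\<in>carr. \<sigma> (x\<^sup>\<star> \<otimes> x) \<in> \<real>\<^sub>\<ge>\<^sub>0}"
  by (auto simp: quasi_states_def dual_ball_def dual_space_def positive_functional_def lin_functional_def)

lemma compactin_quasi_states: "compactin pointwise (quasi_states A)"
  unfolding quasi_states_eq by (intro compact_Int_closedin compactin_dual_ball closedin_positive)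

lemma unit_star:
  assumes e: "is_cs_unit A e"
  shows "e\<^sup>\<star> = e"
proof -
  have ec: "e \<in> carr" "e \<otimes> e\<^sup>\<star> = e\<^sup>\<star>" using e by (auto simp: is_cs_unit_def star_closed)
  have "e = (e \<otimes> e\<^sup>\<star>)\<^sup>\<star>" using ec by (simp add: star_star)
  also have "\<dots> = e \<otimes> e\<^sup>\<star>" using ec(1) by (simp add: star_mult star_star star_closed)
  finally show ?thesis using ec(2) by simp
qed

text \<open>\<open>states\<close> demands no boundedness, so it has to come from positivity. For
  contractive \<open>x\<close> the element \<open>e - ?z\<close> is the square of the self-adjoint
  \<open>e - y\<close>, which bounds \<open>\<sigma> ?z\<close> by one; the Cauchy-Schwarz
  inequality for \<open>\<sigma>\<close> does the rest.\<close>

lemma state_in_dual_ball: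
  assumes e: "is_cs_unit A e" and \<sigma>: "positive_functional A \<sigma>" "\<sigma> e = 1"
  shows "\<sigma> \<in> dual_ball A"
proof (rule dual_ballI)
  show lf: "lin_functional A \<sigma>" using \<sigma> by (simp add: positive_functional_def)
  note lin = lin_functional_linfun[OF lf]
  have pos: "\<sigma> (x\<^sup>\<star> \<otimes> x) \<in> \<real>\<^sub>\<ge>\<^sub>0" if "x \<in> carr" for x using \<sigma> that by (simp add: positive_functional_def)
  have ec: "e \<in> carr" and eu: "\<And>x. x \<in> carr \<Longrightarrow> e \<otimes> x = x \<and> x \<otimes> e = x" using e by (auto simp: is_cs_unit_def)
  have es: "e\<^sup>\<star> = e" by (rule unit_star[OF e])
  have le1: "cmod (\<sigma> x) \<le> 1" if x: "x \<in> carr" "cs_norm A x \<le> 1" for x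
  proof -
    let ?z = "x\<^sup>\<star> \<otimes> x"
    have z: "?z \<in> carr" "?z\<^sup>\<star> = ?z" "cs_norm A ?z \<le> 1"
      using x nonneg by (simp_all add: cs_closed star_mult star_star cstar_identity power_le_one)
    obtain y where y: "y \<in> carr" "2 \<odot> y = ?z \<oplus> y \<otimes> y" "y\<^sup>\<star> = y"
      using sqrt_one_minus[OF z(1,3)] z(2) by metis
    have "(e \<ominus> y)\<^sup>\<star> \<otimes> (e \<ominus> y) = e \<ominus> 2 \<odot> y \<oplus> y \<otimes> y"
      by (rule lin_eqI) (use y(1,3) ec es eu in \<open>auto simp: linfun_simps cs_closed expand\<close>)
    also have "\<dots> = e \<ominus> ?z"
      unfolding y(2) by (rule lin_eqI) (use y(1) ec z(1) in \<open>auto simp: linfun_simps cs_closed\<close>)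
    finally have "\<sigma> (e \<ominus> ?z) \<in> \<real>\<^sub>\<ge>\<^sub>0" using pos[of "e \<ominus> y"] y ec by (simp add: cs_closed)
    then have zle: "Re (\<sigma> ?z) \<le> 1" using \<sigma>(2) ec z by (simp add: linfun_minus[OF lin] complex_nonneg_Reals_iff)
    have exp: "\<sigma> ((x \<oplus> c \<odot> e)\<^sup>\<star> \<otimes> (x \<oplus> c \<odot> e)) = \<sigma> ?z + c * \<sigma> (x\<^sup>\<star>) + cnj c * \<sigma> x + cnj c * c" for c
    proof -
      have "(x \<oplus> c \<odot> e)\<^sup>\<star> \<otimes> (x \<oplus> c \<odot> e) = ?z \<oplus> c \<odot> x\<^sup>\<star> \<oplus> cnj c \<odot> x \<oplus> (cnj c * c) \<odot> e"
        by (rule lin_eqI) (use x ec es eu in \<open>auto simp: linfun_simps cs_closed expand algebra_simps\<close>)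
      then show ?thesis using x ec \<sigma>(2) z by (simp add: linfun_simps[OF lin] cs_closed)
    qed
    have nn: "\<sigma> ?z + c * \<sigma> (x\<^sup>\<star>) + cnj c * \<sigma> x + cnj c * c \<in> \<real>\<^sub>\<ge>\<^sub>0" for c
      using pos[of "x \<oplus> c \<odot> e"] x ec unfolding exp by (simp add: closed)
    have "Im (\<sigma> ?z) = 0" using pos[OF x(1)] by (simp add: complex_nonneg_Reals_iff)
    \<comment> \<open>The imaginary part of the expansion vanishes at \<open>c = 1\<close> and at
      \<open>c = i\<close>; together this says that \<open>\<sigma>\<close> is hermitian.\<close>
    then have herm: "\<sigma> (x\<^sup>\<star>) = cnj (\<sigma> x)"
      using nn[of 1] nn[of \<i>] by (simp add: complex_nonneg_Reals_iff complex_eq_iff)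
    \<comment> \<open>The choice \<open>c = - \<sigma> x\<close> completes the square.\<close>
    have "0 \<le> Re (\<sigma> ?z) - (cmod (\<sigma> x))\<^sup>2"
    proof -
      have "\<sigma> ?z + - \<sigma> x * cnj (\<sigma> x) + cnj (- \<sigma> x) * \<sigma> x + cnj (- \<sigma> x) * (- \<sigma> x)
          = \<sigma> ?z - complex_of_real ((cmod (\<sigma> x))\<^sup>2)"
        unfolding complex_norm_square by (simp add: algebra_simps)
      then have "\<sigma> ?z - complex_of_real ((cmod (\<sigma> x))\<^sup>2) \<in> \<real>\<^sub>\<ge>\<^sub>0"
        using nn[of "- \<sigma> x"] unfolding herm by metis
      then show ?thesis by (simp add: complex_nonneg_Reals_iff)
    qed
    then have "(cmod (\<sigma> x))\<^sup>2 \<le> 1\<^sup>2" using zle by simp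
    then show ?thesis by (rule power2_le_imp_le) simp
  qed
  fix x assume x: "x \<in> carr"
  show "cmod (\<sigma> x) \<le> cs_norm A x"
  proof (cases "cs_norm A x = 0")
    case True
    then have "x = cv_zero A" using definite x by blast
    then show ?thesis using linfun_zero[OF lin] True by simp
  next
    case False
    then have p: "cs_norm A x > 0" using nonneg[OF x] by simp
    let ?r = "complex_of_real (1 / cs_norm A x)"
    have "cmod (\<sigma> (?r \<odot> x)) \<le> 1" using x p by (intro le1) (auto simp: closed scale norm_divide)
    then show ?thesis using p linfun_scale[OF lin x] by (simp add: Real_Vector_Spaces.norm_mult norm_divide)
  qed
qed

lemma states_eq:
  assumes e: "is_cs_unit A e"
  shows "states A e = dual_ball A \<inter> {\<sigma> \<in> extensional carr. \<forall>x\<in>carr. \<sigma> (x\<^sup>\<star> \<otimes> x) \<in> \<real>\<^sub>\<ge>\<^sub>0} \<inter> {\<sigma> \<in> extensional carr. \<sigma> e \<in> {1}}"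
  using state_in_dual_ball[OF e]
  by (auto simp: states_def positive_functional_def dual_ball_def dual_space_def lin_functional_def)

lemma compactin_states:
  assumes e: "is_cs_unit A e"
  shows "compactin pointwise (states A e)"
  unfolding states_eq[OF e] using e
  by (intro compact_Int_closedin compactin_dual_ball closedin_positive closedin_pointwise_preimage continuous_map_evaluation)
    (auto simp: is_cs_unit_def)

text \<open>\<open>\<alpha> e\<close> is a unit for the range of \<open>\<alpha>\<close>, which is
  the whole algebra. The invariance of the state space rests on this.\<close>

lemma automorphism_unit:
  assumes \<alpha>: "star_automorphism A \<alpha>" and e: "is_cs_unit A e"
  shows "\<alpha> e = e"
proof -
  have ec: "e \<in> carr" and eu: "\<And>x. x \<in> carr \<Longrightarrow> e \<otimes> x = x \<and> x \<otimes> e = x" using e by (auto simp: is_cs_unit_def)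
  have hom: "\<And>x y. x \<in> carr \<Longrightarrow> y \<in> carr \<Longrightarrow> \<alpha> (x \<otimes> y) = \<alpha> x \<otimes> \<alpha> y" and bij: "bij_betw \<alpha> carr carr"
    using \<alpha> by (auto simp: star_automorphism_def star_hom_def)
  obtain u where u: "u \<in> carr" "\<alpha> u = e" using bij ec by (metis bij_betw_iff_bijections)
  have "\<alpha> e \<in> carr" using bij ec by (auto simp: bij_betw_def)
  then have "\<alpha> e = \<alpha> e \<otimes> \<alpha> u" using eu u by simp
  also have "\<dots> = e" using hom[OF ec u(1)] eu[OF u(1)] u(2) by simp
  finally show ?thesis .
qed

end

lemma (in faithful_representation) dual_map_dual_ball:
  assumes \<alpha>: "star_automorphism A \<alpha>" and \<sigma>: "\<sigma> \<in> dual_ball A"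
  shows "dual_map A \<alpha> \<sigma> \<in> dual_ball A"
proof (rule A.dual_ballI)
  have \<alpha>h: "\<And>x. x \<in> A.carr \<Longrightarrow> \<alpha> x \<in> A.carr" "\<And>x y. x \<in> A.carr \<Longrightarrow> y \<in> A.carr \<Longrightarrow> \<alpha> (x \<oplus> y) = \<alpha> x \<oplus> \<alpha> y"
    "\<And>c x. x \<in> A.carr \<Longrightarrow> \<alpha> (c \<odot> x) = c \<odot> \<alpha> x"
    using \<alpha> by (auto simp: star_automorphism_def star_hom_def lin_map_def)
  have lin: "lin_functional A \<sigma>" using \<sigma> by (simp add: dual_ball_def dual_space_def)
  show "lin_functional A (dual_map A \<alpha> \<sigma>)"
    using lin \<alpha>h by (simp add: lin_functional_def dual_map_def compose_def A.closed)
  show "cmod (dual_map A \<alpha> \<sigma> x) \<le> cs_norm A x" if x: "x \<in> A.carr" for x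
    using A.dual_ball_bound[OF \<sigma> \<alpha>h(1)[OF x]] automorphism_norm_le[OF \<alpha> x] x
    by (simp add: dual_map_def compose_def)
qed

lemma (in faithful_representation) dual_map_positive:
  assumes \<alpha>: "star_automorphism A \<alpha>"
    and \<sigma>: "\<forall>x\<in>A.carr. \<sigma> (x\<^sup>\<star> \<otimes> x) \<in> \<real>\<^sub>\<ge>\<^sub>0"
  shows "\<forall>x\<in>A.carr. dual_map A \<alpha> \<sigma> (x\<^sup>\<star> \<otimes> x) \<in> \<real>\<^sub>\<ge>\<^sub>0"
  using \<alpha> \<sigma> by (auto simp: star_automorphism_def star_hom_def lin_map_def dual_map_def compose_def A.cs_closed)

theorem theorem3p3:
  fixes A :: "'a cstar" and \<alpha> :: "'a \<Rightarrow> 'a"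
    and H :: "'h hilb" and \<pi> :: "'a \<Rightarrow> 'h \<Rightarrow> 'h"
  assumes "cstar_algebra A" and "cs_separable A" and "exact_cstar A"
    and "star_automorphism A \<alpha>"
    and "hilbert_space H" and "faithful_rep A H \<pi>"
    and "ht A H \<pi> \<alpha> = 0"
  shows "htop (weak_star A (dual_ball A)) (dual_map A \<alpha>) = 0 \<and>
    htop (weak_star A (quasi_states A)) (dual_map A \<alpha>) = 0 \<and>
    (\<forall>e. is_cs_unit A e \<longrightarrow> htop (weak_star A (states A e)) (dual_map A \<alpha>) = 0)"
proof -
  interpret faithful_representation A H \<pi>
    by (intro faithful_representation.intro cstar_representation.intro cstar_representation_axioms.intro
        faithful_representation_axioms.intro assms(1,5)) (use assms(6) in \<open>auto simp: faithful_rep_def\<close>)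
  \<comment> \<open>It remains to see that each of the three spaces is a compact invariant subset of
    the dual ball.\<close>
  note zero = htop_dual_map_eq_zero[OF assms(4,7)]
  have comp: "compact_space (weak_star A S)" if "compactin A.pointwise S" for S
    using that unfolding weak_star_def by (rule compact_space_subtopology)
  have ext: "dual_map A \<alpha> \<sigma> \<in> extensional A.carr" for \<sigma> by (simp add: dual_map_def compose_def)
  have ball: "dual_map A \<alpha> \<sigma> \<in> dual_ball A" if "\<sigma> \<in> dual_ball A" for \<sigma>
    using dual_map_dual_ball[OF assms(4) that] .
  show ?thesis
  proof (intro conjI allI impI)
    show "htop (weak_star A (dual_ball A)) (dual_map A \<alpha>) = 0"
      by (rule zero) (auto intro: comp A.compactin_dual_ball ball)
    show "htop (weak_star A (quasi_states A)) (dual_map A \<alpha>) = 0"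
    proof (rule zero)
      show "quasi_states A \<subseteq> dual_ball A" unfolding A.quasi_states_eq by blast
      show "dual_map A \<alpha> \<sigma> \<in> quasi_states A" if "\<sigma> \<in> quasi_states A" for \<sigma>
        using that ball ext dual_map_positive[OF assms(4)] unfolding A.quasi_states_eq by blast
    qed (rule comp[OF A.compactin_quasi_states])
    fix e assume e: "is_cs_unit A e"
    show "htop (weak_star A (states A e)) (dual_map A \<alpha>) = 0"
    proof (rule zero)
      show "states A e \<subseteq> dual_ball A" unfolding A.states_eq[OF e] by blast
      show "dual_map A \<alpha> \<sigma> \<in> states A e" if \<sigma>: "\<sigma> \<in> states A e" for \<sigma>
      proof -
        have "dual_map A \<alpha> \<sigma> e = \<sigma> e"
          using A.automorphism_unit[OF assms(4) e] e by (simp add: dual_map_def compose_def is_cs_unit_def)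
        then show ?thesis
          using \<sigma> ball ext dual_map_positive[OF assms(4)] unfolding A.states_eq[OF e] by simp
      qed
    qed (rule comp[OF A.compactin_states[OF e]])
  qed
qed

end
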